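(* For every $p>3$ there is a constant $c_p>0$, depending only on $p$, with the following property. Let $\Gamma$ be a family of curves in $\mathbb{R}^2$ which contains an isometric copy of every set of the form $$G_f := \{(x,f(x)) : x\in[0,1]\},$$ where $f\colon[0,1]\to[0,1]$ is $1$-Lipschitz. That is, for every such $f$ there is an isometry $\iota$ of $\mathbb{R}^2$ with $\iota(G_f)\in\Gamma$. Then $\mathrm{mod}_p(\Gamma)\geq c_p$.
   Context: The ambient space is $\mathbb{R}^2$ with Lebesgue measure $\mathcal{L}^2$, and $\mathcal{H}^1$ denotes one-dimensional Hausdorff measure. For a family $\Gamma$ of curves and $1\le p<\infty$, the $p$-modulus is $$\mathrm{mod}_p(\Gamma)=\inf_{\rho\in\mathrm{adm}(\Gamma)}\int_{\mathbb{R}^2}\rho^p\,d\mathcal{L}^2 .$$ Here $\mathrm{adm}(\Gamma)$ is the set of all Borel functions $\rho\colon\mathbb{R}^2\to[0,\infty]$ such that $\int_\gamma\rho\,d\mathcal{H}^1\ge 1$ for every locally rectifiable $\gamma\in\Gamma$. *)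

theory Defs
  imports "HOL-Analysis.Analysis"
begin

type_synonym R2 = "real \<times> real"

text \<open>One-dimensional Hausdorff measure on the plane (Caratheodory construction,
  normalised so that it coincides with length on segments): for \<delta> > 0,
  H1_delta \<delta> A is the infimum of the sums of diameters of countable covers of A by
  bounded sets of diameter at most \<delta>; H1 A is the supremum over \<delta> > 0.\<close>

definition H1_delta :: "real \<Rightarrow> R2 set \<Rightarrow> ennreal" where
  "H1_delta \<delta> A = (INF C \<in> {C :: nat \<Rightarrow> R2 set. A \<subseteq> (\<Union>i. C i) \<and>
        (\<forall>i. bounded (C i) \<and> diameter (C i) \<le> \<delta>)}. (\<Sum>i. ennreal (diameter (C i))))"

definition H1 :: "R2 set \<Rightarrow> ennreal" where
  "H1 A = (SUP \<delta> \<in> {0<..}. H1_delta \<delta> A)"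

definition H1_on :: "R2 set \<Rightarrow> R2 measure" where
  "H1_on \<gamma> = measure_of UNIV (sets borel) (\<lambda>A. H1 (A \<inter> \<gamma>))"

definition curve_integral_H1 :: "R2 set \<Rightarrow> (R2 \<Rightarrow> ennreal) \<Rightarrow> ennreal" where
  "curve_integral_H1 \<gamma> \<rho> = (\<integral>\<^sup>+ x. \<rho> x \<partial>(H1_on \<gamma>))"

definition is_curve :: "R2 set \<Rightarrow> bool" where
  "is_curve C \<longleftrightarrow> (\<exists>I (g :: real \<Rightarrow> R2). is_interval I \<and> I \<noteq> {} \<and> continuous_on I g \<and> C = g ` I)"

definition loc_rectifiable :: "R2 set \<Rightarrow> bool" where
  "loc_rectifiable \<gamma> \<longleftrightarrow> (\<forall>K. compact K \<longrightarrow> H1 (\<gamma> \<inter> K) < \<infinity>)"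

definition ennpow :: "real \<Rightarrow> ennreal \<Rightarrow> ennreal" where
  "ennpow p t = (if t = \<infinity> then \<infinity> else ennreal (enn2real t powr p))"

definition admissible :: "R2 set set \<Rightarrow> (R2 \<Rightarrow> ennreal) set" where
  "admissible \<Gamma> = {\<rho>. \<rho> \<in> borel_measurable borel \<and>
      (\<forall>\<gamma>\<in>\<Gamma>. loc_rectifiable \<gamma> \<longrightarrow> curve_integral_H1 \<gamma> \<rho> \<ge> 1)}"

definition modulus :: "real \<Rightarrow> R2 set set \<Rightarrow> ennreal" where
  "modulus p \<Gamma> = (INF \<rho> \<in> admissible \<Gamma>. \<integral>\<^sup>+ x. ennpow p (\<rho> x) \<partial>lborel)"

definition graph01 :: "(real \<Rightarrow> real) \<Rightarrow> R2 set" where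
  "graph01 f = {(x, f x) | x. x \<in> {0..1}}"

definition isometry_R2 :: "(R2 \<Rightarrow> R2) \<Rightarrow> bool" where
  "isometry_R2 \<iota> \<longleftrightarrow> (\<forall>x y. dist (\<iota> x) (\<iota> y) = dist x y)"

end

theory Submission
  imports Defs "HOL-Probability.Probability" "HOL-Real_Asymp.Real_Asymp"
begin

text \<open>Given \<open>\<rho>\<close> with small \<open>\<integral>\<rho>\<^sup>p\<close>, one constructs a single 1-Lipschitz graph every isometric copy of which
  has \<open>\<rho>\<close>-length below 1. Up to an additive constant, \<open>\<rho>\<close> is dominated by a lower semicontinuous
  \<open>\<int>\<^sup>2\<close>-periodic function of the same integrability, so only isometries with translation part in the
  unit square matter. The graph is a limit of nested strips of widths \<open>w, w\<^sup>2, w\<^sup>4, \<dots>\<close>. Inside a strip of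
  width \<open>w\<close> the next one, of width \<open>w\<^sup>2\<close>, follows a random path whose vertical position at every point
  is uniformly distributed, so for each isometry the mean of \<open>\<rho>\<close> over the strip is almost preserved
  in expectation. The path consists of about \<open>1/w\<close> pieces which are independent within each parity class,
  and for \<open>p > 3\<close> each piece contributes at most a positive power of \<open>w\<close>; by an exponential moment
  bound the mean increases by more than a small power of \<open>w\<close> only with probability
  \<open>exp (- w powr (- \<epsilon>))\<close>. This beats the number of isometries in a \<open>w\<^sup>6\<close>-net, which is polynomial
  in \<open>1/w\<close>, so some path works for all isometries, and the errors are summable over the scales.
  Finally, lower semicontinuity and Fatou's lemma carry the bound over to the limit graph.\<close>

section \<open>Hausdorff measure of Lipschitz curves\<close>

text \<open>The exponent 3 comes from one piece of the path. Slopes of order 1 inside a strip of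
  width \<open>w\<close> allow about \<open>1/w\<close> pieces; each has length about
  \<open>w\<close> and width w^2, hence area about w^3. By Hoelder a density of unit norm in L^q has
  mass at most w^(3 - 3/q) there, which is w^(1 - 3/q) after division by w^2. This is a positive
  power of \<open>w\<close> exactly when q > 3, and then averaging over independent pieces gives
  concentration. The number \<eta> = (1 - 3/q)/8 divides this gain: one \<eta> lowers the slope to
  w^\<eta>, so that the slopes added at all scales are summable, and the rest pays for
  concentration. A union bound needs finitely many isometries, although the density has no modulus
  of continuity. A change of isometry is therefore measured by the small area that the moved strip
  gains, and integrability controls the mass on that area. The first scale is different: the mean
  over a straight strip of fixed width is small because the energy is small.\<close>

lemma H1_delta_le:
  assumes "A \<subseteq> (\<Union>i. C i)" "\<And>i. bounded (C i)" "\<And>i. diameter (C i) \<le> \<delta>"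
  shows "H1_delta \<delta> A \<le> (\<Sum>i. ennreal (diameter (C i)))"
  unfolding H1_delta_def using assms by (intro INF_lower) auto

lemma H1_delta_mono: "A \<subseteq> B \<Longrightarrow> H1_delta \<delta> A \<le> H1_delta \<delta> B"
  unfolding H1_delta_def by (intro INF_superset_mono) auto

text \<open>A cover in \<open>H1_delta\<close> is indexed by \<open>nat\<close>, so the covers of
  two sets have to be merged into one sequence. Partial sums of even length split exactly and bound
  the others.\<close>

lemma suminf_interleave_le:
  fixes a b :: "nat \<Rightarrow> ennreal"
  shows "(\<Sum>n. if even n then a (n div 2) else b (n div 2)) \<le> (\<Sum>n. a n) + (\<Sum>n. b n)"
proof -
  let ?c = "\<lambda>n. if even n then a (n div 2) else b (n div 2)"
  have eq: "(\<Sum>n<2*m. ?c n) = (\<Sum>n<m. a n) + (\<Sum>n<m. b n)" for m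
    by (induction m) (auto simp: algebra_simps)
  have "(\<Sum>n<m. ?c n) \<le> (\<Sum>n. a n) + (\<Sum>n. b n)" for m
  proof -
    have "(\<Sum>n<m. ?c n) \<le> (\<Sum>n<2*m. ?c n)" by (intro sum_mono2) auto
    also have "\<dots> \<le> (\<Sum>n. a n) + (\<Sum>n. b n)"
      unfolding eq by (intro add_mono sum_le_suminf) auto
    finally show ?thesis .
  qed
  then show ?thesis by (intro suminf_le_const) auto
qed

lemma H1_delta_Un: "H1_delta \<delta> (A \<union> B) \<le> H1_delta \<delta> A + H1_delta \<delta> B"
proof (rule ennreal_le_epsilon)
  fix e :: real assume e: "e > 0" and "H1_delta \<delta> A + H1_delta \<delta> B < \<top>"
  then have fin: "H1_delta \<delta> A < \<top>" "H1_delta \<delta> B < \<top>" by (auto simp: add_top)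
  have ex: "\<exists>C. X \<subseteq> (\<Union>i. C i) \<and> (\<forall>i. bounded (C i) \<and> diameter (C i) \<le> \<delta>) \<and>
      (\<Sum>i. ennreal (diameter (C i))) < H1_delta \<delta> X + ennreal (e/2)" if "H1_delta \<delta> X < \<top>" for X
  proof -
    have "H1_delta \<delta> X < H1_delta \<delta> X + ennreal (e/2)"
      using that e ennreal_add_left_cancel_less[of "H1_delta \<delta> X" 0 "ennreal (e/2)"] by auto
    then show ?thesis
      unfolding H1_delta_def INF_less_iff by (auto simp: H1_delta_def[symmetric])
  qed
  obtain C where C: "A \<subseteq> (\<Union>i. C i)" "\<And>i. bounded (C i) \<and> diameter (C i) \<le> \<delta>"
      "(\<Sum>i. ennreal (diameter (C i))) < H1_delta \<delta> A + ennreal (e/2)"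
    using ex[OF fin(1)] by blast
  obtain D where D: "B \<subseteq> (\<Union>i. D i)" "\<And>i. bounded (D i) \<and> diameter (D i) \<le> \<delta>"
      "(\<Sum>i. ennreal (diameter (D i))) < H1_delta \<delta> B + ennreal (e/2)"
    using ex[OF fin(2)] by blast
  let ?F = "\<lambda>n. if even n then C (n div 2) else D (n div 2)"
  have "H1_delta \<delta> (A \<union> B) \<le> (\<Sum>n. ennreal (diameter (?F n)))"
  proof (rule H1_delta_le)
    show "A \<union> B \<subseteq> (\<Union>i. ?F i)"
    proof
      fix x assume "x \<in> A \<union> B"
      then consider i where "x \<in> C i" | i where "x \<in> D i" using C(1) D(1) by blast
      then show "x \<in> (\<Union>i. ?F i)"
      proof cases
        case 1 then have "x \<in> ?F (2*i)" by simp then show ?thesis by blast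
      next
        case 2 then have "x \<in> ?F (2*i+1)" by simp then show ?thesis by blast
      qed
    qed
  qed (use C(2) D(2) in auto)
  also have "\<dots> = (\<Sum>n. if even n then ennreal (diameter (C (n div 2))) else ennreal (diameter (D (n div 2))))"
    by (intro suminf_cong) auto
  also have "\<dots> \<le> (\<Sum>i. ennreal (diameter (C i))) + (\<Sum>i. ennreal (diameter (D i)))"
    by (rule suminf_interleave_le)
  also have "\<dots> \<le> (H1_delta \<delta> A + ennreal (e/2)) + (H1_delta \<delta> B + ennreal (e/2))"
    using C(3) D(3) by (intro add_mono) auto
  also have "\<dots> = H1_delta \<delta> A + H1_delta \<delta> B + ennreal e"
    using e by (simp add: ac_simps flip: ennreal_plus)
  finally show "H1_delta \<delta> (A \<union> B) \<le> H1_delta \<delta> A + H1_delta \<delta> B + ennreal e" .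
qed

lemma H1_delta_empty: "0 \<le> \<delta> \<Longrightarrow> H1_delta \<delta> {} = 0"
  using H1_delta_le[of "{}" "\<lambda>_. {}" \<delta>] by simp

lemma H1_delta_finite_UN:
  assumes "finite I" "0 \<le> \<delta>"
  shows "H1_delta \<delta> (\<Union>i\<in>I. A i) \<le> (\<Sum>i\<in>I. H1_delta \<delta> (A i))"
  using assms(1)
proof induction
  case (insert i I)
  have "H1_delta \<delta> (A i \<union> (\<Union>i\<in>I. A i)) \<le> H1_delta \<delta> (A i) + H1_delta \<delta> (\<Union>i\<in>I. A i)"
    by (rule H1_delta_Un)
  also have "\<dots> \<le> H1_delta \<delta> (A i) + (\<Sum>i\<in>I. H1_delta \<delta> (A i))"
    using insert by (intro add_mono) auto
  finally show ?case using insert by simp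
qed (use assms in \<open>simp add: H1_delta_empty\<close>)

text \<open>The measure of \<open>E\<close> is approximated from outside by countably many closed
  intervals with disjoint interiors, whose images cover the image of \<open>E\<close>. An interval
  of length d has an image of diameter at most \<open>L * d\<close>, and
  \<open>L * (b - a) \<le> \<delta>\<close> keeps each of these images admissible at scale
  \<delta>.\<close>

lemma H1_delta_lipschitz_image_short:
  fixes g :: "real \<Rightarrow> R2"
  assumes g: "L-lipschitz_on {a..b} g" and L: "L > 0" and short: "L * (b - a) \<le> \<delta>" "a \<le> b"
    and E: "E \<in> sets borel" "E \<subseteq> {a..b}"
  shows "H1_delta \<delta> (g ` E) \<le> ennreal L * emeasure lborel E"
proof (rule ennreal_le_epsilon)
  fix e :: real assume e: "e > 0"
  have finE: "E \<in> lmeasurable"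
    using E by (intro bounded_set_imp_lmeasurable bounded_subset[OF bounded_closed_interval]) auto
  obtain \<D> where D: "countable \<D>"
    "\<And>K. K \<in> \<D> \<Longrightarrow> K \<subseteq> cbox a b \<and> K \<noteq> {} \<and> (\<exists>c d. K = cbox c d)"
    "pairwise (\<lambda>A B. interior A \<inter> interior B = {}) \<D>"
    "E \<subseteq> \<Union>\<D>" "\<Union>\<D> \<in> lmeasurable" "measure lebesgue (\<Union>\<D>) \<le> measure lebesgue E + e / L"
    by (rule measurable_outer_intervals_bounded[of E a b "e/L"]) (use finE E e L in auto)
  \<comment> \<open>The countable family becomes a sequence by padding with empty sets, which have
    diameter 0.\<close>
  define C where "C i = (if i \<in> to_nat_on \<D> ` \<D> then from_nat_into \<D> i else {})" for i
  have Cmem: "C i = {} \<or> C i \<in> \<D>" for i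
    using D(1) by (auto simp: C_def)
  have UC: "(\<Union>i. C i) = \<Union>\<D>"
  proof
    show "(\<Union>i. C i) \<subseteq> \<Union>\<D>" using Cmem by blast
    show "\<Union>\<D> \<subseteq> (\<Union>i. C i)"
    proof
      fix x assume "x \<in> \<Union>\<D>"
      then obtain K where K: "K \<in> \<D>" "x \<in> K" by blast
      then have "C (to_nat_on \<D> K) = K" using D(1) by (auto simp: C_def)
      then show "x \<in> (\<Union>i. C i)" using K by blast
    qed
  qed
  have Cbox: "\<exists>c d. C i = cbox c d" for i
  proof (cases "C i = {}")
    case True
    then show ?thesis by (metis empty_as_interval)
  qed (use Cmem[of i] D(2)[of "C i"] in blast)
  have Csub: "C i \<subseteq> {a..b}" for i
    using Cmem[of i] D(2)[of "C i"] by auto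
  \<comment> \<open>Intervals with disjoint interiors may share endpoints; the common part is
    negligible, so the lengths add up to the measure of the union.\<close>
  have neg: "pairwise (\<lambda>m n. negligible (C m \<inter> C n)) UNIV"
  proof (rule pairwiseI)
    fix m n :: nat assume mn: "m \<noteq> n"
    show "negligible (C m \<inter> C n)"
    proof (cases "C m = {} \<or> C n = {}")
      case False
      then have m: "m \<in> to_nat_on \<D> ` \<D>" "n \<in> to_nat_on \<D> ` \<D>"
        by (auto simp: C_def split: if_splits)
      then have "C m \<noteq> C n" using mn D(1) by (auto simp: C_def)
      then have "interior (C m) \<inter> interior (C n) = {}"
        using D(3) Cmem[of m] Cmem[of n] False unfolding pairwise_def by blast
      moreover obtain c d c' d' where cd: "C m = cbox c d" "C n = cbox c' d'" using Cbox by metis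
      moreover obtain u v where uv: "C m \<inter> C n = cbox u v" unfolding cd Int_interval by blast
      ultimately have "box u v = {}" using interior_Int[of "C m" "C n"] by (simp only: interior_cbox)
      then show ?thesis unfolding uv by (simp only: negligible_interval(1))
    qed auto
  qed
  have sums: "(\<lambda>n. measure lebesgue (C n)) sums measure lebesgue (\<Union>n. C n)"
  proof (rule measure_countable_negligible_Union_bounded)
    show "C n \<in> lmeasurable" for n using Cbox[of n] by auto
    show "bounded (\<Union>n. C n)" using Csub by (meson UN_least bounded_closed_interval bounded_subset)
  qed (use neg in \<open>auto simp: pairwise_def\<close>)
  have dist: "dist (g x) (g y) \<le> L * dist x y" if "x \<in> {a..b}" "y \<in> {a..b}" for x y
    using lipschitz_onD[OF g] that by auto
  have diam: "bounded (g ` C i) \<and> diameter (g ` C i) \<le> L * measure lebesgue (C i)" for i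
  proof (cases "C i = {}")
    case False
    obtain c d where cd: "C i = {c..d}" using Cbox[of i] by auto
    with False have "c \<le> d" by auto
    have cdab: "a \<le> c" "d \<le> b" using Csub[of i] cd \<open>c \<le> d\<close> by auto
    have le: "dist (g x) (g y) \<le> L * (d - c)" if "x \<in> C i" "y \<in> C i" for x y
    proof -
      have "dist (g x) (g y) \<le> L * dist x y" using that cd cdab by (intro dist) auto
      also have "\<dots> \<le> L * (d - c)" using that cd L by (intro mult_left_mono) (auto simp: dist_real_def)
      finally show ?thesis .
    qed
    have "bounded (g ` C i)"
      unfolding bounded_two_points using le by blast
    moreover have "diameter (g ` C i) \<le> L * (d - c)"
      by (intro diameter_le) (use False le in \<open>auto simp: dist_norm\<close>)
    ultimately show ?thesis using cd \<open>c \<le> d\<close> by simp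
  qed auto
  have "H1_delta \<delta> (g ` E) \<le> (\<Sum>i. ennreal (diameter (g ` C i)))"
  proof (rule H1_delta_le)
    show "g ` E \<subseteq> (\<Union>i. g ` C i)" using D(4) UC by blast
    show "diameter (g ` C i) \<le> \<delta>" for i
    proof -
      have "measure lebesgue (C i) \<le> measure lebesgue {a..b}"
        using Csub[of i] Cbox[of i] by (intro measure_mono_fmeasurable) auto
      then have "L * measure lebesgue (C i) \<le> L * (b - a)" using short L by (intro mult_left_mono) auto
      then show ?thesis using diam[of i] short by linarith
    qed
  qed (use diam in auto)
  also have "\<dots> \<le> (\<Sum>i. ennreal (L * measure lebesgue (C i)))"
    using diam by (intro suminf_le) (auto intro!: ennreal_leI)
  also have "\<dots> = ennreal (L * measure lebesgue (\<Union>n. C n))"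
    using sums_mult[OF sums, of L] L by (intro suminf_ennreal_eq) auto
  also have "\<dots> \<le> ennreal (L * (measure lebesgue E + e / L))"
    using D(6) UC L by (intro ennreal_leI mult_left_mono) auto
  also have "\<dots> = ennreal L * ennreal (measure lebesgue E) + ennreal e"
    using L e by (simp add: distrib_left ennreal_plus ennreal_mult)
  also have "ennreal (measure lebesgue E) = emeasure lborel E"
    using finE E(1) emeasure_eq_measure2[OF finE] by simp
  finally show "H1_delta \<delta> (g ` E) \<le> ennreal L * emeasure lborel E + ennreal e" .
qed

text \<open>Cutting the unit interval into \<open>n > L / \<delta>\<close> cells makes the
  short-interval estimate applicable to each. The resulting bound is free of \<delta> and passes to
  the supremum.\<close>

lemma H1_lipschitz_image:
  fixes g :: "real \<Rightarrow> R2"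
  assumes g: "L-lipschitz_on {0..1} g" and L: "L > 0" and E: "E \<in> sets borel" "E \<subseteq> {0..1}"
  shows "H1 (g ` E) \<le> ennreal L * emeasure lborel E"
  unfolding H1_def
proof (rule SUP_least)
  fix \<delta> :: real assume "\<delta> \<in> {0<..}"
  then have d: "\<delta> > 0" by simp
  obtain n :: nat where n: "L / \<delta> < real n" using reals_Archimedean2 by blast
  then have n0: "n > 0" using d L by (metis divide_pos_pos gr0I less_asym of_nat_0)
  \<comment> \<open>Half-open cells are disjoint, so their measures add up exactly; the extra index
    \<open>n\<close> catches the endpoint 1.\<close>
  define F where "F i = (if i = n then E \<inter> {1} else E \<inter> {real i / n ..< (real i + 1)/n})" for i
  have E_eq: "E = (\<Union>i\<in>{..n}. F i)"
  proof (intro equalityI subsetI)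
    fix x assume x: "x \<in> E"
    then have x01: "0 \<le> x" "x \<le> 1" using E by auto
    show "x \<in> (\<Union>i\<in>{..n}. F i)"
    proof (cases "x = 1")
      case False
      define i where "i = nat \<lfloor>x * n\<rfloor>"
      have "real i \<le> x * n" "x * n < real i + 1"
        using x01 n0 by (auto simp: i_def)
      then have "x \<in> {real i / n ..< (real i + 1)/n}" using n0 by (auto simp: field_simps)
      moreover have "i < n"
      proof -
        have "real i < n" using \<open>real i \<le> x * n\<close> x01 False n0
          by (smt (verit) mult_less_cancel_right2 of_nat_0_less_iff)
        then show ?thesis by simp
      qed
      ultimately show ?thesis using x by (auto simp: F_def intro!: bexI[of _ i])
    qed (use x in \<open>auto simp: F_def\<close>)
  qed (auto simp: F_def split: if_splits)
  have disj: "disjoint_family_on F {..n}"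
  proof -
    have lt: "F i \<inter> F j = {}" if "i < j" "j \<le> n" for i j
    proof -
      have "x < y" if "x \<in> F i" "y \<in> F j" for x y
      proof -
        have "x < (real i + 1)/n" using that \<open>i < j\<close> \<open>j \<le> n\<close> by (auto simp: F_def)
        also have "\<dots> \<le> real j / n" using \<open>i < j\<close> n0 by (intro divide_right_mono) auto
        also have "\<dots> \<le> y" using that n0 by (auto simp: F_def split: if_splits)
        finally show ?thesis .
      qed
      then show ?thesis by blast
    qed
    show ?thesis
      unfolding disjoint_family_on_def using lt by (metis Int_commute atMost_iff linorder_neqE_nat)
  qed
  have Fb: "F i \<in> sets borel" for i using E by (auto simp: F_def)
  have piece: "H1_delta \<delta> (g ` F i) \<le> ennreal L * emeasure lborel (F i)" if "i \<le> n" for i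
  proof (cases "i = n")
    case True
    show ?thesis
      by (rule H1_delta_lipschitz_image_short[where a=1 and b=1])
         (use True L d Fb[of n] in \<open>auto simp: F_def lipschitz_on_def\<close>)
  next
    case False
    then have "i < n" using that by simp
    have "(real i + 1)/n \<le> 1" using \<open>i < n\<close> by (simp add: field_simps)
    moreover have "L * ((real i + 1)/n - real i / n) \<le> \<delta>"
      using n n0 d by (simp add: field_simps)
    ultimately show ?thesis
      using False L Fb[of i] n0
      by (intro H1_delta_lipschitz_image_short[where a="real i / n" and b="(real i + 1)/n"]
           lipschitz_on_subset[OF g])
         (auto simp: F_def divide_right_mono elim: order_trans)
  qed
  have "H1_delta \<delta> (g ` E) \<le> H1_delta \<delta> (\<Union>i\<in>{..n}. g ` F i)"
    by (rule H1_delta_mono) (subst E_eq, blast)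
  also have "\<dots> \<le> (\<Sum>i\<in>{..n}. H1_delta \<delta> (g ` F i))"
    using d by (intro H1_delta_finite_UN) auto
  also have "\<dots> \<le> (\<Sum>i\<in>{..n}. ennreal L * emeasure lborel (F i))"
    using piece by (intro sum_mono) auto
  also have "\<dots> = ennreal L * emeasure lborel (\<Union>i\<in>{..n}. F i)"
    using disj Fb by (subst sum_emeasure[symmetric]) (auto simp: sum_distrib_left)
  also have "\<dots> = ennreal L * emeasure lborel E" by (subst E_eq) simp
  finally show "H1_delta \<delta> (g ` E) \<le> ennreal L * emeasure lborel E" .
qed

text \<open>Countable additivity of \<^term>\<open>H1\<close> on Borel sets is not needed: if it failed, \<^term>\<open>H1_on \<gamma>\<close> would be
  the zero measure and the estimate trivial.\<close>

lemma curve_integral_H1_lipschitz_le: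
  fixes g :: "real \<Rightarrow> R2"
  assumes g: "L-lipschitz_on UNIV g" and L: "L > 0" and \<rho>: "\<rho> \<in> borel_measurable borel"
  shows "curve_integral_H1 (g ` {0..1}) \<rho> \<le> ennreal L * (\<integral>\<^sup>+x. \<rho> (g x) * indicator {0..1} x \<partial>lborel)"
proof -
  have gm[measurable]: "g \<in> borel_measurable borel"
    using g lipschitz_on_continuous_on borel_measurable_continuous_onI by blast
  note \<rho>[measurable]
  \<comment> \<open>A comparison of measures on Borel sets suffices: \<open>\<nu>\<close> is the
    image under \<open>g\<close> of \<open>L\<close> times Lebesgue measure on the unit
    interval.\<close>
  define \<nu> where "\<nu> = distr (density lborel (\<lambda>x. ennreal L * indicator {0..1} x)) borel g"
  have s: "sets (H1_on (g ` {0..1})) = sets borel"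
    using sets.sigma_sets_eq[of "borel :: R2 measure"] by (simp add: H1_on_def)
  have le: "emeasure (H1_on (g ` {0..1})) A \<le> emeasure \<nu> A" if A: "A \<in> sets borel" for A
  proof -
    let ?E = "g -` A \<inter> {0..1}"
    have E: "?E \<in> sets borel" using A by (auto intro!: measurable_sets_borel[OF gm])
    have "emeasure (H1_on (g ` {0..1})) A \<le> H1 (A \<inter> g ` {0..1})"
      unfolding H1_on_def by (simp add: emeasure_measure_of_conv)
    also have "A \<inter> g ` {0..1} = g ` ?E" by auto
    also have "H1 (g ` ?E) \<le> ennreal L * emeasure lborel ?E"
      using g L E by (intro H1_lipschitz_image lipschitz_on_subset[OF g]) auto
    also have "\<dots> = emeasure \<nu> A"
    proof -
      have "emeasure \<nu> A = (\<integral>\<^sup>+x. ennreal L * indicator {0..1} x * indicator (g -` A) x \<partial>lborel)"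
        using A unfolding \<nu>_def
        using measurable_sets_borel[OF gm A] by (subst emeasure_distr) (auto simp: emeasure_density)
      also have "\<dots> = (\<integral>\<^sup>+x. ennreal L * indicator ?E x \<partial>lborel)"
        by (intro nn_integral_cong) (auto simp: indicator_def)
      also have "\<dots> = ennreal L * emeasure lborel ?E" using E by (simp add: nn_integral_cmult_indicator)
      finally show ?thesis by simp
    qed
    finally show ?thesis .
  qed
  have "curve_integral_H1 (g ` {0..1}) \<rho> \<le> (\<integral>\<^sup>+x. \<rho> x \<partial>\<nu>)"
    unfolding curve_integral_H1_def
    by (intro nn_integral_mono_measure) (use s le in \<open>auto simp: \<nu>_def le_measure\<close>)
  also have "\<dots> = (\<integral>\<^sup>+x. ennreal L * (\<rho> (g x) * indicator {0..1} x) \<partial>lborel)"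
    unfolding \<nu>_def by (simp add: nn_integral_distr nn_integral_density ac_simps)
  also have "\<dots> = ennreal L * (\<integral>\<^sup>+x. \<rho> (g x) * indicator {0..1} x \<partial>lborel)"
    by (rule nn_integral_cmult) simp
  finally show ?thesis .
qed

text \<open>Admissibility tests only locally rectifiable curves, so the constructed graph must be
  shown to be one of them before it can contradict admissibility.\<close>

lemma loc_rectifiable_lipschitz_image:
  fixes g :: "real \<Rightarrow> R2"
  assumes g: "L-lipschitz_on UNIV g" and L: "L > 0"
  shows "loc_rectifiable (g ` {0..1})"
  unfolding loc_rectifiable_def
proof (intro allI impI)
  fix K :: "R2 set" assume "compact K"
  have gm: "g \<in> borel_measurable borel"
    using g lipschitz_on_continuous_on borel_measurable_continuous_onI by blast
  let ?E = "g -` K \<inter> {0..1}"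
  have E: "?E \<in> sets borel"
    using \<open>compact K\<close> by (intro sets.Int measurable_sets_borel[OF gm] borel_compact) auto
  have "H1 (g ` {0..1} \<inter> K) = H1 (g ` ?E)" by (rule arg_cong[where f=H1]) auto
  also have "\<dots> \<le> ennreal L * emeasure lborel ?E"
    using g L E by (intro H1_lipschitz_image lipschitz_on_subset[OF g]) auto
  also have "\<dots> \<le> ennreal L * emeasure lborel {0..1::real}"
    by (intro mult_left_mono emeasure_mono) auto
  also have "\<dots> < \<infinity>" by (simp add: ennreal_mult_less_top)
  finally show "H1 (g ` {0..1} \<inter> K) < \<infinity>" .
qed

section \<open>Concentration and uniform phases on the circle\<close>

text \<open>A Chernoff bound with multiplicative loss. With rate \<open>\<epsilon> / B\<close> the
  exponent u of one factor lies in [0, \<epsilon>], where exp u \<le> 1 + u + u^2 \<le> 1 + (1 +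
  \<epsilon>) u, so only the mean enters; independence multiplies the factors. The moment is kept
  instead of a probability because moments can be summed over all isometries before one sample is
  picked.\<close>

lemma (in prob_space) exp_moment_indep_sum_le:
  fixes Y :: "'i \<Rightarrow> 'a \<Rightarrow> real"
  assumes J: "finite J" and indep: "indep_vars (\<lambda>_. borel) Y J"
    and bnd: "\<And>j \<omega>. j \<in> J \<Longrightarrow> \<omega> \<in> space M \<Longrightarrow> 0 \<le> Y j \<omega> \<and> Y j \<omega> \<le> B"
    and mean: "\<And>j. j \<in> J \<Longrightarrow> (\<integral>\<^sup>+\<omega>. ennreal (Y j \<omega>) \<partial>M) \<le> ennreal (m j)"
    and m: "\<And>j. j \<in> J \<Longrightarrow> 0 \<le> m j" and B: "B > 0" and \<epsilon>: "0 < \<epsilon>" "\<epsilon> \<le> 1"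
  shows "(\<integral>\<^sup>+\<omega>. ennreal (exp (\<epsilon> / B * ((\<Sum>j\<in>J. Y j \<omega>) - (1 + \<epsilon>) * (\<Sum>j\<in>J. m j) - a))) \<partial>M)
    \<le> ennreal (exp (- (\<epsilon> / B * a)))"
proof -
  define c where "c = \<epsilon> / B"
  have c: "c > 0" using B \<epsilon> by (simp add: c_def)
  have Ym[measurable]: "Y j \<in> borel_measurable M" if "j \<in> J" for j
    using indep that by (auto simp: indep_vars_def)
  have ind2: "indep_vars (\<lambda>_. borel) (\<lambda>j \<omega>. ennreal (exp (c * Y j \<omega>))) J"
    by (rule indep_vars_compose2[OF indep, of "\<lambda>_ y. ennreal (exp (c * y))"]) auto
  have one: "(\<integral>\<^sup>+\<omega>. ennreal (exp (c * Y j \<omega>)) \<partial>M) \<le> ennreal (exp (c * (1 + \<epsilon>) * m j))" if j: "j \<in> J" for j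
  proof -
    have "(\<integral>\<^sup>+\<omega>. ennreal (exp (c * Y j \<omega>)) \<partial>M)
        \<le> (\<integral>\<^sup>+\<omega>. 1 + ennreal (c * (1 + \<epsilon>)) * ennreal (Y j \<omega>) \<partial>M)"
    proof (rule nn_integral_mono)
      fix \<omega> assume w: "\<omega> \<in> space M"
      let ?u = "c * Y j \<omega>"
      have u: "0 \<le> ?u" "?u \<le> \<epsilon>"
        using bnd[OF j w] c B \<epsilon> by (auto simp: c_def field_simps)
      have "exp ?u \<le> 1 + ?u + ?u^2" using u \<epsilon> by (intro exp_bound) auto
      also have "?u^2 \<le> \<epsilon> * ?u" unfolding power2_eq_square using u by (intro mult_right_mono) auto
      finally have "exp ?u \<le> 1 + c * (1 + \<epsilon>) * Y j \<omega>" by (simp add: algebra_simps)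
      then have "ennreal (exp ?u) \<le> ennreal (1 + c * (1 + \<epsilon>) * Y j \<omega>)" by (rule ennreal_leI)
      also have "\<dots> = 1 + ennreal (c * (1 + \<epsilon>)) * ennreal (Y j \<omega>)"
        using c \<epsilon> bnd[OF j w] by (simp add: ennreal_plus ennreal_mult)
      finally show "ennreal (exp ?u) \<le> 1 + ennreal (c * (1 + \<epsilon>)) * ennreal (Y j \<omega>)" .
    qed
    also have "\<dots> = 1 + ennreal (c * (1 + \<epsilon>)) * (\<integral>\<^sup>+\<omega>. ennreal (Y j \<omega>) \<partial>M)"
      using j by (simp add: nn_integral_add nn_integral_cmult emeasure_space_1)
    also have "\<dots> \<le> 1 + ennreal (c * (1 + \<epsilon>)) * ennreal (m j)"
      using mean[OF j] by (intro add_mono mult_left_mono) auto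
    also have "\<dots> = ennreal (1 + c * (1 + \<epsilon>) * m j)"
      using c \<epsilon> m[OF j] by (simp add: ennreal_plus ennreal_mult)
    also have "\<dots> \<le> ennreal (exp (c * (1 + \<epsilon>) * m j))"
      by (intro ennreal_leI exp_ge_add_one_self)
    finally show ?thesis .
  qed
  let ?K = "exp (- (c * ((1 + \<epsilon>) * (\<Sum>j\<in>J. m j) + a)))"
  have "(\<integral>\<^sup>+\<omega>. ennreal (exp (c * ((\<Sum>j\<in>J. Y j \<omega>) - (1 + \<epsilon>) * (\<Sum>j\<in>J. m j) - a))) \<partial>M)
      = (\<integral>\<^sup>+\<omega>. ennreal ?K * (\<Prod>j\<in>J. ennreal (exp (c * Y j \<omega>))) \<partial>M)"
    using J by (intro nn_integral_cong)
      (simp add: prod_ennreal ennreal_mult[symmetric] exp_sum[symmetric] exp_add[symmetric]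
        sum_distrib_left algebra_simps)
  also have "\<dots> = ennreal ?K * (\<Prod>j\<in>J. \<integral>\<^sup>+\<omega>. ennreal (exp (c * Y j \<omega>)) \<partial>M)"
    using J ind2 by (subst nn_integral_cmult) (auto simp: indep_vars_nn_integral)
  also have "\<dots> \<le> ennreal ?K * (\<Prod>j\<in>J. ennreal (exp (c * (1 + \<epsilon>) * m j)))"
    using one by (intro mult_left_mono prod_mono_ennreal) auto
  also have "\<dots> = ennreal (exp (- (c * a)))"
    using J by (simp add: prod_ennreal ennreal_mult[symmetric] exp_sum[symmetric] exp_add[symmetric]
        sum_distrib_left algebra_simps)
  finally show ?thesis by (simp add: c_def)
qed

section \<open>The triangle wave and rotation invariance on the circle\<close>

definition tri :: "real \<Rightarrow> real" where
  "tri x = 2 * infdist x \<int>"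

lemma infdist_Ints_eq: "infdist x \<int> = min (frac x) (1 - frac x)" for x :: real
proof -
  have "infdist x \<int> = (INF a\<in>\<int>. dist x a)" by (auto simp: infdist_def)
  also have "\<dots> = min (frac x) (1 - frac x)"
  proof (rule cInf_eq_minimum)
    have "frac x = dist x (of_int \<lfloor>x\<rfloor>)" "1 - frac x = dist x (of_int (\<lfloor>x\<rfloor> + 1))"
      by (auto simp: frac_def dist_real_def)
    then show "min (frac x) (1 - frac x) \<in> dist x ` \<int>"
      unfolding min_def by (metis Ints_of_int image_eqI)
    fix y assume "y \<in> dist x ` \<int>"
    then obtain n :: int where y: "y = \<bar>x - of_int n\<bar>" by (auto elim!: Ints_cases simp: dist_real_def)
    show "min (frac x) (1 - frac x) \<le> y"
    proof (cases "n \<le> \<lfloor>x\<rfloor>")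
      case True
      then have "real_of_int n \<le> of_int \<lfloor>x\<rfloor>" by simp
      then show ?thesis unfolding y frac_def by linarith
    next
      case False
      then have "real_of_int n \<ge> of_int \<lfloor>x\<rfloor> + 1" by linarith
      then show ?thesis unfolding y frac_def by linarith
    qed
  qed
  finally show ?thesis .
qed

lemma tri_bounds: "0 \<le> tri x" "tri x \<le> 1"
  using frac_ge_0[of x] frac_lt_1[of x] unfolding tri_def infdist_Ints_eq by (auto simp: min_def)

lemma tri_lipschitz: "\<bar>tri x - tri y\<bar> \<le> 2 * \<bar>x - y\<bar>"
proof -
  have "\<bar>2 * a - 2 * b\<bar> \<le> 2 * c" if "\<bar>a - b\<bar> \<le> c" for a b c :: real
    using that by linarith
  then show ?thesis
    using infdist_triangle_abs[of x \<int> y] unfolding tri_def dist_real_def by blast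
qed

lemma tri_add_of_int: "tri (x + of_int n) = tri x"
  unfolding tri_def infdist_Ints_eq by (simp add: frac_def)

lemma tri_measurable[measurable]: "tri \<in> borel_measurable borel"
  unfolding tri_def by (intro borel_measurable_continuous_onI continuous_intros)

text \<open>\<open>tri\<close> folds the circle twice onto the unit interval, with slopes 2 and -2,
  so each half contributes half of the integral: a uniform phase gives a uniform height.\<close>

lemma nn_integral_tri_le:
  assumes [measurable]: "F \<in> borel_measurable borel"
  shows "(\<integral>\<^sup>+x. F (tri x) * indicator {0..<1} x \<partial>lborel) \<le> (\<integral>\<^sup>+x. F x * indicator {0..1} x \<partial>lborel)"
proof -
  let ?I = "\<integral>\<^sup>+x. F x * indicator {0..1} x \<partial>lborel"
  have "(\<integral>\<^sup>+x. F (tri x) * indicator {0..<1} x \<partial>lborel) \<le>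
      (\<integral>\<^sup>+x. F (0 + 2 * x) * indicator {0..1} (0 + 2 * x) + F (2 + (-2) * x) * indicator {0..1} (2 + (-2) * x) \<partial>lborel)"
  proof (rule nn_integral_mono)
    fix x :: real
    have "tri x = 2 * x" if "0 \<le> x" "x \<le> 1/2"
      using that frac_eq[of x] unfolding tri_def infdist_Ints_eq by (auto simp: min_def)
    moreover have "tri x = 2 - 2 * x" if "1/2 \<le> x" "x < 1"
      using that frac_eq[of x] unfolding tri_def infdist_Ints_eq by (auto simp: min_def)
    ultimately show "F (tri x) * indicator {0..<1} x \<le>
       F (0 + 2 * x) * indicator {0..1} (0 + 2 * x) + F (2 + (-2) * x) * indicator {0..1} (2 + (-2) * x)"
      by (cases "x \<le> 1/2") (auto simp: indicator_def)
  qed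
  also have "\<dots> = (\<integral>\<^sup>+x. F (0 + 2 * x) * indicator {0..1} (0 + 2 * x) \<partial>lborel) +
      (\<integral>\<^sup>+x. F (2 + (-2) * x) * indicator {0..1} (2 + (-2) * x) \<partial>lborel)"
    by (rule nn_integral_add) auto
  also have "\<dots> = ?I"
  proof -
    have 1: "?I = ennreal 2 * (\<integral>\<^sup>+x. F (0 + 2 * x) * indicator {0..1} (0 + 2 * x) \<partial>lborel)"
      by (subst nn_integral_real_affine[where c=2 and t=0]) auto
    have 2: "?I = ennreal 2 * (\<integral>\<^sup>+x. F (2 + (-2) * x) * indicator {0..1} (2 + (-2) * x) \<partial>lborel)"
      by (subst nn_integral_real_affine[where c="-2" and t=2]) auto
    have half: "a = ennreal (1/2) * I" if "I = ennreal 2 * a" for a I :: ennreal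
    proof -
      have "ennreal (1/2) * ennreal 2 = 1" by (subst ennreal_mult[symmetric]) auto
      then show ?thesis unfolding that by (simp only: mult.assoc[symmetric] mult_1)
    qed
    have "ennreal (1/2) * ?I + ennreal (1/2) * ?I = (ennreal (1/2) + ennreal (1/2)) * ?I"
      by (simp only: distrib_right)
    also have "ennreal (1/2) + ennreal (1/2) = 1" by (subst ennreal_plus[symmetric]) auto
    finally show ?thesis using half[OF 1] half[OF 2] by simp
  qed
  finally show ?thesis .
qed

lemma periodic_of_int:
  fixes G :: "real \<Rightarrow> 'a"
  assumes "\<And>x. G (x + 1) = G x"
  shows "G (x + of_int n) = G x"
proof -
  have nat: "G (x + real k) = G x" for x k
    by (induction k) (use assms in \<open>auto simp: add.assoc[symmetric] add.commute[of 1]\<close>)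
  show ?thesis
  proof (cases "n \<ge> 0")
    case True then show ?thesis using nat[of x "nat n"] by simp
  next
    case False then show ?thesis using nat[of "x + of_int n" "nat (-n)"] by simp
  qed
qed

text \<open>The shift reduces to its fractional part d, and the piece over [1, 1 + d) is moved back
  by one period.\<close>

lemma nn_integral_periodic_shift:
  fixes G :: "real \<Rightarrow> ennreal"
  assumes [measurable]: "G \<in> borel_measurable borel" and per: "\<And>x. G (x + 1) = G x"
  shows "(\<integral>\<^sup>+x. G (x + c) * indicator {0..<1} x \<partial>lborel) = (\<integral>\<^sup>+x. G x * indicator {0..<1} x \<partial>lborel)"
proof -
  define d where "d = frac c"
  have d: "0 \<le> d" "d < 1" by (auto simp: d_def frac_lt_1)
  have "G (x + c) = G (d + x)" for x
    using periodic_of_int[of G, OF per, of "x + d" "\<lfloor>c\<rfloor>"] by (simp add: d_def frac_def algebra_simps)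
  then have "(\<integral>\<^sup>+x. G (x + c) * indicator {0..<1} x \<partial>lborel)
      = (\<integral>\<^sup>+x. G (d + 1 * x) * indicator {d..<1+d} (d + 1 * x) \<partial>lborel)"
    by (intro nn_integral_cong) (auto simp: indicator_def)
  also have "\<dots> = (\<integral>\<^sup>+x. G x * indicator {d..<1+d} x \<partial>lborel)"
    by (subst nn_integral_real_affine[where c=1 and t=d and f="\<lambda>x. G x * indicator {d..<1+d} x"]) auto
  also have "\<dots> = (\<integral>\<^sup>+x. G x * indicator {d..<1} x + G x * indicator {1..<1+d} x \<partial>lborel)"
    using d by (intro nn_integral_cong) (auto simp: indicator_def)
  also have "\<dots> = (\<integral>\<^sup>+x. G x * indicator {d..<1} x \<partial>lborel) + (\<integral>\<^sup>+x. G x * indicator {1..<1+d} x \<partial>lborel)"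
    by (rule nn_integral_add) auto
  also have "(\<integral>\<^sup>+x. G x * indicator {1..<1+d} x \<partial>lborel) = (\<integral>\<^sup>+x. G (1 + 1 * x) * indicator {1..<1+d} (1 + 1 * x) \<partial>lborel)"
    by (subst nn_integral_real_affine[where c=1 and t=1]) auto
  also have "\<dots> = (\<integral>\<^sup>+x. G x * indicator {0..<d} x \<partial>lborel)"
    using per by (intro nn_integral_cong) (auto simp: indicator_def add.commute)
  also have "(\<integral>\<^sup>+x. G x * indicator {d..<1} x \<partial>lborel) + (\<integral>\<^sup>+x. G x * indicator {0..<d} x \<partial>lborel)
      = (\<integral>\<^sup>+x. G x * indicator {d..<1} x + G x * indicator {0..<d} x \<partial>lborel)"
    by (rule nn_integral_add[symmetric]) auto
  also have "\<dots> = (\<integral>\<^sup>+x. G x * indicator {0..<1} x \<partial>lborel)"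
    using d by (intro nn_integral_cong) (auto simp: indicator_def)
  finally show ?thesis .
qed

definition unif :: "real measure" where
  "unif = density lborel (indicator {0..<1})"

lemma sets_unif[simp, measurable_cong]: "sets unif = sets borel"
  by (simp add: unif_def)

lemma space_unif[simp]: "space unif = UNIV"
  by (simp add: unif_def)

lemma prob_space_unif: "prob_space unif"
  by (rule prob_spaceI) (simp add: unif_def emeasure_density)

lemma nn_integral_unif:
  "G \<in> borel_measurable borel \<Longrightarrow> (\<integral>\<^sup>+x. G x \<partial>unif) = (\<integral>\<^sup>+x. G x * indicator {0..<1} x \<partial>lborel)"
  unfolding unif_def by (subst nn_integral_density) (auto simp: mult.commute)

text \<open>Linear interpolation between two independent uniform points of [0, 1] is not uniform,
  but moving along the circle is. For fixed \<open>x\<close> the rotation by \<open>x\<close> turns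
  the increment into \<open>frac y\<close>; then, for fixed \<open>y\<close>, the rotation by
  \<open>t * frac y\<close> is absorbed by periodicity, whatever \<open>t\<close> is.\<close>

lemma nn_integral_circle_walk:
  fixes G :: "real \<Rightarrow> ennreal"
  assumes G[measurable]: "G \<in> borel_measurable borel" and per: "\<And>x. G (x + 1) = G x"
  shows "(\<integral>\<^sup>+z. G (fst z + t * frac (snd z - fst z)) \<partial>(unif \<Otimes>\<^sub>M unif)) = (\<integral>\<^sup>+x. G x \<partial>unif)"
proof -
  interpret U: prob_space unif by (rule prob_space_unif)
  interpret UU: pair_prob_space unif unif ..
  have fr[measurable]: "(frac :: real \<Rightarrow> real) \<in> borel_measurable borel"
    unfolding frac_def by measurable
  have "(\<integral>\<^sup>+z. G (fst z + t * frac (snd z - fst z)) \<partial>(unif \<Otimes>\<^sub>M unif))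
      = (\<integral>\<^sup>+x. \<integral>\<^sup>+y. G (x + t * frac (y - x)) \<partial>unif \<partial>unif)"
    by (subst U.nn_integral_fst[symmetric]) auto
  also have "\<dots> = (\<integral>\<^sup>+x. \<integral>\<^sup>+y. G (x + t * frac y) \<partial>unif \<partial>unif)"
  proof (rule nn_integral_cong)
    fix x
    have fr1: "frac (z + 1) = frac z" for z :: real by (simp add: frac_def)
    have p: "G (x + t * frac (y + 1 - x)) = G (x + t * frac (y - x))" for y
    proof -
      have "y + 1 - x = (y - x) + 1" by simp
      then show ?thesis by (simp only: fr1)
    qed
    have "(\<integral>\<^sup>+y. G (x + t * frac (y - x)) \<partial>unif) = (\<integral>\<^sup>+y. G (x + t * frac (y - x)) * indicator {0..<1} y \<partial>lborel)"
      by (subst nn_integral_unif) auto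
    also have "\<dots> = (\<integral>\<^sup>+y. G (x + t * frac (y + x - x)) * indicator {0..<1} y \<partial>lborel)"
      using p by (intro nn_integral_periodic_shift[where G="\<lambda>y. G (x + t * frac (y - x))", symmetric]) auto
    also have "\<dots> = (\<integral>\<^sup>+y. G (x + t * frac y) \<partial>unif)"
      by (subst nn_integral_unif) auto
    finally show "(\<integral>\<^sup>+y. G (x + t * frac (y - x)) \<partial>unif) = (\<integral>\<^sup>+y. G (x + t * frac y) \<partial>unif)" .
  qed
  also have "\<dots> = (\<integral>\<^sup>+y. \<integral>\<^sup>+x. G (x + t * frac y) \<partial>unif \<partial>unif)"
    by (rule UU.Fubini'[symmetric]) auto
  also have "\<dots> = (\<integral>\<^sup>+y. \<integral>\<^sup>+x. G x \<partial>unif \<partial>unif)"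
    using nn_integral_periodic_shift[OF G per] by (simp add: nn_integral_unif)
  also have "\<dots> = (\<integral>\<^sup>+x. G x \<partial>unif)" using U.emeasure_space_1 by simp
  finally show ?thesis .
qed

section \<open>Independent phases and independence of disjoint blocks of them\<close>

definition phases :: "(nat \<Rightarrow> real) measure" where
  "phases = PiM UNIV (\<lambda>_. unif)"

lemma prob_space_phases: "prob_space phases"
  unfolding phases_def by (intro prob_space_PiM prob_space_unif)

lemma phases_component_measurable[measurable]: "(\<lambda>\<omega>. \<omega> i) \<in> phases \<rightarrow>\<^sub>M unif"
  unfolding phases_def by measurable

lemma space_phases[simp]: "space phases = UNIV"
  by (auto simp: phases_def space_PiM)

lemma indep_vars_phases: "prob_space.indep_vars phases (\<lambda>_. unif) (\<lambda>i \<omega>. \<omega> i) UNIV"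
proof -
  interpret prob_space phases by (rule prob_space_phases)
  have "distr phases (PiM UNIV (\<lambda>_. unif)) (\<lambda>\<omega>. \<lambda>i\<in>UNIV. \<omega> i) = phases"
    by (simp add: phases_def restrict_UNIV distr_id2)
  moreover have "distr phases unif (\<lambda>\<omega>. \<omega> i) = unif" for i
    unfolding phases_def by (rule distr_PiM_component) (auto intro: prob_space_unif)
  ultimately show ?thesis
    by (subst indep_vars_iff_distr_eq_PiM) (auto simp: phases_def)
qed

lemma distr_phases_pair:
  assumes "i \<noteq> j"
  shows "distr phases (unif \<Otimes>\<^sub>M unif) (\<lambda>\<omega>. (\<omega> i, \<omega> j)) = unif \<Otimes>\<^sub>M unif"
proof -
  interpret prob_space phases by (rule prob_space_phases)
  have c: "distr phases unif (\<lambda>\<omega>. \<omega> i) = unif" for i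
    unfolding phases_def by (rule distr_PiM_component) (auto intro: prob_space_unif)
  have "indep_var (PiM {i} (\<lambda>_. unif)) (\<lambda>\<omega>. restrict \<omega> {i}) (PiM {j} (\<lambda>_. unif)) (\<lambda>\<omega>. restrict \<omega> {j})"
    using indep_var_restrict[OF indep_vars_phases, of "{i}" "{j}"] assms by simp
  from indep_var_compose[OF this, of "\<lambda>\<omega>. \<omega> i" unif "\<lambda>\<omega>. \<omega> j" unif]
  have "indep_var unif (\<lambda>\<omega>. \<omega> i) unif (\<lambda>\<omega>. \<omega> j)"
    by (simp add: comp_def)
  then show ?thesis unfolding indep_var_distribution_eq by (simp add: c)
qed

text \<open>The function with index \<open>j\<close> reads the block \<open>{j, Suc j}\<close>.
  Consecutive blocks overlap, but the blocks of one parity class are pairwise disjoint.\<close>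

lemma indep_vars_phases_pairs:
  assumes F: "\<And>j. F j \<in> borel_measurable (unif \<Otimes>\<^sub>M unif)"
  shows "prob_space.indep_vars phases (\<lambda>_. borel) (\<lambda>j \<omega>. F j (\<omega> j, \<omega> (Suc j))) {j. j < N \<and> even j = b}"
proof -
  interpret prob_space phases by (rule prob_space_phases)
  let ?L = "{j. j < N \<and> even j = b}"
  have "indep_vars (\<lambda>j. PiM {j, Suc j} (\<lambda>_. unif)) (\<lambda>j \<omega>. restrict (\<lambda>i. \<omega> i) {j, Suc j}) ?L"
    by (rule indep_vars_restrict[OF indep_vars_phases]) (auto simp: disjoint_family_on_def)
  from indep_vars_compose2[OF this, of "\<lambda>j \<omega>. F j (\<omega> j, \<omega> (Suc j))" "\<lambda>_. borel"]
  show ?thesis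
    using F by (auto intro!: measurable_compose[OF _ F])
qed

section \<open>Random refinement of a strip\<close>

text \<open>The variable \<open>s\<close> is the height above the lower edge \<open>f\<close>; in
  these coordinates moving the strip is a translation in each vertical fibre. For \<open>I\<close>
  of length 1 and \<open>w > 0\<close>, division by \<open>w\<close> gives the mean of
  \<open>r\<close> over the strip.\<close>

definition strip_integral :: "real set \<Rightarrow> (real \<Rightarrow> real) \<Rightarrow> real \<Rightarrow> (R2 \<Rightarrow> ennreal) \<Rightarrow> ennreal" where
  "strip_integral I f w r =
    (\<integral>\<^sup>+x. (\<integral>\<^sup>+s. r (x, f x + s) * indicator {0..w} s \<partial>lborel) * indicator I x \<partial>lborel)"

text \<open>The only consequence of the integrability of \<open>r\<^sup>q\<close> that is needed: Chebyshev's inequality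
  for the part of \<open>r\<close> above the level \<open>t\<close>.\<close>

definition tail_bound :: "real \<Rightarrow> (R2 \<Rightarrow> ennreal) \<Rightarrow> bool" where
  "tail_bound q r \<longleftrightarrow> r \<in> borel_measurable borel \<and>
    (\<forall>t>0. (\<integral>\<^sup>+z. r z * indicator {z. r z > ennreal t} z \<partial>lborel) \<le> ennreal (t powr (1 - q)))"

lemma nn_integral_shear:
  assumes [measurable]: "h \<in> borel_measurable borel" "f \<in> borel_measurable borel"
  shows "(\<integral>\<^sup>+x. \<integral>\<^sup>+s. h (x, f x + s) \<partial>lborel \<partial>lborel) = (\<integral>\<^sup>+z. h z \<partial>(lborel :: R2 measure))"
proof -
  have "(\<integral>\<^sup>+s. h (x, f x + s) \<partial>lborel) = (\<integral>\<^sup>+y. h (x, y) \<partial>lborel)" for x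
    by (subst (2) nn_integral_real_affine[where c=1 and t="f x"]) auto
  then have "(\<integral>\<^sup>+x. \<integral>\<^sup>+s. h (x, f x + s) \<partial>lborel \<partial>lborel) = (\<integral>\<^sup>+x. \<integral>\<^sup>+y. h (x, y) \<partial>lborel \<partial>lborel)"
    by simp
  also have "\<dots> = (\<integral>\<^sup>+z. h z \<partial>(lborel \<Otimes>\<^sub>M lborel))"
    by (rule lborel.nn_integral_fst) (simp add: lborel_prod)
  finally show ?thesis by (simp add: lborel_prod)
qed

definition strip :: "real set \<Rightarrow> (real \<Rightarrow> real) \<Rightarrow> real \<Rightarrow> R2 set" where
  "strip I f w = {z. fst z \<in> I \<and> f (fst z) \<le> snd z \<and> snd z \<le> f (fst z) + w}"

lemma strip_measurable[measurable]:
  assumes [measurable]: "f \<in> borel_measurable borel" "I \<in> sets borel"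
  shows "strip I f w \<in> sets borel"
proof -
  have "{z \<in> space (borel \<Otimes>\<^sub>M borel). fst z \<in> I \<and> f (fst z) \<le> snd z \<and> snd z \<le> f (fst z) + w}
      \<in> sets (borel \<Otimes>\<^sub>M borel)" by measurable
  then show ?thesis unfolding borel_prod by (simp add: strip_def)
qed

text \<open>The fibrewise form suits random displacements of the edge, the planar form suits rigid
  motions and area estimates; this is the passage between them.\<close>

lemma strip_integral_eq_plane:
  assumes [measurable]: "r \<in> borel_measurable borel" "f \<in> borel_measurable borel" "I \<in> sets borel"
  shows "strip_integral I f w r = (\<integral>\<^sup>+z. r z * indicator (strip I f w) z \<partial>lborel)"
proof -
  have "(\<integral>\<^sup>+z. r z * indicator (strip I f w) z \<partial>lborel)
      = (\<integral>\<^sup>+x. \<integral>\<^sup>+s. r (x, f x + s) * indicator (strip I f w) (x, f x + s) \<partial>lborel \<partial>lborel)"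
    by (subst nn_integral_shear) auto
  also have "\<dots> = (\<integral>\<^sup>+x. \<integral>\<^sup>+s. r (x, f x + s) * indicator {0..w} s * indicator I x \<partial>lborel \<partial>lborel)"
    by (intro nn_integral_cong) (auto simp: strip_def indicator_def)
  also have "\<dots> = strip_integral I f w r"
    unfolding strip_integral_def by (intro nn_integral_cong nn_integral_multc) measurable
  finally show ?thesis by simp
qed

lemma emeasure_strip:
  assumes [measurable]: "f \<in> borel_measurable borel" "I \<in> sets borel" and w: "0 \<le> w"
  shows "emeasure lborel (strip I f w) = ennreal w * emeasure lborel I"
proof -
  have "emeasure lborel (strip I f w) = strip_integral I f w (\<lambda>_. 1)"
    by (subst strip_integral_eq_plane) auto
  then show ?thesis using w by (simp add: strip_integral_def nn_integral_cmult_indicator)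
qed

text \<open>Splitting \<open>r\<close> at the level \<open>t\<close> replaces Hoelder's inequality:
  below \<open>t\<close> the mass is at most \<open>t\<close> times the area, above it is the tail.
  The level stays free because each use balances the two terms differently.\<close>

lemma nn_integral_indicator_le_tail:
  assumes [measurable]: "r \<in> borel_measurable borel" "A \<in> sets borel"
    and A: "emeasure lborel A \<le> ennreal l" "0 \<le> l" and t: "0 < t"
    and tail: "(\<integral>\<^sup>+z. r z * indicator {z. r z > ennreal t} z \<partial>lborel) \<le> ennreal \<kappa>" "0 \<le> \<kappa>"
  shows "(\<integral>\<^sup>+z. r z * indicator A z \<partial>lborel) \<le> ennreal (t * l + \<kappa>)"
proof -
  have "(\<integral>\<^sup>+z. r z * indicator A z \<partial>lborel)
      \<le> (\<integral>\<^sup>+z. ennreal t * indicator A z + r z * indicator {z. r z > ennreal t} z \<partial>lborel)"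
    by (intro nn_integral_mono) (auto simp: indicator_def not_less)
  also have "\<dots> = ennreal t * emeasure lborel A + (\<integral>\<^sup>+z. r z * indicator {z. r z > ennreal t} z \<partial>lborel)"
    by (subst nn_integral_add) (auto simp: nn_integral_cmult_indicator)
  also have "\<dots> \<le> ennreal t * ennreal l + ennreal \<kappa>"
    using t A tail by (intro add_mono mult_left_mono) auto
  also have "\<dots> = ennreal (t * l + \<kappa>)"
    using t A tail by (simp add: ennreal_plus ennreal_mult)
  finally show ?thesis .
qed

lemma strip_integral_le_tail:
  assumes r: "tail_bound q r" and [measurable]: "f \<in> borel_measurable borel" "I \<in> sets borel"
    and l: "emeasure lborel I = ennreal l" "0 \<le> l" and w: "0 \<le> w" and t: "0 < t"
  shows "strip_integral I f w r \<le> ennreal (t * (l * w) + t powr (1 - q))"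
proof -
  have [measurable]: "r \<in> borel_measurable borel" using r by (simp add: tail_bound_def)
  show ?thesis
    unfolding strip_integral_eq_plane[OF \<open>r \<in> _\<close> assms(2,3)]
    using r l w t
    by (intro nn_integral_indicator_le_tail) (auto simp: tail_bound_def emeasure_strip ennreal_mult mult.commute)
qed

lemma frac_measurable[measurable]: "(frac :: real \<Rightarrow> real) \<in> borel_measurable borel"
  unfolding frac_def by measurable

text \<open>For fixed \<open>x\<close> and \<open>s\<close> the random height
  \<open>D * tri (...) + s\<close> is uniform on [s, s + D], which lies in [0, D + w'] when
  \<open>s\<close> lies in [0, w']. Its expectation is thus at most 1/D times the fibre integral
  over the wider strip, and integrating over \<open>s\<close> adds the factor \<open>w'\<close>. The
  position in the cell enters through \<open>\<tau>\<close> only, and the circle walk is uniform at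
  every time.\<close>

lemma nn_integral_random_strip_le:
  assumes [measurable]: "r \<in> borel_measurable borel" "f \<in> borel_measurable borel" "I \<in> sets borel"
      "\<tau> \<in> borel_measurable borel"
    and D: "0 < D" and w: "0 \<le> w'"
  shows "(\<integral>\<^sup>+z. strip_integral I (\<lambda>x. f x + D * tri (fst z + \<tau> x * frac (snd z - fst z))) w' r \<partial>(unif \<Otimes>\<^sub>M unif))
     \<le> ennreal (w' / D) * strip_integral I f (D + w') r"
proof -
  interpret U: prob_space unif by (rule prob_space_unif)
  interpret UU: pair_prob_space unif unif ..
  interpret P: pair_sigma_finite "unif \<Otimes>\<^sub>M unif" lborel ..
  let ?t = "\<lambda>z x. tri (fst z + \<tau> x * frac (snd z - fst z))"
  have inner: "(\<integral>\<^sup>+z. r (x, f x + D * ?t z x + s) \<partial>(unif \<Otimes>\<^sub>M unif)) * indicator {0..w'} s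
      \<le> ennreal (1 / D) * (\<integral>\<^sup>+y. r (x, f x + y) * indicator {0..D + w'} y \<partial>lborel) * indicator {0..w'} s"
    for x s :: real
  proof (cases "s \<in> {0..w'}")
    case True
    let ?G = "\<lambda>\<theta>. r (x, f x + D * tri \<theta> + s)"
    have "(\<integral>\<^sup>+z. r (x, f x + D * ?t z x + s) \<partial>(unif \<Otimes>\<^sub>M unif)) = (\<integral>\<^sup>+\<theta>. ?G \<theta> \<partial>unif)"
      by (rule nn_integral_circle_walk[where G="?G"]) (auto simp: tri_add_of_int[where n=1, simplified])
    also have "\<dots> = (\<integral>\<^sup>+\<theta>. ?G \<theta> * indicator {0..<1} \<theta> \<partial>lborel)"
      by (rule nn_integral_unif) measurable
    also have "\<dots> \<le> (\<integral>\<^sup>+v. r (x, f x + D * v + s) * indicator {0..1} v \<partial>lborel)"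
      by (rule nn_integral_tri_le[where F="\<lambda>v. r (x, f x + D * v + s)"]) measurable
    also have "\<dots> \<le> (\<integral>\<^sup>+v. r (x, f x + (s + D * v)) * indicator {0..D + w'} (s + D * v) \<partial>lborel)"
    proof (rule nn_integral_mono)
      fix v :: real
      have "s + D * v \<in> {0..D + w'}" if "v \<in> {0..1}"
      proof -
        have "D * v \<le> D" "0 \<le> D * v" using that D by (auto intro: mult_left_le)
        then show ?thesis using True unfolding atLeastAtMost_iff by linarith
      qed
      then show "r (x, f x + D * v + s) * indicator {0..1} v \<le> r (x, f x + (s + D * v)) * indicator {0..D + w'} (s + D * v)"
        by (auto simp: indicator_def algebra_simps)
    qed
    \<comment> \<open>Inserting 1/D times D supplies the Jacobian of the substitution y = s + D
      v.\<close>
    also have "\<dots> = ennreal (1 / D) * (ennreal \<bar>D\<bar> * \<dots>)"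
      using D by (simp add: mult.assoc[symmetric] ennreal_mult[symmetric])
    also have "ennreal \<bar>D\<bar> * (\<integral>\<^sup>+v. r (x, f x + (s + D * v)) * indicator {0..D + w'} (s + D * v) \<partial>lborel)
        = (\<integral>\<^sup>+y. r (x, f x + y) * indicator {0..D + w'} y \<partial>lborel)"
      using D by (intro nn_integral_real_affine[symmetric, where f="\<lambda>y. r (x, f x + y) * indicator {0..D + w'} y"]) auto
    finally show ?thesis using True by simp
  qed simp
  have "(\<integral>\<^sup>+z. strip_integral I (\<lambda>x. f x + D * ?t z x) w' r \<partial>(unif \<Otimes>\<^sub>M unif))
      = (\<integral>\<^sup>+x. \<integral>\<^sup>+z. (\<integral>\<^sup>+s. r (x, f x + D * ?t z x + s) * indicator {0..w'} s \<partial>lborel) * indicator I x \<partial>(unif \<Otimes>\<^sub>M unif) \<partial>lborel)"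
    unfolding strip_integral_def by (rule P.Fubini'[symmetric]) measurable
  also have "\<dots> = (\<integral>\<^sup>+x. (\<integral>\<^sup>+z. (\<integral>\<^sup>+s. r (x, f x + D * ?t z x + s) * indicator {0..w'} s \<partial>lborel) \<partial>(unif \<Otimes>\<^sub>M unif)) * indicator I x \<partial>lborel)"
    by (intro nn_integral_cong nn_integral_multc) measurable
  also have "\<dots> = (\<integral>\<^sup>+x. (\<integral>\<^sup>+s. \<integral>\<^sup>+z. r (x, f x + D * ?t z x + s) * indicator {0..w'} s \<partial>(unif \<Otimes>\<^sub>M unif) \<partial>lborel) * indicator I x \<partial>lborel)"
    by (intro nn_integral_cong arg_cong2[where f="(*)"] P.Fubini'[symmetric] refl) measurable
  also have "\<dots> = (\<integral>\<^sup>+x. (\<integral>\<^sup>+s. (\<integral>\<^sup>+z. r (x, f x + D * ?t z x + s) \<partial>(unif \<Otimes>\<^sub>M unif)) * indicator {0..w'} s \<partial>lborel) * indicator I x \<partial>lborel)"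
    by (intro nn_integral_cong arg_cong2[where f="(*)"] refl nn_integral_multc) measurable
  also have "\<dots> \<le> (\<integral>\<^sup>+x. (\<integral>\<^sup>+s. ennreal (1 / D) * (\<integral>\<^sup>+y. r (x, f x + y) * indicator {0..D + w'} y \<partial>lborel) * indicator {0..w'} s \<partial>lborel) * indicator I x \<partial>lborel)"
    by (intro nn_integral_mono mult_right_mono inner) auto
  also have "\<dots> = (\<integral>\<^sup>+x. ennreal (w' / D) * ((\<integral>\<^sup>+y. r (x, f x + y) * indicator {0..D + w'} y \<partial>lborel) * indicator I x) \<partial>lborel)"
  proof (rule nn_integral_cong)
    fix x :: real
    let ?A = "\<integral>\<^sup>+y. r (x, f x + y) * indicator {0..D + w'} y \<partial>lborel"
    have "(\<integral>\<^sup>+s. ennreal (1 / D) * ?A * indicator {0..w'} s \<partial>lborel) = ennreal (1 / D) * ?A * ennreal w'"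
      using w by (subst nn_integral_cmult_indicator) auto
    also have "\<dots> = ennreal (w' / D) * ?A"
    proof -
      have "ennreal (w' / D) = ennreal (1 / D) * ennreal w'" using w D by (subst ennreal_mult[symmetric]) auto
      then show ?thesis by (simp only: ac_simps)
    qed
    finally show "(\<integral>\<^sup>+s. ennreal (1 / D) * ?A * indicator {0..w'} s \<partial>lborel) * indicator I x
        = ennreal (w' / D) * (?A * indicator I x)" by (simp only: ac_simps)
  qed
  also have "\<dots> = ennreal (w' / D) * strip_integral I f (D + w') r"
    unfolding strip_integral_def by (rule nn_integral_cmult) measurable
  finally show ?thesis .
qed

section \<open>Cells of the unit interval and the walk through the phases\<close>

definition cell :: "nat \<Rightarrow> nat \<Rightarrow> real set" where
  "cell N j = {real j / N ..< (real j + 1) / N}"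

lemma cell_measurable[measurable]: "cell N j \<in> sets borel"
  by (simp add: cell_def)

lemma emeasure_cell: "0 < N \<Longrightarrow> emeasure lborel (cell N j) = ennreal (1 / N)"
  by (simp add: cell_def divide_right_mono diff_divide_distrib[symmetric])

lemma indicator_eq_sum_cell:
  assumes N: "0 < N"
  shows "indicator {0..<1} x = (\<Sum>j<N. indicator (cell N j) x :: ennreal)"
proof (cases "x \<in> {0..<1}")
  case True
  define i where "i = nat \<lfloor>x * N\<rfloor>"
  have i: "real i \<le> x * N" "x * N < real i + 1" using True N by (auto simp: i_def)
  have iN: "i < N"
  proof -
    have "x * N < 1 * real N" using True N by (intro mult_strict_right_mono) auto
    then show ?thesis using i by linarith
  qed
  have "x \<in> cell N j \<longleftrightarrow> j = i" for j
  proof -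
    have "x \<in> cell N j \<longleftrightarrow> real j \<le> x * N \<and> x * N < real j + 1"
      using N by (auto simp: cell_def field_simps)
    then show ?thesis using i by auto
  qed
  then have "(\<Sum>j<N. indicator (cell N j) x :: ennreal) = (\<Sum>j<N. if j = i then 1 else 0)"
    by (intro sum.cong) (auto simp: indicator_def)
  then show ?thesis using True iN by (simp add: sum.delta)
next
  case False
  have "x \<notin> cell N j" if "j < N" for j
  proof
    assume "x \<in> cell N j"
    then have x: "real j / N \<le> x" "x < (real j + 1) / N" by (auto simp: cell_def)
    have "(real j + 1) / N \<le> 1" using that N by (auto simp: field_simps)
    moreover have "0 \<le> x" by (rule order_trans[OF _ x(1)]) simp
    ultimately show False using x False by auto
  qed
  then show ?thesis using False by simp
qed

lemma strip_integral_eq_sum_cell: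
  assumes [measurable]: "r \<in> borel_measurable borel" "f \<in> borel_measurable borel" and N: "0 < N"
  shows "strip_integral {0..<1} f w r = (\<Sum>j<N. strip_integral (cell N j) f w r)"
  unfolding strip_integral_def indicator_eq_sum_cell[OF N] sum_distrib_left
  by (rule nn_integral_sum) measurable

lemma strip_integral_cong:
  "(\<And>x. x \<in> I \<Longrightarrow> f x = g x) \<Longrightarrow> strip_integral I f w r = strip_integral I g w r"
  unfolding strip_integral_def by (intro nn_integral_cong) (auto simp: indicator_def)

text \<open>\<open>ramp (real N * x - real i)\<close> is the fraction of the i-th cell that lies to
  the left of \<open>x\<close>.\<close>

definition ramp :: "real \<Rightarrow> real" where
  "ramp u = max 0 (min 1 u)"

lemma sum_ramp: "(\<Sum>i<n. ramp (u - real i)) = max 0 (min (real n) u)"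
  by (induction n) (auto simp: ramp_def min_def max_def)

text \<open>On the \<open>j\<close>-th cell the walk runs linearly from \<open>\<omega> j\<close> to \<open>\<omega> (Suc j)\<close> modulo 1, always in the positive
  direction. With uniform phases the increment is independent of the starting point, so the walk is
  uniform modulo 1 at every \<open>x\<close>.\<close>

definition walk :: "nat \<Rightarrow> (nat \<Rightarrow> real) \<Rightarrow> real \<Rightarrow> real" where
  "walk N \<omega> x = \<omega> 0 + (\<Sum>i<N. frac (\<omega> (Suc i) - \<omega> i) * ramp (real N * x - real i))"

text \<open>Every increment \<open>frac (...)\<close> lies in [0, 1) and every \<open>ramp\<close>
  is monotone. So the walk is nondecreasing and grows no faster than the sum of all ramps, which is
  \<open>real N * x\<close> clamped to [0, N].\<close>

lemma walk_lipschitz: "\<bar>walk N \<omega> x - walk N \<omega> y\<bar> \<le> N * \<bar>x - y\<bar>"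
proof (induction x y rule: linorder_wlog)
  case (le x y)
  have mono: "ramp (real N * x - real i) \<le> ramp (real N * y - real i)" for i
  proof -
    have "real N * x \<le> real N * y" using le by (intro mult_left_mono) auto
    then show ?thesis unfolding ramp_def by auto
  qed
  have "walk N \<omega> y - walk N \<omega> x =
      (\<Sum>i<N. frac (\<omega> (Suc i) - \<omega> i) * (ramp (real N * y - real i) - ramp (real N * x - real i)))"
    by (simp add: walk_def sum_subtractf right_diff_distrib)
  moreover have "0 \<le> (\<Sum>i<N. frac (\<omega> (Suc i) - \<omega> i) * (ramp (real N * y - real i) - ramp (real N * x - real i)))"
    using mono by (intro sum_nonneg mult_nonneg_nonneg) auto
  moreover have "(\<Sum>i<N. frac (\<omega> (Suc i) - \<omega> i) * (ramp (real N * y - real i) - ramp (real N * x - real i)))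
      \<le> (\<Sum>i<N. 1 * (ramp (real N * y - real i) - ramp (real N * x - real i)))"
    using mono by (intro sum_mono mult_right_mono) (auto simp: less_imp_le[OF frac_lt_1])
  moreover have "\<dots> = max 0 (min (real N) (real N * y)) - max 0 (min (real N) (real N * x))"
    by (simp add: sum_subtractf sum_ramp)
  moreover have "\<dots> \<le> N * y - N * x"
    using mult_left_mono[OF le, of "real N"] by auto
  ultimately have "0 \<le> walk N \<omega> y - walk N \<omega> x" "walk N \<omega> y - walk N \<omega> x \<le> N * (y - x)"
    by (auto simp: right_diff_distrib)
  then show ?case using le by (simp add: abs_if)
qed (simp add: abs_minus_commute)

text \<open>On cell \<open>j\<close> the earlier ramps are 1 and the later ones 0. The increments
  telescope to \<open>\<omega> j - \<omega> 0\<close> up to an integer, which \<open>tri\<close>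
  does not see; hence the height over one cell depends on two phases only.\<close>

lemma tri_walk:
  assumes j: "j < N" and x: "x \<in> cell N j"
  shows "tri (walk N \<omega> x) = tri (\<omega> j + (real N * x - real j) * frac (\<omega> (Suc j) - \<omega> j))"
proof -
  have N: "0 < N" using j by simp
  have x': "real j \<le> N * x" "N * x < real j + 1" using x N by (auto simp: cell_def field_simps)
  have "(\<Sum>i<N. frac (\<omega> (Suc i) - \<omega> i) * ramp (real N * x - real i))
     = (\<Sum>i<Suc j. frac (\<omega> (Suc i) - \<omega> i) * ramp (real N * x - real i))"
    using j x' by (intro sum.mono_neutral_right) (auto simp: ramp_def)
  also have "\<dots> = (\<Sum>i<j. frac (\<omega> (Suc i) - \<omega> i) * ramp (real N * x - real i))
      + frac (\<omega> (Suc j) - \<omega> j) * (real N * x - real j)"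
    using x' by (simp add: ramp_def)
  also have "(\<Sum>i<j. frac (\<omega> (Suc i) - \<omega> i) * ramp (real N * x - real i)) = (\<Sum>i<j. frac (\<omega> (Suc i) - \<omega> i))"
  proof (rule sum.cong[OF refl])
    fix i assume "i \<in> {..<j}"
    then have "real i + 1 \<le> real j" by auto
    then show "frac (\<omega> (Suc i) - \<omega> i) * ramp (real N * x - real i) = frac (\<omega> (Suc i) - \<omega> i)"
      using x' by (simp add: ramp_def)
  qed
  also have "(\<Sum>i<j. frac (\<omega> (Suc i) - \<omega> i)) = \<omega> j - \<omega> 0 + of_int (- (\<Sum>i<j. \<lfloor>\<omega> (Suc i) - \<omega> i\<rfloor>))"
  proof -
    have "(\<Sum>i<j. frac (\<omega> (Suc i) - \<omega> i)) = (\<Sum>i<j. \<omega> (Suc i) - \<omega> i) - (\<Sum>i<j. of_int \<lfloor>\<omega> (Suc i) - \<omega> i\<rfloor>)"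
      unfolding frac_def by (rule sum_subtractf)
    then show ?thesis by (simp add: sum_lessThan_telescope)
  qed
  finally have "walk N \<omega> x = (\<omega> j + (real N * x - real j) * frac (\<omega> (Suc j) - \<omega> j))
      + of_int (- (\<Sum>i<j. \<lfloor>\<omega> (Suc i) - \<omega> i\<rfloor>))"
    by (simp add: walk_def algebra_simps)
  then show ?thesis by (simp only: tri_add_of_int)
qed

text \<open>One step for finitely many densities. \<open>B\<close> bounds the share of one cell in
  the new mean. The loss is a factor \<open>1 + \<epsilon>\<close> and a summand \<open>a\<close>
  per parity class, and \<open>w / (w - w')\<close> reflects that the lower edge ranges over a
  height \<open>w - w'\<close> only. The 2 in \<open>few\<close> counts the parity classes.\<close>

lemma random_refinement:
  fixes r :: "'k \<Rightarrow> R2 \<Rightarrow> ennreal" and N :: nat and w w' t q B \<epsilon> a m :: real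
  assumes K: "finite K" and r: "\<And>k. k \<in> K \<Longrightarrow> tail_bound q (r k)"
    and f[measurable]: "f \<in> borel_measurable borel"
    and w: "0 < w'" "w' < w" and N: "0 < N" and t: "0 < t"
    and B: "t / N + t powr (1 - q) / w' \<le> B" and \<epsilon>: "0 < \<epsilon>" "\<epsilon> \<le> 1"
    and few: "2 * card K * exp (- (\<epsilon> / B * a)) < 1"
    and m: "0 \<le> m" and mass: "\<And>k. k \<in> K \<Longrightarrow> strip_integral {0..<1} f w (r k) \<le> ennreal (w * m)"
  obtains g where "(2 * N * (w - w'))-lipschitz_on UNIV g" "\<And>x. 0 \<le> g x" "\<And>x. g x \<le> w - w'"
    "\<And>k. k \<in> K \<Longrightarrow> strip_integral {0..<1} (\<lambda>x. f x + g x) w' (r k)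
        \<le> ennreal (w' * ((1 + \<epsilon>) * (w / (w - w') * m) + 2 * a))"
proof -
  interpret prob_space phases by (rule prob_space_phases)
  \<comment> \<open>Amplitude of the displacement: with the lower edge raised by at most
    \<open>D\<close>, the strip of width \<open>w'\<close> stays inside the old one.\<close>
  define D where "D = w - w'"
  have D: "0 < D" using w by (simp add: D_def)
  have Bpos: "0 < B"
  proof -
    have "0 < t / N" using t N by simp
    moreover have "0 \<le> t powr (1 - q) / w'" using w by simp
    ultimately show ?thesis using B by linarith
  qed
  \<comment> \<open>\<open>Z\<close> is the mass over one cell as a function of its two phases,
    \<open>F\<close> its share in the new mean, and \<open>\<mu>\<close> a bound for the expectation
    of \<open>F\<close>, read off from the old strip.\<close>
  define Z where "Z k j z = strip_integral (cell N j)
      (\<lambda>x. f x + D * tri (fst z + (real N * x - real j) * frac (snd z - fst z))) w' (r k)"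
    for k j and z :: "real \<times> real"
  define F where "F k j z = enn2real (Z k j z) / w'" for k j z
  define \<mu> where "\<mu> k j = enn2real (strip_integral (cell N j) f w (r k)) / D" for k j
  have rm[measurable]: "r k \<in> borel_measurable borel" if "k \<in> K" for k
    using r[OF that] by (simp add: tail_bound_def)
  have Zm: "Z k j \<in> borel_measurable (unif \<Otimes>\<^sub>M unif)" if "k \<in> K" for k j
    using rm[OF that] unfolding Z_def strip_integral_def by measurable
  have Zle: "Z k j z \<le> ennreal (w' * B)" if k: "k \<in> K" for k j z
  proof -
    have "Z k j z \<le> ennreal (t * (1 / N * w') + t powr (1 - q))"
      unfolding Z_def using w t N
      by (intro strip_integral_le_tail[OF r[OF k]]) (auto simp: emeasure_cell)
    also have "\<dots> \<le> ennreal (w' * B)"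
    proof (rule ennreal_leI)
      have "w' * (t / N + t powr (1 - q) / w') \<le> w' * B" using B w by (intro mult_left_mono) auto
      moreover have "w' * (t / N + t powr (1 - q) / w') = t * (1 / N * w') + t powr (1 - q)"
        using w by (simp add: distrib_left)
      ultimately show "t * (1 / N * w') + t powr (1 - q) \<le> w' * B" by simp
    qed
    finally show ?thesis .
  qed
  have Fm: "F k j \<in> borel_measurable (unif \<Otimes>\<^sub>M unif)" if "k \<in> K" for k j
    using Zm[OF that] unfolding F_def by measurable
  have Fbnd: "0 \<le> F k j z \<and> F k j z \<le> B" if "k \<in> K" for k j z
  proof -
    have "enn2real (Z k j z) \<le> w' * B"
      using Zle[OF that] w Bpos by (intro enn2real_leI) auto
    then show ?thesis using w by (auto simp: F_def field_simps)
  qed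
  have FZ: "ennreal (F k j z) = ennreal (1 / w') * Z k j z" if "k \<in> K" for k j z
  proof -
    have "Z k j z < \<top>" using Zle[OF that] by (rule le_less_trans) simp
    then have "Z k j z = ennreal (enn2real (Z k j z))" by simp
    moreover have "ennreal (F k j z) = ennreal (1 / w') * ennreal (enn2real (Z k j z))"
      using w unfolding F_def by (subst ennreal_mult[symmetric]) auto
    ultimately show ?thesis by simp
  qed
  have part: "strip_integral (cell N j) f w (r k) < \<top>" if "k \<in> K" "j < N" for k j
  proof -
    have "strip_integral (cell N j) f w (r k) \<le> (\<Sum>j<N. strip_integral (cell N j) f w (r k))"
      using that by (intro member_le_sum) auto
    also have "\<dots> = strip_integral {0..<1} f w (r k)"
      using that N by (intro strip_integral_eq_sum_cell[symmetric]) auto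
    also have "\<dots> < \<top>" using mass[OF that(1)] by (rule le_less_trans) simp
    finally show ?thesis .
  qed
  have \<mu>: "0 \<le> \<mu> k j" for k j using D by (simp add: \<mu>_def)
  have \<mu>sum: "(\<Sum>j<N. \<mu> k j) \<le> w / D * m" if "k \<in> K" for k
  proof -
    have "(\<Sum>j<N. enn2real (strip_integral (cell N j) f w (r k))) = enn2real (\<Sum>j<N. strip_integral (cell N j) f w (r k))"
      using part[OF that] by (subst enn2real_sum) auto
    also have "\<dots> = enn2real (strip_integral {0..<1} f w (r k))"
      using that N by (subst strip_integral_eq_sum_cell) auto
    also have "\<dots> \<le> w * m" using mass[OF that] w m by (intro enn2real_leI) auto
    finally show ?thesis using D unfolding \<mu>_def sum_divide_distrib[symmetric] by (simp add: field_simps)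
  qed
  have mean: "(\<integral>\<^sup>+\<omega>. ennreal (F k j (\<omega> j, \<omega> (Suc j))) \<partial>phases) \<le> ennreal (\<mu> k j)" if k: "k \<in> K" and j: "j < N" for k j
  proof -
    have "(\<integral>\<^sup>+\<omega>. ennreal (F k j (\<omega> j, \<omega> (Suc j))) \<partial>phases)
        = (\<integral>\<^sup>+z. ennreal (F k j z) \<partial>(distr phases (unif \<Otimes>\<^sub>M unif) (\<lambda>\<omega>. (\<omega> j, \<omega> (Suc j)))))"
      using Fm[OF k] by (subst nn_integral_distr) auto
    also have "\<dots> = (\<integral>\<^sup>+z. ennreal (1 / w') * Z k j z \<partial>(unif \<Otimes>\<^sub>M unif))"
      by (simp add: distr_phases_pair FZ[OF k])
    also have "\<dots> = ennreal (1 / w') * (\<integral>\<^sup>+z. Z k j z \<partial>(unif \<Otimes>\<^sub>M unif))"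
      using Zm[OF k] by (rule nn_integral_cmult)
    also have "\<dots> \<le> ennreal (1 / w') * (ennreal (w' / D) * strip_integral (cell N j) f (D + w') (r k))"
      unfolding Z_def using rm[OF k] D w by (intro mult_left_mono nn_integral_random_strip_le) auto
    also have "\<dots> = ennreal (1 / D) * strip_integral (cell N j) f w (r k)"
      using w D by (simp add: mult.assoc[symmetric] ennreal_mult[symmetric]) (simp add: D_def)
    also have "\<dots> = ennreal (1 / D) * ennreal (enn2real (strip_integral (cell N j) f w (r k)))"
      using part[OF k j] by simp
    also have "\<dots> = ennreal (\<mu> k j)"
      using D unfolding \<mu>_def by (subst ennreal_mult[symmetric]) auto
    finally show ?thesis .
  qed
  define J where "J b = {j. j < N \<and> even j = b}" for b
  define X where "X k b \<omega> = (\<Sum>j\<in>J b. F k j (\<omega> j, \<omega> (Suc j))) - (1 + \<epsilon>) * (\<Sum>j\<in>J b. \<mu> k j) - a" for k b \<omega>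
  have Xm: "X k b \<in> borel_measurable phases" if "k \<in> K" for k b
    unfolding X_def using Fm[OF that] by measurable
  have Em: "(\<lambda>\<omega>. ennreal (exp (\<epsilon> / B * X k b \<omega>))) \<in> borel_measurable phases" if "k \<in> K" for k b
  proof -
    note Xm[OF that, measurable]
    show ?thesis by measurable
  qed
  have Xint: "(\<integral>\<^sup>+\<omega>. ennreal (exp (\<epsilon> / B * X k b \<omega>)) \<partial>phases) \<le> ennreal (exp (- (\<epsilon> / B * a)))" if k: "k \<in> K" for k b
    unfolding X_def
  proof (rule exp_moment_indep_sum_le)
    show "indep_vars (\<lambda>_. borel) (\<lambda>j \<omega>. F k j (\<omega> j, \<omega> (Suc j))) (J b)"
      unfolding J_def by (rule indep_vars_phases_pairs) (rule Fm[OF k])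
  qed (use Fbnd[OF k] mean[OF k] \<mu> Bpos \<epsilon> in \<open>auto simp: J_def\<close>)
  \<comment> \<open>Pieces with indices of equal parity share no phase; hence one exponential moment per parity \<open>b\<close>.\<close>
  have "\<exists>\<omega>. (\<Sum>k\<in>K. \<Sum>b\<in>UNIV. ennreal (exp (\<epsilon> / B * X k b \<omega>))) < 1"
  proof (rule ccontr)
    assume "\<not> ?thesis"
    then have ge: "1 \<le> (\<Sum>k\<in>K. \<Sum>b\<in>UNIV. ennreal (exp (\<epsilon> / B * X k b \<omega>)))" for \<omega>
      by (auto simp: not_less)
    have "1 = (\<integral>\<^sup>+\<omega>. 1 \<partial>phases)" using emeasure_space_1 by simp
    also have "\<dots> \<le> (\<integral>\<^sup>+\<omega>. (\<Sum>k\<in>K. \<Sum>b\<in>UNIV. ennreal (exp (\<epsilon> / B * X k b \<omega>))) \<partial>phases)"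
      by (intro nn_integral_mono ge)
    also have "\<dots> = (\<Sum>k\<in>K. \<Sum>b\<in>UNIV. \<integral>\<^sup>+\<omega>. ennreal (exp (\<epsilon> / B * X k b \<omega>)) \<partial>phases)"
    proof -
      have "(\<integral>\<^sup>+\<omega>. (\<Sum>k\<in>K. \<Sum>b\<in>UNIV. ennreal (exp (\<epsilon> / B * X k b \<omega>))) \<partial>phases)
          = (\<Sum>k\<in>K. \<integral>\<^sup>+\<omega>. (\<Sum>b\<in>UNIV. ennreal (exp (\<epsilon> / B * X k b \<omega>))) \<partial>phases)"
        by (intro nn_integral_sum borel_measurable_sum Em)
      also have "\<dots> = (\<Sum>k\<in>K. \<Sum>b\<in>UNIV. \<integral>\<^sup>+\<omega>. ennreal (exp (\<epsilon> / B * X k b \<omega>)) \<partial>phases)"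
        by (intro sum.cong[OF refl] nn_integral_sum Em)
      finally show ?thesis .
    qed
    also have "\<dots> \<le> (\<Sum>k\<in>K. \<Sum>b\<in>(UNIV::bool set). ennreal (exp (- (\<epsilon> / B * a))))"
      by (intro sum_mono Xint)
    also have "\<dots> = ennreal (2 * card K * exp (- (\<epsilon> / B * a)))"
      by (simp add: card_UNIV_bool ennreal_mult ennreal_of_nat_eq_real_of_nat mult.commute mult.left_commute)
    also have "\<dots> < 1" using few by (simp add: ennreal_less_one_iff)
    finally show False by simp
  qed
  then obtain \<omega> where \<omega>: "(\<Sum>k\<in>K. \<Sum>b\<in>UNIV. ennreal (exp (\<epsilon> / B * X k b \<omega>))) < 1" by blast
  \<comment> \<open>A sum of nonnegative terms that is below 1 forces each exponential below 1,
    hence each exponent below 0, for all \<open>k\<close> and both parities at once.\<close>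
  have Xneg: "X k b \<omega> \<le> 0" if k: "k \<in> K" for k b
  proof -
    have "ennreal (exp (\<epsilon> / B * X k b \<omega>)) \<le> (\<Sum>b\<in>UNIV. ennreal (exp (\<epsilon> / B * X k b \<omega>)))"
      by (rule member_le_sum) auto
    also have "\<dots> \<le> (\<Sum>k\<in>K. \<Sum>b\<in>UNIV. ennreal (exp (\<epsilon> / B * X k b \<omega>)))"
      using k K by (intro member_le_sum) auto
    finally have "ennreal (exp (\<epsilon> / B * X k b \<omega>)) < 1" using \<omega> by (rule le_less_trans)
    then have "exp (\<epsilon> / B * X k b \<omega>) < 1" by (simp add: ennreal_less_one_iff)
    then have "\<epsilon> / B * X k b \<omega> < 0" by simp
    then show ?thesis using \<epsilon> Bpos by (simp add: mult_less_0_iff zero_less_divide_iff divide_less_0_iff)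
  qed
  define g where "g x = D * tri (walk N \<omega> x)" for x
  have glip: "(2 * N * (w - w'))-lipschitz_on UNIV g"
  proof (rule lipschitz_onI)
    fix x y :: real
    have "\<bar>g x - g y\<bar> = D * \<bar>tri (walk N \<omega> x) - tri (walk N \<omega> y)\<bar>"
      using D by (simp add: g_def abs_mult flip: right_diff_distrib)
    also have "\<dots> \<le> D * (2 * (N * \<bar>x - y\<bar>))"
      using D walk_lipschitz[of N \<omega> x y]
      by (intro mult_left_mono order_trans[OF tri_lipschitz]) auto
    finally show "dist (g x) (g y) \<le> 2 * N * (w - w') * dist x y"
      by (simp only: dist_real_def D_def mult_ac of_nat_mult of_nat_numeral)
  qed (use w in auto)
  have gm[measurable]: "g \<in> borel_measurable borel"
    using glip lipschitz_on_continuous_on borel_measurable_continuous_onI by blast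
  show ?thesis
  proof (rule that[OF glip])
    show "0 \<le> g x" for x using D tri_bounds by (simp add: g_def)
    show "g x \<le> w - w'" for x using D tri_bounds(2)[of "walk N \<omega> x"] by (simp add: g_def D_def mult_left_le)
    fix k assume k: "k \<in> K"
    have "strip_integral {0..<1} (\<lambda>x. f x + g x) w' (r k) = (\<Sum>j<N. strip_integral (cell N j) (\<lambda>x. f x + g x) w' (r k))"
      using k N by (intro strip_integral_eq_sum_cell) auto
    \<comment> \<open>Up to the integer discarded by \<open>tri\<close>, the single global walk
      realises on each cell the two-phase path used in \<open>Z\<close>.\<close>
    also have "\<dots> = (\<Sum>j<N. Z k j (\<omega> j, \<omega> (Suc j)))"
      unfolding Z_def g_def by (intro sum.cong strip_integral_cong refl) (auto simp: tri_walk)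
    also have "\<dots> = (\<Sum>j<N. ennreal (w' * F k j (\<omega> j, \<omega> (Suc j))))"
      using w FZ[OF k] by (intro sum.cong refl)
        (simp add: ennreal_mult' mult.assoc[symmetric] ennreal_mult[symmetric])
    also have "\<dots> = ennreal (w' * (\<Sum>j<N. F k j (\<omega> j, \<omega> (Suc j))))"
      using w Fbnd[OF k] by (subst sum_ennreal) (auto simp: sum_distrib_left)
    also have "\<dots> \<le> ennreal (w' * ((1 + \<epsilon>) * (w / (w - w') * m) + 2 * a))"
    proof (intro ennreal_leI mult_left_mono)
      have split: "(\<Sum>j<N. h j) = (\<Sum>j\<in>J True. h j) + (\<Sum>j\<in>J False. h j)" for h :: "nat \<Rightarrow> real"
        by (subst sum.union_disjoint[symmetric]) (auto simp: J_def intro!: sum.cong)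
      have "(\<Sum>j<N. F k j (\<omega> j, \<omega> (Suc j))) \<le> (1 + \<epsilon>) * (\<Sum>j<N. \<mu> k j) + 2 * a"
        using Xneg[OF k, of True] Xneg[OF k, of False] unfolding X_def split by (simp add: algebra_simps)
      also have "(1 + \<epsilon>) * (\<Sum>j<N. \<mu> k j) \<le> (1 + \<epsilon>) * (w / D * m)"
        using \<mu>sum[OF k] \<epsilon> by (intro mult_left_mono) auto
      finally show "(\<Sum>j<N. F k j (\<omega> j, \<omega> (Suc j))) \<le> (1 + \<epsilon>) * (w / (w - w') * m) + 2 * a"
        by (simp add: D_def)
    qed (use w in auto)
    finally show "strip_integral {0..<1} (\<lambda>x. f x + g x) w' (r k) \<le> ennreal (w' * ((1 + \<epsilon>) * (w / (w - w') * m) + 2 * a))" .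
  qed
qed

section \<open>Isometries of the plane\<close>

text \<open>Phrased as a substitution rule for nonnegative Borel functions, which is closed under
  composition; rigid motions are then assembled from shears, swaps and reflections.\<close>

definition area_preserving :: "(R2 \<Rightarrow> R2) \<Rightarrow> bool" where
  "area_preserving \<phi> \<longleftrightarrow> \<phi> \<in> borel_measurable borel \<and>
    (\<forall>h\<in>borel_measurable borel. (\<integral>\<^sup>+z. h (\<phi> z) \<partial>lborel) = (\<integral>\<^sup>+z. h z \<partial>(lborel :: R2 measure)))"

lemma area_preserving_nn_integral:
  "area_preserving \<phi> \<Longrightarrow> h \<in> borel_measurable borel \<Longrightarrow>
    (\<integral>\<^sup>+z. h (\<phi> z) \<partial>lborel) = (\<integral>\<^sup>+z. h z \<partial>lborel)"
  by (simp add: area_preserving_def)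

lemma area_preserving_comp:
  assumes "area_preserving \<phi>" "area_preserving \<psi>"
  shows "area_preserving (\<lambda>z. \<phi> (\<psi> z))"
  unfolding area_preserving_def
proof (intro conjI ballI)
  have m[measurable]: "\<phi> \<in> borel_measurable borel" "\<psi> \<in> borel_measurable borel"
    using assms by (auto simp: area_preserving_def)
  then show "(\<lambda>z. \<phi> (\<psi> z)) \<in> borel_measurable borel" by measurable
  fix h :: "R2 \<Rightarrow> ennreal" assume h[measurable]: "h \<in> borel_measurable borel"
  have "(\<lambda>z. h (\<phi> z)) \<in> borel_measurable borel" by measurable
  from area_preserving_nn_integral[OF assms(2) this]
  have "(\<integral>\<^sup>+z. h (\<phi> (\<psi> z)) \<partial>lborel) = (\<integral>\<^sup>+z. h (\<phi> z) \<partial>lborel)" .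
  also have "\<dots> = integral\<^sup>N lborel h"
    by (rule area_preserving_nn_integral[OF assms(1) h])
  finally show "(\<integral>\<^sup>+z. h (\<phi> (\<psi> z)) \<partial>lborel) = integral\<^sup>N lborel h" .
qed

lemma nn_integral_plane:
  assumes [measurable]: "h \<in> borel_measurable borel"
  shows "(\<integral>\<^sup>+z. h z \<partial>(lborel :: R2 measure)) = (\<integral>\<^sup>+x. \<integral>\<^sup>+y. h (x, y) \<partial>lborel \<partial>lborel)"
  using nn_integral_shear[of h "\<lambda>_. 0"] by simp

lemma area_preserving_vertical_shear:
  assumes [measurable]: "f \<in> borel_measurable borel"
  shows "area_preserving (\<lambda>z. (fst z, f (fst z) + snd z))"
proof -
  have m[measurable]: "(\<lambda>z. (fst z, f (fst z) + snd z)) \<in> borel_measurable (borel :: R2 measure)"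
    unfolding borel_prod[symmetric] by measurable
  show ?thesis
    unfolding area_preserving_def
  proof (intro conjI ballI m)
    fix h :: "R2 \<Rightarrow> ennreal" assume [measurable]: "h \<in> borel_measurable borel"
    have "(\<integral>\<^sup>+z. h (fst z, f (fst z) + snd z) \<partial>lborel) = (\<integral>\<^sup>+x. \<integral>\<^sup>+s. h (x, f x + s) \<partial>lborel \<partial>lborel)"
      using measurable_compose[OF m \<open>h \<in> _\<close>] by (subst nn_integral_plane) auto
    then show "(\<integral>\<^sup>+z. h (fst z, f (fst z) + snd z) \<partial>lborel) = integral\<^sup>N lborel h"
      by (simp add: nn_integral_shear)
  qed
qed

lemma area_preserving_swap: "area_preserving (\<lambda>z. (snd z, fst z))"
proof -
  have m[measurable]: "(\<lambda>z. (snd z, fst z)) \<in> borel_measurable (borel :: R2 measure)"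
    unfolding borel_prod[symmetric] by measurable
  show ?thesis
    unfolding area_preserving_def
  proof (intro conjI ballI m)
    fix h :: "R2 \<Rightarrow> ennreal" assume h[measurable]: "h \<in> borel_measurable borel"
    have "(\<integral>\<^sup>+z. h (snd z, fst z) \<partial>lborel) = (\<integral>\<^sup>+x. \<integral>\<^sup>+y. h (y, x) \<partial>lborel \<partial>lborel)"
      using measurable_compose[OF m h] by (subst nn_integral_plane) auto
    also have "\<dots> = (\<integral>\<^sup>+y. \<integral>\<^sup>+x. h (y, x) \<partial>lborel \<partial>lborel)"
      using h by (intro lborel_pair.Fubini'[where f="\<lambda>y x. h (y, x)"]) (simp add: lborel_prod)
    also have "\<dots> = integral\<^sup>N lborel h" by (simp add: nn_integral_plane)
    finally show "(\<integral>\<^sup>+z. h (snd z, fst z) \<partial>lborel) = integral\<^sup>N lborel h" .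
  qed
qed

lemma area_preserving_horizontal_shear:
  assumes [measurable]: "f \<in> borel_measurable borel"
  shows "area_preserving (\<lambda>z. (f (snd z) + fst z, snd z))"
  using area_preserving_comp[OF area_preserving_swap
      area_preserving_comp[OF area_preserving_vertical_shear[OF assms] area_preserving_swap]]
  by simp

lemma area_preserving_reflect: "area_preserving (\<lambda>z. (fst z, - snd z))"
proof -
  have m[measurable]: "(\<lambda>z. (fst z, - snd z)) \<in> borel_measurable (borel :: R2 measure)"
    unfolding borel_prod[symmetric] by measurable
  show ?thesis
    unfolding area_preserving_def
  proof (intro conjI ballI m)
    fix h :: "R2 \<Rightarrow> ennreal" assume h[measurable]: "h \<in> borel_measurable borel"
    have "(\<integral>\<^sup>+y. h (x, - y) \<partial>lborel) = (\<integral>\<^sup>+y. h (x, y) \<partial>lborel)" for x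
      by (subst (2) nn_integral_real_affine[where c="-1" and t=0]) auto
    then show "(\<integral>\<^sup>+z. h (fst z, - snd z) \<partial>lborel) = integral\<^sup>N lborel h"
      using measurable_compose[OF m h] by (subst (1 2) nn_integral_plane) auto
  qed
qed

text \<open>The translation is (a, b), the first column of the matrix is (c, d), and on
  \<open>rigid_params\<close> its determinant is \<open>s\<close>. Using (c, d) on the unit circle
  instead of an angle lets parameters be compared coordinate by coordinate.\<close>

definition rigid :: "real \<times> real \<times> real \<times> real \<times> real \<Rightarrow> R2 \<Rightarrow> R2" where
  "rigid = (\<lambda>(a, b, c, d, s) (x, y). (a + c * x - s * d * y, b + d * x + s * c * y))"

text \<open>The linear part is the transposed matrix, the inverse of an orthogonal one.\<close>

definition rigid_inv :: "real \<times> real \<times> real \<times> real \<times> real \<Rightarrow> R2 \<Rightarrow> R2" where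
  "rigid_inv = (\<lambda>(a, b, c, d, s) (u, v). (c * (u - a) + d * (v - b), s * (c * (v - b) - d * (u - a))))"

definition rigid_params :: "(real \<times> real \<times> real \<times> real \<times> real) set" where
  "rigid_params = {(a, b, c, d, s). c\<^sup>2 + d\<^sup>2 = 1 \<and> s \<in> {1, -1}}"

lemma rigid_inv_rigid: "P \<in> rigid_params \<Longrightarrow> rigid_inv P (rigid P z) = z"
proof (cases P, cases z)
  fix a b c d s x y assume P: "P \<in> rigid_params" "P = (a, b, c, d, s)" "z = (x, y)"
  then have cd: "c * c + d * d = 1" and s: "s * s = 1" by (auto simp: rigid_params_def power2_eq_square)
  have "c * (c * x - s * d * y) + d * (d * x + s * c * y) = (c * c + d * d) * x" by (simp add: algebra_simps)
  moreover have "s * (c * (d * x + s * c * y) - d * (c * x - s * d * y)) = (s * s) * (c * c + d * d) * y"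
    by (simp add: algebra_simps)
  ultimately show ?thesis unfolding P using cd s
    by (simp add: rigid_def rigid_inv_def add_diff_eq[symmetric])
qed

lemma rigid_measurable[measurable]: "rigid P \<in> borel_measurable borel"
  by (cases P) (simp add: rigid_def case_prod_beta', intro borel_measurable_continuous_onI continuous_intros)

lemma rigid_inv_measurable[measurable]: "rigid_inv P \<in> borel_measurable borel"
  by (cases P) (simp add: rigid_inv_def case_prod_beta', intro borel_measurable_continuous_onI continuous_intros)

text \<open>For \<open>d \<noteq> 0\<close> a rotation is a product of three shears: horizontal with
  slope (c - 1)/d, vertical with slope d, and the same horizontal one again. For
  \<open>d = 0\<close> there remain the identity and the half turn, which is a product of two
  reflections.\<close>

lemma area_preserving_rotation:
  assumes "c\<^sup>2 + d\<^sup>2 = 1"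
  shows "area_preserving (\<lambda>z. (c * fst z - d * snd z, d * fst z + c * snd z))"
proof (cases "d = 0")
  case False
  define k where "k = (c - 1) / d"
  have kd: "k * d = c - 1" using False by (simp add: k_def)
  have kc: "k * c + k = - d"
  proof -
    have "(k * c + k) * d = (k * d) * (c + 1)" by (simp add: algebra_simps)
    also have "\<dots> = - d * d" using assms unfolding kd by (simp add: algebra_simps power2_eq_square)
    finally have "(k * c + k) * d = (- d) * d" by simp
    then show ?thesis using mult_right_cancel[OF False] by blast
  qed
  have H: "area_preserving (\<lambda>z. (k * snd z + fst z, snd z))" by (rule area_preserving_horizontal_shear) auto
  have V: "area_preserving (\<lambda>z. (fst z, d * fst z + snd z))" by (rule area_preserving_vertical_shear) auto
  have "k * (d * (k * y + x) + y) + (k * y + x) = c * x - d * y"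
       "d * (k * y + x) + y = d * x + c * y" for x y
  proof -
    have "d * (k * y + x) + y = d * x + (k * d) * y + y" by (simp add: algebra_simps)
    then show 1: "d * (k * y + x) + y = d * x + c * y" unfolding kd by (simp add: algebra_simps)
    have "k * (d * x + c * y) + (k * y + x) = (k * d) * x + x + (k * c + k) * y" by (simp add: algebra_simps)
    then show "k * (d * (k * y + x) + y) + (k * y + x) = c * x - d * y"
      unfolding 1 kd kc by (simp add: algebra_simps)
  qed
  then show ?thesis using area_preserving_comp[OF H area_preserving_comp[OF V H]] by simp
next
  case True
  then consider "c = 1" | "c = -1" using assms by (auto simp: power2_eq_1_iff)
  then show ?thesis
  proof cases
    case 1 then show ?thesis using True by (simp add: area_preserving_def)
  next
    case 2
    then show ?thesis
      using True area_preserving_comp[OF area_preserving_swap area_preserving_comp[OF area_preserving_reflect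
          area_preserving_comp[OF area_preserving_swap area_preserving_reflect]]] by simp
  qed
qed

lemma area_preserving_rigid:
  assumes "P \<in> rigid_params"
  shows "area_preserving (rigid P)"
proof -
  obtain a b c d s where P: "P = (a, b, c, d, s)" by (cases P)
  have cd: "c\<^sup>2 + d\<^sup>2 = 1" and s: "s = 1 \<or> s = -1" using assms by (auto simp: P rigid_params_def)
  have R: "area_preserving (\<lambda>z. (fst z, s * snd z))"
    using s area_preserving_reflect by (auto simp: area_preserving_def)
  have T: "area_preserving (\<lambda>z. (a + fst z, b + snd z))"
    using area_preserving_comp[OF area_preserving_vertical_shear[of "\<lambda>_. b"] area_preserving_horizontal_shear[of "\<lambda>_. a"]]
    by simp
  have "rigid P = (\<lambda>z. (a + (c * fst z - d * (s * snd z)), b + (d * fst z + c * (s * snd z))))"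
    by (auto simp: P rigid_def fun_eq_iff)
  then show ?thesis
    using area_preserving_comp[OF T area_preserving_comp[OF area_preserving_rotation[OF cd] R]] by simp
qed

text \<open>After subtraction of the image of 0 the map is orthogonal. Its columns are orthonormal,
  so the second is the first turned by a right angle, times the determinant \<open>s\<close>, which
  is 1 or -1.\<close>

lemma isometry_R2_eq_rigid:
  assumes "isometry_R2 \<iota>"
  obtains P where "P \<in> rigid_params" "\<iota> = rigid P"
proof -
  define T where "T z = \<iota> z - \<iota> 0" for z
  have "orthogonal_transformation T"
    unfolding orthogonal_transformation_isometry T_def
    using assms by (auto simp: isometry_R2_def dist_norm)
  then have lin: "linear T" and inn: "\<And>v w. T v \<bullet> T w = v \<bullet> w"
    by (auto simp: orthogonal_transformation_def)
  obtain a b where ab: "\<iota> 0 = (a, b)" by (cases "\<iota> 0")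
  obtain c d where cd: "T (1, 0) = (c, d)" by (cases "T (1, 0)")
  obtain c' d' where cd': "T (0, 1) = (c', d')" by (cases "T (0, 1)")
  have e: "c * c + d * d = 1" "c' * c' + d' * d' = 1" "c * c' + d * d' = 0"
    using inn[of "(1, 0)" "(1, 0)"] inn[of "(0, 1)" "(0, 1)"] inn[of "(1, 0)" "(0, 1)"]
    by (auto simp: cd cd')
  define s where "s = c * d' - d * c'"
  have s2: "s * s = 1"
  proof -
    \<comment> \<open>Lagrange's identity: squared determinant plus squared inner product is the
      product of the squared norms.\<close>
    have "s * s + (c * c' + d * d') * (c * c' + d * d') = (c * c + d * d) * (c' * c' + d' * d')"
      by (simp add: s_def algebra_simps)
    then show ?thesis using e by simp
  qed
  have c': "c' = - s * d"
  proof -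
    have "c' = (c * c + d * d) * c' - c * (c * c' + d * d')" using e by simp
    also have "\<dots> = - s * d" by (simp add: s_def algebra_simps)
    finally show ?thesis .
  qed
  have d': "d' = s * c"
  proof -
    have "d' = (c * c + d * d) * d' - d * (c * c' + d * d')" using e by simp
    also have "\<dots> = s * c" by (simp add: s_def algebra_simps)
    finally show ?thesis .
  qed
  have "\<iota> (x, y) = rigid (a, b, c, d, s) (x, y)" for x y
  proof -
    have "(x, y) = x *\<^sub>R (1, 0) + y *\<^sub>R (0, 1)" by simp
    then have "T (x, y) = x *\<^sub>R T (1, 0) + y *\<^sub>R T (0, 1)"
      by (simp only: linear_add[OF lin] linear_scale[OF lin])
    then have "T (x, y) = (c * x - s * d * y, d * x + s * c * y)"
      unfolding cd cd' by (simp add: c' d' algebra_simps)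
    moreover have "\<iota> (x, y) = T (x, y) + (a, b)" by (simp add: T_def ab)
    ultimately show ?thesis by (simp add: rigid_def)
  qed
  moreover have "(a, b, c, d, s) \<in> rigid_params"
    using e s2 by (auto simp: rigid_params_def power2_eq_square square_eq_1_iff)
  ultimately show ?thesis by (intro that[of "(a, b, c, d, s)"]) auto
qed

section \<open>Finite nets of isometries\<close>

definition close_params :: "real \<Rightarrow> real \<times> real \<times> real \<times> real \<times> real \<Rightarrow> real \<times> real \<times> real \<times> real \<times> real \<Rightarrow> bool" where
  "close_params \<delta> = (\<lambda>(a, b, c, d, s) (a', b', c', d', s').
     \<bar>a - a'\<bar> \<le> \<delta> \<and> \<bar>b - b'\<bar> \<le> \<delta> \<and> \<bar>c - c'\<bar> \<le> \<delta> \<and> \<bar>d - d'\<bar> \<le> \<delta> \<and> s = s')"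

definition unit_params :: "(real \<times> real \<times> real \<times> real \<times> real) set" where
  "unit_params = {P \<in> rigid_params. fst P \<in> {0..1} \<and> fst (snd P) \<in> {0..1}}"

lemma abs_le_1_of_sum_squares: "c\<^sup>2 + d\<^sup>2 = (1 :: real) \<Longrightarrow> \<bar>c\<bar> \<le> 1 \<and> \<bar>d\<bar> \<le> 1"
  using abs_le_square_iff[of c 1] abs_le_square_iff[of d 1] zero_le_power2[of c] zero_le_power2[of d]
  by auto

text \<open>The four real parameters are rounded to multiples of \<delta>. A grid point would in
  general violate c^2 + d^2 = 1, so each occupied class is represented by one of its own members.
  The count is two signs times (2n + 1)^4 with n \<le> 1/\<delta> + 1.\<close>

lemma rigid_net:
  assumes \<delta>: "0 < \<delta>"
  obtains K where "finite K" "K \<subseteq> unit_params" "real (card K) \<le> 2 * (2 / \<delta> + 3) ^ 4"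
    "\<And>P. P \<in> unit_params \<Longrightarrow> \<exists>P'\<in>K. close_params \<delta> P P'"
proof -
  define n where "n = \<lceil>1 / \<delta>\<rceil>"
  define \<phi> where "\<phi> = (\<lambda>(a, b, c, d, s :: real). (\<lfloor>a / \<delta>\<rfloor>, \<lfloor>b / \<delta>\<rfloor>, \<lfloor>c / \<delta>\<rfloor>, \<lfloor>d / \<delta>\<rfloor>, s))"
  define C where "C = {-n..n} \<times> {-n..n} \<times> {-n..n} \<times> {-n..n} \<times> {1, -1 :: real}"
  have n0: "0 < n" using \<delta> by (simp add: n_def)
  have fl: "\<lfloor>x / \<delta>\<rfloor> \<in> {-n..n}" if "\<bar>x\<bar> \<le> 1" for x
  proof -
    have n: "1 / \<delta> \<le> of_int n" by (simp add: n_def)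
    have "x / \<delta> \<le> 1 / \<delta>" "- 1 / \<delta> \<le> x / \<delta>" using that \<delta> divide_right_mono[of x 1 \<delta>] divide_right_mono[of "-1" x \<delta>] by (auto simp: abs_le_iff)
    then have "x / \<delta> \<le> of_int n" "of_int (-n) \<le> x / \<delta>" using n by auto
    then show ?thesis unfolding atLeastAtMost_iff le_floor_iff
      using floor_mono[of "x / \<delta>" "of_int n"] by simp
  qed
  have sub: "\<phi> ` unit_params \<subseteq> C"
    using fl abs_le_1_of_sum_squares
    by (auto simp: \<phi>_def C_def unit_params_def rigid_params_def)
  have fin: "finite (\<phi> ` unit_params)"
    by (rule finite_subset[OF sub]) (simp add: C_def)
  have cardC: "real (card C) = 2 * (2 * of_int n + 1) ^ 4"
    using n0 by (simp add: C_def card_cartesian_product power4_eq_xxxx algebra_simps)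
  define h where "h y = (SOME P. P \<in> unit_params \<and> \<phi> P = y)" for y
  have h: "h y \<in> unit_params \<and> \<phi> (h y) = y" if "y \<in> \<phi> ` unit_params" for y
  proof -
    from that obtain P where "y = \<phi> P" "P \<in> unit_params" by (rule imageE)
    then have "P \<in> unit_params \<and> \<phi> P = y" by simp
    then show ?thesis unfolding h_def by (rule someI)
  qed
  show ?thesis
  proof (rule that[of "h ` \<phi> ` unit_params"])
    show "finite (h ` \<phi> ` unit_params)" using fin by simp
    show "h ` \<phi> ` unit_params \<subseteq> unit_params" using h by blast
    have "card (h ` \<phi> ` unit_params) \<le> card C"
      using card_image_le[OF fin, of h] card_mono[OF _ sub] by (force simp: C_def)
    also have "real (card C) \<le> 2 * (2 / \<delta> + 3) ^ 4"
    proof -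
      have "of_int n \<le> 1 / \<delta> + 1" by (simp add: n_def)
      then show ?thesis unfolding cardC using n0 by (intro mult_left_mono power_mono) auto
    qed
    finally show "real (card (h ` \<phi> ` unit_params)) \<le> 2 * (2 / \<delta> + 3) ^ 4" by simp
    fix P assume P: "P \<in> unit_params"
    have near: "\<bar>x - y\<bar> \<le> \<delta>" if "\<lfloor>x / \<delta>\<rfloor> = \<lfloor>y / \<delta>\<rfloor>" for x y
    proof -
      have "\<bar>x / \<delta> - y / \<delta>\<bar> \<le> 1" using that by linarith
      then show ?thesis using \<delta> by (simp add: diff_divide_distrib[symmetric] field_simps)
    qed
    have "\<phi> (h (\<phi> P)) = \<phi> P" using h P by blast
    then have "close_params \<delta> P (h (\<phi> P))"
      by (cases P, cases "h (\<phi> P)") (auto simp: \<phi>_def close_params_def intro: near)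
    then show "\<exists>P'\<in>h ` \<phi> ` unit_params. close_params \<delta> P P'" using P by blast
  qed
qed

text \<open>The images of the point under \<open>P\<close> and \<open>P'\<close> differ by (U, V),
  with each coordinate at most \<delta> + \<delta> + 2\<delta>. The inverse of \<open>P'\<close>
  mixes the two with coefficients of absolute value at most 1, which doubles the bound.\<close>

lemma rigid_close:
  assumes P: "close_params \<delta> P P'" "P' \<in> rigid_params" and z: "\<bar>x\<bar> \<le> 1" "\<bar>y\<bar> \<le> 2" and P0: "P \<in> rigid_params"
    and e: "rigid_inv P' (rigid P (x, y)) = (x', y')"
  shows "\<bar>x' - x\<bar> \<le> 8 * \<delta> \<and> \<bar>y' - y\<bar> \<le> 8 * \<delta>"
proof -
  obtain a b c d s where p: "P = (a, b, c, d, s)" by (cases P)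
  obtain a' b' c' d' where p': "P' = (a', b', c', d', s)"
    using P by (cases P') (auto simp: close_params_def p)
  have cl: "\<bar>a - a'\<bar> \<le> \<delta>" "\<bar>b - b'\<bar> \<le> \<delta>" "\<bar>c - c'\<bar> \<le> \<delta>" "\<bar>d - d'\<bar> \<le> \<delta>"
    using P by (auto simp: close_params_def p p')
  have cd: "\<bar>c'\<bar> \<le> 1" "\<bar>d'\<bar> \<le> 1" and s: "\<bar>s\<bar> = 1"
    using P abs_le_1_of_sum_squares[of c' d'] by (auto simp: p' rigid_params_def)
  define U where "U = (a - a') + (c - c') * x - s * (d - d') * y"
  define V where "V = (b - b') + (d - d') * x + s * (c - c') * y"
  have \<delta>: "0 \<le> \<delta>" using cl by linarith
  have prod: "\<bar>u * v\<bar> \<le> \<delta> * k" if "\<bar>u\<bar> \<le> \<delta>" "\<bar>v\<bar> \<le> k" for u v k :: real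
    unfolding abs_mult using that \<delta> by (intro mult_mono) auto
  have UV: "\<bar>U\<bar> \<le> 4 * \<delta>" "\<bar>V\<bar> \<le> 4 * \<delta>"
  proof -
    have "\<bar>s * (d - d') * y\<bar> \<le> \<delta> * 2" "\<bar>s * (c - c') * y\<bar> \<le> \<delta> * 2"
      using cl z s by (auto simp: abs_mult intro!: prod mult_mono)
    moreover have "\<bar>(c - c') * x\<bar> \<le> \<delta> * 1" "\<bar>(d - d') * x\<bar> \<le> \<delta> * 1"
      using cl z by (auto intro!: prod[where k=1, simplified])
    moreover have "\<bar>p + q - r\<bar> \<le> 4 * \<delta>" "\<bar>p + q + r\<bar> \<le> 4 * \<delta>"
      if "\<bar>p\<bar> \<le> \<delta>" "\<bar>q\<bar> \<le> \<delta> * 1" "\<bar>r\<bar> \<le> \<delta> * 2" for p q r :: real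
      using that by linarith+
    ultimately show "\<bar>U\<bar> \<le> 4 * \<delta>" "\<bar>V\<bar> \<le> 4 * \<delta>" unfolding U_def V_def using cl by blast+
  qed
  have id: "rigid_inv P' (rigid P' (x, y)) = (x, y)" by (rule rigid_inv_rigid[OF P(2)])
  have "x' - x = fst (rigid_inv P' (rigid P (x, y))) - fst (rigid_inv P' (rigid P' (x, y)))"
    by (simp only: e id fst_conv)
  also have "\<dots> = c' * U + d' * V"
    by (simp add: p p' rigid_def rigid_inv_def U_def V_def algebra_simps)
  finally have dx: "x' - x = c' * U + d' * V" .
  have "y' - y = snd (rigid_inv P' (rigid P (x, y))) - snd (rigid_inv P' (rigid P' (x, y)))"
    by (simp only: e id snd_conv)
  also have "\<dots> = s * (c' * V - d' * U)"
    by (simp add: p p' rigid_def rigid_inv_def U_def V_def algebra_simps)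
  finally have dy: "y' - y = s * (c' * V - d' * U)" .
  have W: "\<bar>c' * W\<bar> \<le> 4 * \<delta>" "\<bar>d' * W\<bar> \<le> 4 * \<delta>" if "\<bar>W\<bar> \<le> 4 * \<delta>" for W
    using cd that mult_mono[of "\<bar>c'\<bar>" 1 "\<bar>W\<bar>" "4 * \<delta>"] mult_mono[of "\<bar>d'\<bar>" 1 "\<bar>W\<bar>" "4 * \<delta>"]
    by (auto simp: abs_mult)
  have two: "\<bar>p + q\<bar> \<le> 8 * \<delta>" "\<bar>p - q\<bar> \<le> 8 * \<delta>"
    if "\<bar>p\<bar> \<le> 4 * \<delta>" "\<bar>q\<bar> \<le> 4 * \<delta>" for p q :: real
    using that by linarith+
  have "\<bar>x' - x\<bar> \<le> 8 * \<delta>"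
    unfolding dx by (rule two(1)[OF W(1)[OF UV(1)] W(2)[OF UV(2)]])
  moreover have "\<bar>y' - y\<bar> \<le> 8 * \<delta>"
    unfolding dy abs_mult s mult_1 by (rule two(2)[OF W(1)[OF UV(2)] W(2)[OF UV(1)]])
  ultimately show ?thesis ..
qed

section \<open>Refinement for all isometries at once\<close>

lemma nn_integral_tail_rigid:
  assumes [measurable]: "r \<in> borel_measurable borel" and P: "P \<in> rigid_params"
  shows "(\<integral>\<^sup>+z. r (rigid P z) * indicator {z. r (rigid P z) > ennreal t} z \<partial>lborel)
      = (\<integral>\<^sup>+z. r z * indicator {z. r z > ennreal t} z \<partial>lborel)"
  using area_preserving_nn_integral[OF area_preserving_rigid[OF P], of "\<lambda>z. r z * indicator {z. r z > ennreal t} z"]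
  by (simp add: indicator_def)

lemma tail_bound_rigid:
  assumes r: "tail_bound q r" and P: "P \<in> rigid_params"
  shows "tail_bound q (\<lambda>z. r (rigid P z))"
proof -
  have [measurable]: "r \<in> borel_measurable borel" using r by (simp add: tail_bound_def)
  show ?thesis using r P unfolding tail_bound_def by (simp add: nn_integral_tail_rigid)
qed

text \<open>The image under \<open>P\<close> of a point of the strip \<open>T\<close> is the image
  under \<open>P'\<close> of a point of a slightly larger strip \<open>T'\<close>. Two
  area-preserving substitutions thus replace \<open>P\<close> by \<open>P'\<close> at the cost of
  the mass over \<open>T' - T\<close>, whose area is of order \<delta>.\<close>

lemma strip_integral_close:
  assumes \<rho>: "tail_bound q \<rho>" and f: "1-lipschitz_on UNIV f" "\<And>x. 0 \<le> f x" "\<And>x. f x + w \<le> 1"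
    and w: "0 < w" and P: "P \<in> rigid_params" "P' \<in> rigid_params" "close_params \<delta> P P'"
    and \<delta>: "0 < \<delta>" "\<delta> \<le> 1 / 16" and t: "0 < t"
  shows "strip_integral {0..<1} f w (\<lambda>z. \<rho> (rigid P z)) \<le>
    strip_integral {0..<1} f w (\<lambda>z. \<rho> (rigid P' z)) + ennreal (t * (100 * \<delta>) + t powr (1 - q))"
proof -
  have [measurable]: "\<rho> \<in> borel_measurable borel" using \<rho> by (simp add: tail_bound_def)
  have [measurable]: "f \<in> borel_measurable borel"
    using f(1) lipschitz_on_continuous_on borel_measurable_continuous_onI by blast
  have w1: "w \<le> 1" using f(2,3)[of 0] by linarith
  define T where "T = strip {0..<1} f w"
  \<comment> \<open>Points move by at most 8\<delta> in each coordinate, and the 1-Lipschitz edge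
    \<open>f\<close> changes by at most another 8\<delta>; hence the margin 16\<delta> above and
    below.\<close>
  define T' where "T' = strip {- (8 * \<delta>)..1 + 8 * \<delta>} (\<lambda>x. f x - 16 * \<delta>) (w + 32 * \<delta>)"
  have [measurable]: "T \<in> sets borel" "T' \<in> sets borel" unfolding T_def T'_def by measurable
  have sub: "T \<subseteq> T'" using \<delta> by (auto simp: T_def T'_def strip_def)
  have eT: "emeasure lborel T = ennreal w"
    unfolding T_def using w by (subst emeasure_strip) auto
  have eT': "emeasure lborel T' = ennreal ((w + 32 * \<delta>) * (1 + 16 * \<delta>))"
    unfolding T'_def using w \<delta> by (subst emeasure_strip) (auto simp: ennreal_mult add.commute)
  have diff: "emeasure lborel (T' - T) \<le> ennreal (100 * \<delta>)"
  proof -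
    have "emeasure lborel (T' - T) = ennreal ((w + 32 * \<delta>) * (1 + 16 * \<delta>) - w)"
      using sub w \<delta> by (subst emeasure_Diff) (auto simp: eT eT' ennreal_minus)
    also have "\<dots> \<le> ennreal (100 * \<delta>)"
    proof (rule ennreal_leI)
      \<comment> \<open>The three terms of the sum below are at most 16\<delta>, 32\<delta> and
        32\<delta>.\<close>
      have "w * \<delta> \<le> 1 * \<delta>" "\<delta> * \<delta> \<le> 1/16 * \<delta>" using w1 \<delta> by (auto intro: mult_right_mono)
      then have "16 * (w * \<delta>) + 32 * \<delta> + 512 * (\<delta> * \<delta>) \<le> 100 * \<delta>" using \<delta> by linarith
      moreover have "(w + 32 * \<delta>) * (1 + 16 * \<delta>) - w = 16 * (w * \<delta>) + 32 * \<delta> + 512 * (\<delta> * \<delta>)"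
        by (simp add: algebra_simps)
      ultimately show "(w + 32 * \<delta>) * (1 + 16 * \<delta>) - w \<le> 100 * \<delta>" by simp
    qed
    finally show ?thesis .
  qed
  have lip: "\<bar>f x - f y\<bar> \<le> \<bar>x - y\<bar>" for x y
    using lipschitz_onD[OF f(1), of x y] by (simp add: dist_real_def)
  have moved: "rigid_inv P' u \<in> T'" if "rigid_inv P' (rigid P z) = rigid_inv P' u" "z \<in> T" for u z
  proof -
    obtain x y where z: "z = (x, y)" by (cases z)
    obtain x' y' where u: "rigid_inv P' u = (x', y')" by (cases "rigid_inv P' u")
    have xy: "0 \<le> x" "x < 1" "f x \<le> y" "y \<le> f x + w" using that(2) by (auto simp: T_def strip_def z)
    have y: "0 \<le> y" "y \<le> 2" using xy f(2)[of x] f(3)[of x] by linarith+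
    have c: "\<bar>x' - x\<bar> \<le> 8 * \<delta> \<and> \<bar>y' - y\<bar> \<le> 8 * \<delta>"
      by (rule rigid_close[OF P(3,2) _ _ P(1)]) (use xy y that(1) z u in auto)
    have "\<bar>f x' - f x\<bar> \<le> 8 * \<delta>" using lip[of x' x] c by linarith
    then show ?thesis unfolding u T'_def strip_def using xy c by auto
  qed
  have inv: "rigid_inv P (rigid P z) = z" "rigid_inv P' (rigid P' z) = z" for z
    using P rigid_inv_rigid by auto
  have "strip_integral {0..<1} f w (\<lambda>z. \<rho> (rigid P z)) = (\<integral>\<^sup>+z. \<rho> (rigid P z) * indicator T z \<partial>lborel)"
    unfolding T_def by (subst strip_integral_eq_plane) auto
  also have "\<dots> \<le> (\<integral>\<^sup>+z. \<rho> (rigid P z) * indicator T' (rigid_inv P' (rigid P z)) \<partial>lborel)"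
    using moved by (intro nn_integral_mono mult_left_mono) (auto simp: indicator_def)
  also have "\<dots> = (\<integral>\<^sup>+u. \<rho> u * indicator T' (rigid_inv P' u) \<partial>lborel)"
    by (rule area_preserving_nn_integral[OF area_preserving_rigid[OF P(1)], where h="\<lambda>u. \<rho> u * indicator T' (rigid_inv P' u)"]) measurable
  also have "\<dots> = (\<integral>\<^sup>+z. \<rho> (rigid P' z) * indicator T' (rigid_inv P' (rigid P' z)) \<partial>lborel)"
    by (rule area_preserving_nn_integral[OF area_preserving_rigid[OF P(2)], where h="\<lambda>u. \<rho> u * indicator T' (rigid_inv P' u)", symmetric]) measurable
  also have "\<dots> = (\<integral>\<^sup>+z. \<rho> (rigid P' z) * indicator T z + \<rho> (rigid P' z) * indicator (T' - T) z \<partial>lborel)"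
    unfolding inv using sub by (intro nn_integral_cong) (auto simp: indicator_def)
  also have "\<dots> = (\<integral>\<^sup>+z. \<rho> (rigid P' z) * indicator T z \<partial>lborel) + (\<integral>\<^sup>+z. \<rho> (rigid P' z) * indicator (T' - T) z \<partial>lborel)"
    by (rule nn_integral_add) measurable
  also have "\<dots> \<le> strip_integral {0..<1} f w (\<lambda>z. \<rho> (rigid P' z)) + ennreal (t * (100 * \<delta>) + t powr (1 - q))"
  proof (rule add_mono)
    show "(\<integral>\<^sup>+z. \<rho> (rigid P' z) * indicator T z \<partial>lborel) \<le> strip_integral {0..<1} f w (\<lambda>z. \<rho> (rigid P' z))"
      unfolding T_def by (subst strip_integral_eq_plane) auto
    show "(\<integral>\<^sup>+z. \<rho> (rigid P' z) * indicator (T' - T) z \<partial>lborel) \<le> ennreal (t * (100 * \<delta>) + t powr (1 - q))"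
      using \<delta> t diff tail_bound_rigid[OF \<rho> P(2)]
      by (intro nn_integral_indicator_le_tail) (auto simp: tail_bound_def)
  qed
  finally show ?thesis .
qed

text \<open>The last condition makes the union bound over the net \<open>rigid_net\<close> with \<open>\<delta> = w ^ 6\<close> succeed.\<close>

definition small_scale :: "real \<Rightarrow> real \<Rightarrow> bool" where
  "small_scale \<eta> w \<longleftrightarrow> 0 < w \<and> w \<le> 1/2 \<and> w powr \<eta> \<le> 1/128 \<and> 101 * w\<^sup>2 \<le> w powr \<eta> \<and>
     4 * (2 / w ^ 6 + 3) ^ 4 * exp (- (w powr (- 5 * \<eta>) / 2)) < 1"

lemma eventually_small_scale:
  assumes "0 < \<eta>" "\<eta> < 1"
  shows "eventually (small_scale \<eta>) (at_right 0)"
  unfolding small_scale_def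
proof (intro eventually_conj)
  have "((\<lambda>w. w powr \<eta>) \<longlongrightarrow> 0) (at_right 0)" using assms by real_asymp
  from order_tendstoD(2)[OF this, of "1/128"]
  show "\<forall>\<^sub>F w in at_right 0. w powr \<eta> \<le> 1/128" by (auto elim: eventually_mono)
  have "((\<lambda>w. 4 * (2 / w ^ 6 + 3) ^ 4 * exp (- (w powr (- 5 * \<eta>) / 2))) \<longlongrightarrow> 0) (at_right 0)"
    using assms by real_asymp
  from order_tendstoD(2)[OF this, of 1]
  show "\<forall>\<^sub>F w in at_right 0. 4 * (2 / w ^ 6 + 3) ^ 4 * exp (- (w powr (- 5 * \<eta>) / 2)) < 1" by simp
  have "((\<lambda>w. 101 * w\<^sup>2 / w powr \<eta>) \<longlongrightarrow> 0) (at_right 0)" using assms by real_asymp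
  from order_tendstoD(2)[OF this, of 1] have "\<forall>\<^sub>F w in at_right 0. 101 * w\<^sup>2 / w powr \<eta> < 1" by simp
  then show "\<forall>\<^sub>F w in at_right 0. 101 * w\<^sup>2 \<le> w powr \<eta>"
    using eventually_at_right_less[of "0 :: real"] by eventually_elim (simp add: field_simps)
  show "\<forall>\<^sub>F w in at_right 0. w \<le> (1/2 :: real)"
    using eventually_at_right_real[of 0 "1/2"] by (auto elim: eventually_mono)
qed (simp add: eventually_at_right_less)

text \<open>The choice of \<eta> means 3/q = 1 - 8\<eta>. With about w^(\<eta> - 1) cells the slope
  grows by at most 4 w^\<eta>, and one cell contributes at most 2 w^(7\<eta>) to the mean. Both
  losses \<open>\<epsilon>\<close> and \<open>a\<close> of \<open>random_refinement\<close> are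
  taken to be w^\<eta>.\<close>

lemma uniform_refinement:
  fixes q w m L :: real
  defines "\<eta> \<equiv> (1 - 3 / q) / 8"
  assumes q: "3 < q" and \<rho>: "tail_bound q \<rho>" and w: "small_scale \<eta> w"
    and f: "L-lipschitz_on UNIV f" "L + 4 * w powr \<eta> \<le> 1" "\<And>x. 0 \<le> f x" "\<And>x. f x + w \<le> 1"
    and m: "0 \<le> m" "m \<le> 1"
    and mass: "\<And>P. P \<in> unit_params \<Longrightarrow> strip_integral {0..<1} f w (\<lambda>z. \<rho> (rigid P z)) \<le> ennreal (w * m)"
  obtains h where "(L + 4 * w powr \<eta>)-lipschitz_on UNIV h" "\<And>x. f x \<le> h x" "\<And>x. h x + w\<^sup>2 \<le> f x + w"
    "\<And>P. P \<in> unit_params \<Longrightarrow>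
      strip_integral {0..<1} h (w\<^sup>2) (\<lambda>z. \<rho> (rigid P z)) \<le> ennreal (w\<^sup>2 * (m + 8 * w powr \<eta>))"
proof -
  define u where "u = w powr \<eta>"
  have w0: "0 < w" "w \<le> 1/2" and u: "0 < u" "u \<le> 1/128" "101 * w\<^sup>2 \<le> u"
    and few: "4 * (2 / w ^ 6 + 3) ^ 4 * exp (- (w powr (- 5 * \<eta>) / 2)) < 1"
    using w by (auto simp: small_scale_def u_def)
  have \<eta>: "0 < \<eta>" "\<eta> < 1/8" "3 / q = 1 - 8 * \<eta>" using q by (auto simp: \<eta>_def field_simps)
  have wpow: "w ^ n = w powr n" for n using w0 by (simp add: powr_realpow)
  have w2: "0 < w\<^sup>2" "w\<^sup>2 < w" using w0 by (auto simp: power2_eq_square)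
  have wu: "w \<le> u"
    using powr_mono'[of \<eta> 1 w] w0 \<eta> by (simp add: u_def)
  \<comment> \<open>Passing from the net to all isometries costs a multiple of
    \<open>\<delta> powr (1 - 1 / q)\<close>. As q > 3 gives 6 (1 - 1/q) > 4, this is a multiple of
    w^4 at most, which fits into \<open>w\<^sup>2 * u\<close>.\<close>
  define \<delta> where "\<delta> = w ^ 6"
  have \<delta>: "0 < \<delta>" "\<delta> \<le> 1/16"
  proof -
    have "w ^ 6 \<le> (1/2) ^ 6" using w0 by (intro power_mono) auto
    then show "\<delta> \<le> 1/16" by (simp add: \<delta>_def power_divide)
  qed (use w0 in \<open>simp add: \<delta>_def\<close>)
  obtain K where K: "finite K" "K \<subseteq> unit_params" "real (card K) \<le> 2 * (2 / \<delta> + 3) ^ 4"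
    "\<And>P. P \<in> unit_params \<Longrightarrow> \<exists>P'\<in>K. close_params \<delta> P P'"
    using rigid_net[OF \<delta>(1)] by blast
  \<comment> \<open>The added slope is about 2 N w, so this is the largest order of \<open>N\<close>
    that keeps it of order w^\<eta>.\<close>
  define N where "N = nat \<lceil>w powr (\<eta> - 1)\<rceil>"
  have N: "w powr (\<eta> - 1) \<le> real N" "real N \<le> w powr (\<eta> - 1) + 1" "0 < N"
  proof -
    have "0 < w powr (\<eta> - 1)" using w0 by simp
    then show "w powr (\<eta> - 1) \<le> real N" "real N \<le> w powr (\<eta> - 1) + 1" "0 < N"
      unfolding N_def by (auto simp: of_nat_nat)
  qed
  \<comment> \<open>A piece of length \<open>w\<close> and width w^2 has area w^3; at this level t
    w^3 and t^(1 - q) are both w^(3 - 3/q).\<close>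
  define t where "t = w powr (- 3 / q)"
  have t: "0 < t" using w0 by (simp add: t_def)
  have B: "t / N + t powr (1 - q) / w\<^sup>2 \<le> 2 * w powr (7 * \<eta>)"
  proof -
    have "t / N \<le> t / w powr (\<eta> - 1)" using N t w0 by (intro divide_left_mono) auto
    also have "\<dots> = w powr (7 * \<eta>)"
      using \<eta>(3) by (simp add: t_def powr_diff[symmetric])
    finally have 1: "t / N \<le> w powr (7 * \<eta>)" .
    have "- 3 / q * (1 - q) = 3 - 3 / q" using q by (simp add: field_simps)
    then have "t powr (1 - q) = w powr (3 - 3 / q)"
      by (simp only: t_def powr_powr)
    then have "t powr (1 - q) / w\<^sup>2 = w powr (8 * \<eta>)"
      using \<eta>(3) by (simp add: wpow powr_diff[symmetric])
    also have "\<dots> \<le> w powr (7 * \<eta>)" using w0 \<eta> by (intro powr_mono') auto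
    finally show ?thesis using 1 by simp
  qed
  \<comment> \<open>The rate is u * u / (2 w^(7\<eta>)) = w^(-5\<eta>) / 2, the exponent in
    \<open>small_scale\<close>; the leading 4 there is 2 parities times the 2 in the size of the
    net.\<close>
  have few': "2 * card K * exp (- (u / (2 * w powr (7 * \<eta>)) * u)) < 1"
  proof -
    have e1: "u / (2 * w powr (7 * \<eta>)) * u = w powr (- 5 * \<eta>) / 2"
    proof -
      have "w powr (- 5 * \<eta>) * w powr (7 * \<eta>) = u * u"
        by (simp add: u_def powr_add[symmetric])
      then show ?thesis using w0 by (simp add: field_simps)
    qed
    have "2 * real (card K) * exp (- (w powr (- 5 * \<eta>) / 2)) \<le> 2 * (2 * (2 / \<delta> + 3) ^ 4) * exp (- (w powr (- 5 * \<eta>) / 2))"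
      using K(3) by (intro mult_right_mono mult_left_mono) auto
    also have "\<dots> < 1" using few by (simp add: \<delta>_def)
    finally show ?thesis by (simp only: e1 of_nat_mult of_nat_numeral)
  qed
  have fm[measurable]: "f \<in> borel_measurable borel"
    using f(1) lipschitz_on_continuous_on borel_measurable_continuous_onI by blast
  have Ksub: "P \<in> rigid_params" if "P \<in> K" for P using that K(2) by (auto simp: unit_params_def)
  obtain g where g: "(2 * N * (w - w\<^sup>2))-lipschitz_on UNIV g" "\<And>x. 0 \<le> g x" "\<And>x. g x \<le> w - w\<^sup>2"
    "\<And>P. P \<in> K \<Longrightarrow> strip_integral {0..<1} (\<lambda>x. f x + g x) (w\<^sup>2) (\<lambda>z. \<rho> (rigid P z))
        \<le> ennreal (w\<^sup>2 * ((1 + u) * (w / (w - w\<^sup>2) * m) + 2 * u))"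
  proof (rule random_refinement[of K q "\<lambda>P z. \<rho> (rigid P z)" f "w\<^sup>2" w N t "2 * w powr (7 * \<eta>)" u u m])
    show "tail_bound q (\<lambda>z. \<rho> (rigid P z))" if "P \<in> K" for P
      using tail_bound_rigid[OF \<rho> Ksub[OF that]] .
  qed (use K mass w2 N t B u few' m in auto)
  define h where "h x = f x + g x" for x
  \<comment> \<open>The factors 1 + u and w / (w - w^2) \<le> 1 + 2u raise a mean of at most 1 by at
    most 3u + 2u^2 \<le> 5u; the additive losses of the two parities give 2u.\<close>
  have step: "(1 + u) * (w / (w - w\<^sup>2) * m) + 2 * u \<le> m + 7 * u"
  proof -
    have "w / (w - w\<^sup>2) = 1 / (1 - w)" using w0 by (simp add: power2_eq_square field_simps)
    also have "\<dots> \<le> 1 + 2 * w" using w0 by (simp add: field_simps)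
    also have "\<dots> \<le> 1 + 2 * u" using wu by simp
    finally have "w / (w - w\<^sup>2) * m \<le> (1 + 2 * u) * m" using m by (intro mult_right_mono) auto
    then have "(1 + u) * (w / (w - w\<^sup>2) * m) \<le> (1 + u) * ((1 + 2 * u) * m)" using u by (intro mult_left_mono) auto
    also have "\<dots> = m + (3 * u + 2 * u * u) * m" by (simp add: algebra_simps)
    also have "\<dots> \<le> m + (3 * u + 2 * u * u)" using m u by (intro add_left_mono) (simp add: mult_left_le)
    also have "\<dots> \<le> m + 5 * u" using u by (simp add: mult_le_one)
    finally show ?thesis by simp
  qed
  have hlip: "(L + 4 * w powr \<eta>)-lipschitz_on UNIV h"
  proof (rule lipschitz_on_le)
    show "(L + 2 * N * (w - w\<^sup>2))-lipschitz_on UNIV h"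
      unfolding h_def by (rule lipschitz_on_add[OF f(1) g(1)])
    have "real N * (w - w\<^sup>2) \<le> (w powr (\<eta> - 1) + 1) * w" using N w0 w2 by (intro mult_mono) auto
    also have "\<dots> = u + w" using w0 by (simp add: u_def distrib_right powr_diff)
    finally show "L + 2 * N * (w - w\<^sup>2) \<le> L + 4 * w powr \<eta>" using wu by (simp add: u_def)
  qed
  show ?thesis
  proof (rule that[OF hlip])
    show "f x \<le> h x" for x using g(2) by (simp add: h_def)
    show hw: "h x + w\<^sup>2 \<le> f x + w" for x using g(3)[of x] by (simp add: h_def)
    fix P assume P: "P \<in> unit_params"
    then obtain P' where P': "P' \<in> K" "close_params \<delta> P P'" using K(4) by blast
    \<comment> \<open>This level balances \<open>s * \<delta>\<close> against
      \<open>s powr (1 - q)\<close>: both equal \<open>\<delta> powr (1 - 1 / q)\<close>.\<close>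
    define s where "s = \<delta> powr (- 1 / q)"
    have h1: "1-lipschitz_on UNIV h" by (rule lipschitz_on_le[OF hlip f(2)])
    have "strip_integral {0..<1} h (w\<^sup>2) (\<lambda>z. \<rho> (rigid P z)) \<le>
      strip_integral {0..<1} h (w\<^sup>2) (\<lambda>z. \<rho> (rigid P' z)) + ennreal (s * (100 * \<delta>) + s powr (1 - q))"
    proof (rule strip_integral_close[OF \<rho> h1])
      show "0 \<le> h x" for x using f(3)[of x] g(2)[of x] by (simp add: h_def)
      show "h x + w\<^sup>2 \<le> 1" for x using hw[of x] f(4)[of x] by linarith
    qed (use w2 P P' Ksub \<delta> in \<open>auto simp: unit_params_def s_def\<close>)
    also have "strip_integral {0..<1} h (w\<^sup>2) (\<lambda>z. \<rho> (rigid P' z)) \<le> ennreal (w\<^sup>2 * (m + 7 * u))"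
      using g(4)[OF P'(1)] step w2 unfolding h_def
      by (elim order_trans) (intro ennreal_leI mult_left_mono; simp)
    also have "ennreal (w\<^sup>2 * (m + 7 * u)) + ennreal (s * (100 * \<delta>) + s powr (1 - q))
        = ennreal (w\<^sup>2 * (m + 7 * u) + (s * (100 * \<delta>) + s powr (1 - q)))"
      using m u \<delta> by (subst ennreal_plus) (auto simp: s_def)
    also have "\<dots> \<le> ennreal (w\<^sup>2 * (m + 8 * w powr \<eta>))"
    proof (rule ennreal_leI)
      have a1: "s * \<delta> = \<delta> powr (1 - 1 / q)" using \<delta> by (simp add: s_def powr_diff powr_minus field_simps)
      have a2: "s powr (1 - q) = \<delta> powr (1 - 1 / q)"
      proof -
        have "- 1 / q * (1 - q) = 1 - 1 / q" using q by (simp add: field_simps)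
        then show ?thesis by (simp only: s_def powr_powr)
      qed
      have a3: "\<delta> powr (1 - 1 / q) \<le> w\<^sup>2 * w\<^sup>2"
      proof -
        have "\<delta> powr (1 - 1 / q) = w powr (6 * (1 - 1 / q))" by (simp add: \<delta>_def wpow powr_powr)
        also have "\<dots> \<le> w powr 4" using q w0 by (intro powr_mono') (auto simp: field_simps)
        also have "\<dots> = w\<^sup>2 * w\<^sup>2" using wpow[of 4] by (simp add: power4_eq_xxxx power2_eq_square)
        finally show ?thesis .
      qed
      have "s * (100 * \<delta>) + s powr (1 - q) = 100 * (s * \<delta>) + s powr (1 - q)" by simp
      also have "\<dots> = 101 * \<delta> powr (1 - 1 / q)" unfolding a1 a2 by simp
      also have "\<dots> \<le> 101 * (w\<^sup>2 * w\<^sup>2)" using a3 by (intro mult_left_mono) auto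
      also have "\<dots> = w\<^sup>2 * (101 * w\<^sup>2)" by simp
      also have "\<dots> \<le> w\<^sup>2 * u" using u by (intro mult_left_mono) auto
      finally show "w\<^sup>2 * (m + 7 * u) + (s * (100 * \<delta>) + s powr (1 - q)) \<le> w\<^sup>2 * (m + 8 * w powr \<eta>)"
        by (simp add: u_def algebra_simps)
    qed
    finally show "strip_integral {0..<1} h (w\<^sup>2) (\<lambda>z. \<rho> (rigid P z)) \<le> ennreal (w\<^sup>2 * (m + 8 * w powr \<eta>))"
      by (simp add: add_right_mono)
  qed
qed

text \<open>Squaring the width squares its power u = w^\<eta> as well, so u at least halves in each
  step. The losses 8u in the mean and 4u in the slope therefore sum to fixed multiples of the first
  u, which is at most 1/128; this keeps the mean within 1/4 and the slope within 1.\<close>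

lemma refinement_sequence:
  fixes q w :: real
  defines "\<eta> \<equiv> (1 - 3 / q) / 8"
  assumes q: "3 < q" and \<rho>: "tail_bound q \<rho>" and w: "0 < w" "\<And>v. 0 < v \<Longrightarrow> v \<le> w \<Longrightarrow> small_scale \<eta> v"
    and mass: "\<And>P. P \<in> unit_params \<Longrightarrow> strip_integral {0..<1} (\<lambda>_. 0) w (\<lambda>z. \<rho> (rigid P z)) \<le> ennreal (w * (1/8))"
  obtains f where "\<And>k. 1-lipschitz_on UNIV (f k)" "\<And>k x. 0 \<le> f k x" "\<And>k x. f k x \<le> f (Suc k) x"
    "\<And>k x. f (Suc k) x + w ^ 2 ^ Suc k \<le> f k x + w ^ 2 ^ k" "\<And>k x. f k x + w ^ 2 ^ k \<le> 1"
    "\<And>k P. P \<in> unit_params \<Longrightarrow>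
      strip_integral {0..<1} (f k) (w ^ 2 ^ k) (\<lambda>z. \<rho> (rigid P z)) \<le> ennreal (w ^ 2 ^ k * (1/4))"
proof -
  define W where "W k = w ^ 2 ^ k" for k :: nat
  define u where "u k = W k powr \<eta>" for k
  have w12: "w \<le> 1/2" using w(2)[of w] w(1) by (simp add: small_scale_def)
  have W: "0 < W k" "W k \<le> w" for k
  proof -
    show "0 < W k" using w by (simp add: W_def)
    show "W k \<le> w" using power_decreasing[of 1 "2 ^ k" w] w w12 by (simp add: W_def)
  qed
  have W_Suc: "W (Suc k) = (W k)\<^sup>2" for k by (simp add: W_def power_mult[symmetric] mult.commute)
  have u: "0 < u k" "u k \<le> 1/128" for k
  proof -
    have "small_scale \<eta> (W k)" by (rule w(2)[OF W])
    then show "u k \<le> 1/128" by (simp add: small_scale_def u_def)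
    show "0 < u k" using W(1)[of k] by (simp add: u_def)
  qed
  have u_Suc: "u (Suc k) = u k * u k" for k
    using W(1)[of k] by (simp add: u_def W_Suc power2_eq_square powr_mult)
  have u_half: "u (Suc k) \<le> u k / 2" for k
    using mult_left_mono[of "u k" "1/2" "u k"] u[of k] by (simp add: u_Suc)
  \<comment> \<open>The budgets telescope: since \<open>u (Suc k) \<le> u k / 2\<close>, the
    increment \<open>16 * (u k - u (Suc k))\<close> covers the loss \<open>8 * u k\<close>, and
    likewise for the slope with 8 and 4.\<close>
  define m where "m k = 1/8 + 16 * (u 0 - u k)" for k
  define L where "L k = 8 * (u 0 - u k)" for k
  have u_le: "u k \<le> u 0" for k
  proof (induction k)
    case (Suc k) then show ?case using u_half[of k] u(1)[of k] by linarith
  qed simp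
  have m: "0 \<le> m k" "m k \<le> 1/4" "m k + 8 * u k \<le> m (Suc k)" for k
    using u[of k] u[of 0] u_le[of k] u_half[of k] by (auto simp: m_def)
  have L: "L k + 4 * u k \<le> 1" "L k + 4 * u k \<le> L (Suc k)" "L k \<le> 1" for k
    using u[of k] u[of 0] u_half[of k] by (auto simp: L_def)
  define Q where "Q k f \<longleftrightarrow> (L k)-lipschitz_on UNIV f \<and> (\<forall>x. 0 \<le> f x \<and> f x + W k \<le> 1) \<and>
    (\<forall>P\<in>unit_params. strip_integral {0..<1} f (W k) (\<lambda>z. \<rho> (rigid P z)) \<le> ennreal (W k * m k))" for k f
  have "\<exists>f. \<forall>k. Q k (f k) \<and> (\<forall>x. f k x \<le> f (Suc k) x \<and> f (Suc k) x + W (Suc k) \<le> f k x + W k)"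
  proof (rule dependent_nat_choice)
    show "\<exists>f. Q 0 f"
      using mass w12 by (intro exI[of _ "\<lambda>_. 0"]) (auto simp: Q_def L_def m_def W_def lipschitz_on_def)
    fix f k assume f: "Q k f"
    obtain h where "(L k + 4 * W k powr \<eta>)-lipschitz_on UNIV h" "\<And>x. f x \<le> h x" "\<And>x. h x + (W k)\<^sup>2 \<le> f x + W k"
      "\<And>P. P \<in> unit_params \<Longrightarrow>
        strip_integral {0..<1} h ((W k)\<^sup>2) (\<lambda>z. \<rho> (rigid P z)) \<le> ennreal ((W k)\<^sup>2 * (m k + 8 * W k powr \<eta>))"
      unfolding \<eta>_def
      by (rule uniform_refinement[OF q \<rho>, of "W k" "L k" f "m k"])
         (use f m[of k] L[of k] w(2)[OF W] in \<open>auto simp: Q_def \<eta>_def u_def\<close>)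
    note h = this[folded u_def W_Suc]
    have "Q (Suc k) h"
      unfolding Q_def
    proof (intro conjI allI ballI)
      show "(L (Suc k))-lipschitz_on UNIV h" by (rule lipschitz_on_le[OF h(1) L(2)])
      fix x
      show "0 \<le> h x" using f h(2)[of x] unfolding Q_def by (meson order_trans)
      show "h x + W (Suc k) \<le> 1" using f h(3)[of x] unfolding Q_def by (meson order_trans)
    next
      fix P assume "P \<in> unit_params"
      from h(4)[OF this] show "strip_integral {0..<1} h (W (Suc k)) (\<lambda>z. \<rho> (rigid P z)) \<le> ennreal (W (Suc k) * m (Suc k))"
        using m(3)[of k] W(1)[of "Suc k"] by (elim order_trans) (intro ennreal_leI mult_left_mono; simp)
    qed
    then show "\<exists>h. Q (Suc k) h \<and> (\<forall>x. f x \<le> h x \<and> h x + W (Suc k) \<le> f x + W k)" using h by blast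
  qed
  then obtain f where f: "\<And>k. Q k (f k)" "\<And>k x. f k x \<le> f (Suc k) x" "\<And>k x. f (Suc k) x + W (Suc k) \<le> f k x + W k"
    by blast
  show ?thesis
  proof (rule that[of f])
    show "1-lipschitz_on UNIV (f k)" for k
      using f(1)[of k] L(3)[of k] by (auto simp: Q_def intro: lipschitz_on_le)
    show "0 \<le> f k x" for k x using f(1)[of k] by (simp add: Q_def)
    show "f k x \<le> f (Suc k) x" for k x by (rule f(2))
    show "f (Suc k) x + w ^ 2 ^ Suc k \<le> f k x + w ^ 2 ^ k" for k x using f(3) by (simp add: W_def)
    show "f k x + w ^ 2 ^ k \<le> 1" for k x using f(1)[of k] by (simp add: Q_def W_def)
    fix k P assume "P \<in> unit_params"
    with f(1)[of k] have "strip_integral {0..<1} (f k) (W k) (\<lambda>z. \<rho> (rigid P z)) \<le> ennreal (W k * m k)"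
      by (simp add: Q_def)
    also have "\<dots> \<le> ennreal (W k * (1/4))" using m(2)[of k] W(1)[of k] by (intro ennreal_leI mult_left_mono) auto
    finally show "strip_integral {0..<1} (f k) (w ^ 2 ^ k) (\<lambda>z. \<rho> (rigid P z)) \<le> ennreal (w ^ 2 ^ k * (1/4))"
      by (simp add: W_def)
  qed
qed

text \<open>Near (x, y0) the function exceeds any level below its value there. The fibre segments
  over \<open>x\<close> contain \<open>y0\<close> and shrink to it, so their averages eventually
  reach that level. This turns bounds on strips into a bound on the limit graph.\<close>

lemma lower_semicontinuous_le_liminf_average:
  fixes r :: "R2 \<Rightarrow> ennreal" and y W :: "nat \<Rightarrow> real"
  assumes r[measurable]: "r \<in> borel_measurable borel" and lsc: "\<And>\<alpha>. open {z. \<alpha> < r z}"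
    and W: "\<And>k. 0 < W k" "W \<longlonglongrightarrow> 0" and y: "\<And>k. y k \<le> y0" "\<And>k. y0 \<le> y k + W k"
  shows "r (x, y0) \<le> liminf (\<lambda>k. ennreal (1 / W k) * (\<integral>\<^sup>+s. r (x, y k + s) * indicator {0..W k} s \<partial>lborel))"
  unfolding le_Liminf_iff
proof (intro allI impI)
  fix \<beta> assume "\<beta> < r (x, y0)"
  \<comment> \<open>An average of values above \<alpha> is estimated from below by \<alpha> itself;
    the gap between \<beta> and \<alpha> makes the required inequality strict.\<close>
  then obtain \<alpha> where \<alpha>: "\<beta> < \<alpha>" "\<alpha> < r (x, y0)" using dense by blast
  then obtain e where e: "e > 0" "ball (x, y0) e \<subseteq> {z. \<alpha> < r z}"
    using lsc[of \<alpha>] unfolding open_contains_ball by blast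
  have "\<forall>\<^sub>F k in sequentially. W k < e" using order_tendstoD(2)[OF W(2) e(1)] .
  then show "\<forall>\<^sub>F k in sequentially. \<beta> < ennreal (1 / W k) * (\<integral>\<^sup>+s. r (x, y k + s) * indicator {0..W k} s \<partial>lborel)"
  proof eventually_elim
    case (elim k)
    have "\<alpha> = ennreal (1 / W k) * (\<alpha> * ennreal (W k))"
    proof -
      have "ennreal (1 / W k) * ennreal (W k) = 1" using W(1)[of k] by (subst ennreal_mult[symmetric]) auto
      then show ?thesis by (metis mult.commute mult.left_commute mult_1)
    qed
    also have "\<alpha> * ennreal (W k) = (\<integral>\<^sup>+s. \<alpha> * indicator {0..W k} s \<partial>lborel)"
      using W(1)[of k] by (subst nn_integral_cmult_indicator) auto
    also have "\<dots> \<le> (\<integral>\<^sup>+s. r (x, y k + s) * indicator {0..W k} s \<partial>lborel)"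
    proof (rule nn_integral_mono)
      fix s :: real
      have "\<alpha> \<le> r (x, y k + s)" if s: "s \<in> {0..W k}"
      proof -
        have "\<bar>y0 - (y k + s)\<bar> < e" using s y(1)[of k] y(2)[of k] elim by auto
        then have "(x, y k + s) \<in> ball (x, y0) e" by (simp add: dist_Pair_Pair dist_real_def)
        then show ?thesis using e(2) by auto
      qed
      then show "\<alpha> * indicator {0..W k} s \<le> r (x, y k + s) * indicator {0..W k} s" by (auto simp: indicator_def)
    qed
    finally have "\<alpha> \<le> ennreal (1 / W k) * (\<integral>\<^sup>+s. r (x, y k + s) * indicator {0..W k} s \<partial>lborel)"
      by (simp add: mult_left_mono)
    with \<alpha>(1) show ?case by (rule less_le_trans)
  qed
qed

lemma good_graph_exists:
  fixes q w :: real
  defines "\<eta> \<equiv> (1 - 3 / q) / 8"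
  assumes q: "3 < q" and \<rho>: "tail_bound q \<rho>" and lsc: "\<And>\<alpha>. open {z. \<alpha> < \<rho> z}"
    and w: "0 < w" "\<And>v. 0 < v \<Longrightarrow> v \<le> w \<Longrightarrow> small_scale \<eta> v"
    and mass: "\<And>P. P \<in> unit_params \<Longrightarrow> strip_integral {0..<1} (\<lambda>_. 0) w (\<lambda>z. \<rho> (rigid P z)) \<le> ennreal (w * (1/8))"
  obtains f where "1-lipschitz_on UNIV f" "\<And>x. f x \<in> {0..1}"
    "\<And>P. P \<in> unit_params \<Longrightarrow> (\<integral>\<^sup>+x. \<rho> (rigid P (x, f x)) * indicator {0..<1} x \<partial>lborel) \<le> ennreal (1/4)"
proof -
  obtain f where f: "\<And>k. 1-lipschitz_on UNIV (f k)" "\<And>k x. 0 \<le> f k x" "\<And>k x. f k x \<le> f (Suc k) x"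
    "\<And>k x. f (Suc k) x + w ^ 2 ^ Suc k \<le> f k x + w ^ 2 ^ k" "\<And>k x. f k x + w ^ 2 ^ k \<le> 1"
    "\<And>k P. P \<in> unit_params \<Longrightarrow>
      strip_integral {0..<1} (f k) (w ^ 2 ^ k) (\<lambda>z. \<rho> (rigid P z)) \<le> ennreal (w ^ 2 ^ k * (1/4))"
    using refinement_sequence[OF q \<rho> w[unfolded \<eta>_def] mass] by blast
  define W where "W k = w ^ 2 ^ k" for k :: nat
  have w12: "w \<le> 1/2" using w(2)[of w] w(1) by (simp add: small_scale_def)
  have Wpos: "0 < W k" for k using w by (simp add: W_def)
  have W0: "W \<longlonglongrightarrow> 0"
  proof (rule tendsto_sandwich[of "\<lambda>_. 0" _ _ "\<lambda>k. w ^ k"])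
    show "(\<lambda>k. w ^ k) \<longlonglongrightarrow> 0" using w w12 by (intro LIMSEQ_power_zero) auto
    have "W k \<le> w ^ k" for k
      unfolding W_def using w w12 by (intro power_decreasing) (auto simp: less_imp_le)
    then show "\<forall>\<^sub>F k in sequentially. W k \<le> w ^ k" by simp
    show "\<forall>\<^sub>F k in sequentially. 0 \<le> W k" using Wpos by (simp add: less_imp_le)
  qed auto
  define F where "F x = (SUP k. f k x)" for x
  have inc: "incseq (\<lambda>k. f k x)" for x using f(3) by (rule incseq_SucI)
  have dec: "decseq (\<lambda>k. f k x + W k)" for x
    using f(4) by (intro decseq_SucI) (simp add: W_def)
  \<comment> \<open>Nestedness: every lower edge lies below every upper edge, so the supremum exists
    and is caught in all strips.\<close>
  have f_le: "f j x \<le> f k x + W k" for j k x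
  proof (cases "j \<le> k")
    case True then show ?thesis using incseqD[OF inc True, of x] Wpos[of k] by linarith
  next
    case False then show ?thesis using decseqD[OF dec, of k j x] Wpos[of j] by linarith
  qed
  have F: "f k x \<le> F x" "F x \<le> f k x + W k" for k x
    unfolding F_def using f_le by (auto intro!: cSUP_upper cSUP_least bdd_aboveI2[where M="f k x + W k"])
  have lim: "(\<lambda>k. f k x) \<longlonglongrightarrow> F x" for x
  proof (rule tendsto_sandwich[of "\<lambda>k. F x - W k" _ _ "\<lambda>_. F x"])
    show "(\<lambda>k. F x - W k) \<longlonglongrightarrow> F x" using tendsto_diff[OF tendsto_const W0, of "F x"] by simp
    show "\<forall>\<^sub>F k in sequentially. F x - W k \<le> f k x" using F(2)[of x] by (auto simp: algebra_simps)
    show "\<forall>\<^sub>F k in sequentially. f k x \<le> F x" using F(1) by auto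
  qed auto
  have Flip: "1-lipschitz_on UNIV F"
  proof (rule lipschitz_onI)
    fix x y
    have "(\<lambda>k. dist (f k x) (f k y)) \<longlonglongrightarrow> dist (F x) (F y)" by (intro tendsto_dist lim)
    then show "dist (F x) (F y) \<le> 1 * dist x y"
      using lipschitz_onD[OF f(1)] by (intro LIMSEQ_le_const2) auto
  qed simp
  have fm[measurable]: "f k \<in> borel_measurable borel" for k
    using f(1) lipschitz_on_continuous_on borel_measurable_continuous_onI by blast
  have \<rho>m[measurable]: "\<rho> \<in> borel_measurable borel" using \<rho> by (simp add: tail_bound_def)
  show ?thesis
  proof (rule that[OF Flip])
    fix x
    have "0 \<le> F x" using F(1)[of 0 x] f(2)[of 0 x] by linarith
    moreover have "F x \<le> 1" using F(2)[of x 0] f(5)[of 0 x] by (simp add: W_def)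
    ultimately show "F x \<in> {0..1}" by simp
  next
    fix P assume P: "P \<in> unit_params"
    define r where "r z = \<rho> (rigid P z)" for z
    have [measurable]: "r \<in> borel_measurable borel" unfolding r_def by measurable
    have rlsc: "open {z. \<alpha> < r z}" for \<alpha>
    proof -
      have "continuous_on UNIV (rigid P)"
        by (cases P) (simp add: rigid_def case_prod_beta', intro continuous_intros)
      from open_vimage[OF lsc this, of \<alpha>] show ?thesis by (simp add: r_def vimage_def)
    qed
    define A where "A k x = ennreal (1 / W k) * (\<integral>\<^sup>+s. r (x, f k x + s) * indicator {0..W k} s \<partial>lborel)" for k x
    have Am[measurable]: "A k \<in> borel_measurable borel" for k unfolding A_def by measurable
    have "(\<integral>\<^sup>+x. r (x, F x) * indicator {0..<1} x \<partial>lborel)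
        \<le> (\<integral>\<^sup>+x. liminf (\<lambda>k. A k x * indicator {0..<1} x) \<partial>lborel)"
    proof (rule nn_integral_mono)
      fix x :: real
      have "r (x, F x) \<le> liminf (\<lambda>k. A k x)"
        unfolding A_def by (rule lower_semicontinuous_le_liminf_average) (use rlsc Wpos W0 F in auto)
      then show "r (x, F x) * indicator {0..<1} x \<le> liminf (\<lambda>k. A k x * indicator {0..<1} x)"
        by (auto simp: indicator_def)
    qed
    also have "\<dots> \<le> liminf (\<lambda>k. \<integral>\<^sup>+x. A k x * indicator {0..<1} x \<partial>lborel)"
      by (rule nn_integral_liminf) measurable
    also have "\<dots> \<le> liminf (\<lambda>k :: nat. ennreal (1/4))"
    proof (rule Liminf_mono, rule always_eventually, rule allI)
      fix k
      have "(\<integral>\<^sup>+x. A k x * indicator {0..<1} x \<partial>lborel) = ennreal (1 / W k) * strip_integral {0..<1} (f k) (W k) r"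
        unfolding A_def strip_integral_def mult.assoc by (rule nn_integral_cmult) measurable
      also have "\<dots> \<le> ennreal (1 / W k) * ennreal (W k * (1/4))"
        using f(6)[OF P, of k] unfolding W_def r_def by (intro mult_left_mono) auto
      also have "\<dots> = ennreal (1/4)" using Wpos[of k] by (subst ennreal_mult[symmetric]) auto
      finally show "(\<integral>\<^sup>+x. A k x * indicator {0..<1} x \<partial>lborel) \<le> ennreal (1/4)" .
    qed
    also have "\<dots> = ennreal (1/4)" by (simp add: Liminf_const)
    finally show "(\<integral>\<^sup>+x. \<rho> (rigid P (x, F x)) * indicator {0..<1} x \<partial>lborel) \<le> ennreal (1/4)"
      by (simp add: r_def)
  qed
qed

section \<open>Reduction to periodic lower semicontinuous densities\<close>

text \<open>Large enough for the image of the unit square under every member of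
  \<open>unit_params\<close>, hence for every graph tested after reduction modulo the integer
  lattice.\<close>

definition window :: "R2 set" where
  "window = {-4<..<4} \<times> {-4<..<4}"

lemma open_window: "open window"
  unfolding window_def by (intro open_Times) auto

definition lattice_vec :: "int \<times> int \<Rightarrow> R2" where
  "lattice_vec = (\<lambda>(m, n). (of_int m, of_int n))"

text \<open>A fully periodic set has infinite area unless it is null; cutting it down to
  \<open>window\<close> keeps the area comparable to that of \<open>U\<close>.\<close>

definition periodized :: "R2 set \<Rightarrow> R2 set" where
  "periodized U = window \<inter> (\<Union>k. {z. z + lattice_vec k \<in> U})"

lemma open_periodized: "open U \<Longrightarrow> open (periodized U)"
  unfolding periodized_def
  by (intro open_Int open_window open_UN ballI open_vimage[of U "\<lambda>z. z + lattice_vec _", unfolded vimage_def])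
     (auto intro!: continuous_intros)

text \<open>Unfolding: after sum and integral are exchanged and the variable is translated, each
  point of \<open>U\<close> is counted once for every lattice translate of \<open>window\<close>
  that contains it.\<close>

lemma emeasure_periodized_le:
  assumes "open U"
  shows "emeasure lborel (periodized U) \<le> 100 * emeasure lborel U"
proof -
  have [measurable]: "U \<in> sets borel" "window \<in> sets borel" "periodized U \<in> sets borel"
    using assms open_window open_periodized by auto
  have [measurable]: "(\<lambda>z. z + v) \<in> borel_measurable borel" "(\<lambda>z. z - v) \<in> borel_measurable borel" for v :: R2
    by measurable
  have "emeasure lborel (periodized U) = (\<integral>\<^sup>+z. indicator (periodized U) z \<partial>lborel)" by simp
  also have "\<dots> \<le> (\<integral>\<^sup>+z. \<integral>\<^sup>+k. indicator U (z + lattice_vec k) * indicator window z \<partial>count_space UNIV \<partial>lborel)"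
  proof (rule nn_integral_mono)
    fix z
    show "indicator (periodized U) z \<le> (\<integral>\<^sup>+k. indicator U (z + lattice_vec k) * indicator window z \<partial>count_space UNIV)"
    proof (cases "z \<in> periodized U")
      case True
      then obtain k where k: "z \<in> window" "z + lattice_vec k \<in> U" by (auto simp: periodized_def)
      have "indicator (periodized U) z \<le> (indicator U (z + lattice_vec k) * indicator window z :: ennreal)"
        using k by (auto simp: indicator_def)
      also have "\<dots> \<le> (\<integral>\<^sup>+k. indicator U (z + lattice_vec k) * indicator window z \<partial>count_space UNIV)"
        by (rule nn_integral_ge_point) simp
      finally show ?thesis .
    qed simp
  qed
  also have "\<dots> = (\<integral>\<^sup>+k. \<integral>\<^sup>+z. indicator U (z + lattice_vec k) * indicator window z \<partial>lborel \<partial>count_space UNIV)"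
    by (rule nn_integral_count_space_nn_integral) auto
  also have "\<dots> = (\<integral>\<^sup>+k. \<integral>\<^sup>+z. indicator U z * indicator window (z - lattice_vec k) \<partial>lborel \<partial>count_space UNIV)"
  proof (rule nn_integral_cong)
    fix k :: "int \<times> int"
    let ?P = "(of_int (fst k), of_int (snd k), 1, 0, 1) :: real \<times> real \<times> real \<times> real \<times> real"
    have P: "?P \<in> rigid_params" by (simp add: rigid_params_def)
    have e: "rigid ?P z = z + lattice_vec k" for z
      by (cases z, cases k) (simp add: rigid_def lattice_vec_def)
    have "(\<integral>\<^sup>+z. indicator U (rigid ?P z) * indicator window (rigid ?P z - lattice_vec k) \<partial>lborel)
        = (\<integral>\<^sup>+z. indicator U z * indicator window (z - lattice_vec k) \<partial>lborel :: ennreal)"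
      by (rule area_preserving_nn_integral[OF area_preserving_rigid[OF P],
            where h="\<lambda>z. indicator U z * indicator window (z - lattice_vec k)"]) measurable
    then show "(\<integral>\<^sup>+z. indicator U (z + lattice_vec k) * indicator window z \<partial>lborel)
        = (\<integral>\<^sup>+z. indicator U z * indicator window (z - lattice_vec k) \<partial>lborel :: ennreal)"
      by (simp add: e)
  qed
  also have "\<dots> = (\<integral>\<^sup>+z. \<integral>\<^sup>+k. indicator U z * indicator window (z - lattice_vec k) \<partial>count_space UNIV \<partial>lborel)"
    by (rule nn_integral_count_space_nn_integral[symmetric]) auto
  also have "\<dots> \<le> (\<integral>\<^sup>+z. 100 * indicator U z \<partial>lborel)"
  proof (rule nn_integral_mono)
    fix z :: R2
    obtain x y where z: "z = (x, y)" by (cases z)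
    \<comment> \<open>In each coordinate the admissible lattice shifts lie in a range of at most 10
      integers, hence the factor 100.\<close>
    define C where "C v = {\<lfloor>v - 4\<rfloor>..\<lceil>v + 4\<rceil>}" for v :: real
    have C: "card (C v) \<le> 10" for v
    proof -
      have "of_int \<lceil>v + 4\<rceil> < v + 5" "of_int \<lfloor>v - 4\<rfloor> > v - 5" by linarith+
      then have "real_of_int (\<lceil>v + 4\<rceil> - \<lfloor>v - 4\<rfloor>) < 10" by simp
      then have "\<lceil>v + 4\<rceil> - \<lfloor>v - 4\<rfloor> < 10" by linarith
      then show ?thesis by (simp add: C_def)
    qed
    have sub: "{k. z - lattice_vec k \<in> window} \<subseteq> C x \<times> C y"
      by (auto simp: window_def lattice_vec_def C_def z) linarith+
    have "(\<integral>\<^sup>+k. indicator {k. z - lattice_vec k \<in> window} k \<partial>count_space UNIV)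
        = emeasure (count_space UNIV) {k. z - lattice_vec k \<in> window}" by simp
    also have "\<dots> \<le> emeasure (count_space UNIV) (C x \<times> C y)" by (intro emeasure_mono sub) auto
    also have "\<dots> = of_nat (card (C x) * card (C y))"
      by (subst emeasure_count_space) (auto simp: C_def card_cartesian_product)
    also have "\<dots> \<le> of_nat (10 * 10)" by (intro of_nat_mono mult_mono C) auto
    finally have count: "(\<integral>\<^sup>+k. indicator {k. z - lattice_vec k \<in> window} k \<partial>count_space UNIV) \<le> (100 :: ennreal)"
      by simp
    have "(\<integral>\<^sup>+k. indicator U z * indicator window (z - lattice_vec k) \<partial>count_space UNIV)
        = indicator U z * (\<integral>\<^sup>+k. indicator {k. z - lattice_vec k \<in> window} k \<partial>count_space UNIV)"
      by (subst nn_integral_cmult[symmetric]) (auto simp: indicator_def intro!: nn_integral_cong)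
    then show "(\<integral>\<^sup>+k. indicator U z * indicator window (z - lattice_vec k) \<partial>count_space UNIV) \<le> 100 * (indicator U z :: ennreal)"
      using mult_left_mono[OF count, of "indicator U z"] by (simp add: mult.commute)
  qed
  also have "\<dots> = 100 * emeasure lborel U" by (simp add: nn_integral_cmult_indicator)
  finally show ?thesis .
qed

lemma emeasure_superlevel_le:
  assumes [measurable]: "\<rho> \<in> borel_measurable borel" and \<beta>: "0 < \<beta>" and p: "0 < p"
    and le: "(\<integral>\<^sup>+z. ennpow p (\<rho> z) \<partial>lborel) \<le> ennreal c" and c: "0 \<le> c"
  shows "emeasure lborel {z. \<rho> z > ennreal \<beta>} \<le> ennreal (c * \<beta> powr (- p))"
proof -
  have S[measurable]: "{z. \<rho> z > ennreal \<beta>} \<in> sets lborel" by measurable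
  have "ennreal (\<beta> powr p) * emeasure lborel {z. \<rho> z > ennreal \<beta>}
      = (\<integral>\<^sup>+z. ennreal (\<beta> powr p) * indicator {z. \<rho> z > ennreal \<beta>} z \<partial>lborel)"
    by (rule nn_integral_cmult_indicator[symmetric]) measurable
  also have "\<dots> \<le> (\<integral>\<^sup>+z. ennpow p (\<rho> z) \<partial>lborel)"
  proof (rule nn_integral_mono)
    fix z
    show "ennreal (\<beta> powr p) * indicator {z. \<rho> z > ennreal \<beta>} z \<le> ennpow p (\<rho> z)"
    proof (cases "\<rho> z > ennreal \<beta>")
      case gt: True
      show ?thesis
      proof (cases "\<rho> z = \<infinity>")
        case False
        then obtain v where v: "\<rho> z = ennreal v" "0 \<le> v" by (cases "\<rho> z") auto
        then have "\<beta> < v" using gt \<beta> by (simp add: ennreal_less_iff)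
        then have "\<beta> powr p \<le> v powr p" using \<beta> p by (intro powr_mono2) auto
        then show ?thesis using gt v by (simp add: ennpow_def ennreal_leI)
      qed (simp add: ennpow_def)
    qed simp
  qed
  also note le
  finally have "ennreal (\<beta> powr (- p)) * (ennreal (\<beta> powr p) * emeasure lborel {z. \<rho> z > ennreal \<beta>})
      \<le> ennreal (\<beta> powr (- p)) * ennreal c" by (rule mult_left_mono) simp
  moreover have "ennreal (\<beta> powr (- p)) * ennreal (\<beta> powr p) = 1"
    using \<beta> by (subst ennreal_mult[symmetric]) (auto simp: powr_add[symmetric])
  moreover have "ennreal (\<beta> powr (- p)) * ennreal c = ennreal (c * \<beta> powr (- p))"
    using c by (subst ennreal_mult[symmetric]) (auto simp: mult.commute)
  ultimately show ?thesis by (simp only: mult.assoc[symmetric] mult_1)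
qed

text \<open>The sets where \<rho> exceeds a dyadic level \<open>\<beta> j\<close> are enclosed in
  open sets of at most twice the Chebyshev bound and periodized; \<open>r\<close> is at least the
  next level there. A supremum of positive multiples of indicators of open sets is lower
  semicontinuous, and using the next level makes \<open>r\<close> dominate every translate of \<rho>
  on \<open>window\<close> where its value exceeds 1/8.\<close>

lemma periodic_majorant:
  fixes p q c :: real
  assumes \<rho>[measurable]: "\<rho> \<in> borel_measurable borel" and q: "1 < q" "q < p" and c: "0 < c"
    and le: "(\<integral>\<^sup>+z. ennpow p (\<rho> z) \<partial>lborel) \<le> ennreal c"
  obtains r where "r \<in> borel_measurable borel" "\<And>\<alpha>. open {z. \<alpha> < r z}"
    "\<And>z k. z \<in> window \<Longrightarrow> \<rho> (z + lattice_vec k) \<le> ennreal (1/8) + r z"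
    "\<And>t. 0 < t \<Longrightarrow> (\<integral>\<^sup>+z. r z * indicator {z. r z > ennreal t} z \<partial>lborel)
      \<le> ennreal (c * (200 * 2 powr q * 8 powr (p - q) / (1 - 2 powr (q - p))) * t powr (1 - q))"
proof -
  \<comment> \<open>The lowest level is the additive constant 1/8, to which smaller values of \<rho>
    are left.\<close>
  define \<beta> :: "nat \<Rightarrow> real" where "\<beta> j = 2 ^ j / 8" for j
  have \<beta>: "0 < \<beta> j" "\<beta> (Suc j) = 2 * \<beta> j" for j by (auto simp: \<beta>_def)
  define l where "l j = c * \<beta> j powr (- p)" for j
  have l: "0 < l j" for j using c \<beta>(1)[of j] by (simp add: l_def)
  have "\<exists>U. open U \<and> {z. \<rho> z > ennreal (\<beta> j)} \<subseteq> U \<and> emeasure lborel U \<le> ennreal (2 * l j)" for j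
  proof -
    let ?E = "{z. \<rho> z > ennreal (\<beta> j)}"
    have Em[measurable]: "?E \<in> sets borel" by measurable
    obtain U where U: "open U" "?E \<subseteq> U" "emeasure lborel (U - ?E) < ennreal (l j)"
      using outer_regular_lborel[OF Em l] by blast
    have [measurable]: "U \<in> sets borel" using U by auto
    have "emeasure lborel U = emeasure lborel (?E \<union> (U - ?E))" using U(2) by (simp add: Un_absorb1)
    also have "\<dots> \<le> emeasure lborel ?E + emeasure lborel (U - ?E)" by (rule emeasure_subadditive) auto
    also have "\<dots> \<le> ennreal (l j) + ennreal (l j)"
      using emeasure_superlevel_le[OF \<rho> \<beta>(1) _ le, of j] q c U(3)
      by (intro add_mono) (auto simp: l_def)
    also have "\<dots> = ennreal (2 * l j)" using l[of j] by (subst ennreal_plus[symmetric]) auto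
    finally show ?thesis using U by blast
  qed
  then obtain U where U: "\<And>j. open (U j)" "\<And>j. {z. \<rho> z > ennreal (\<beta> j)} \<subseteq> U j"
      "\<And>j. emeasure lborel (U j) \<le> ennreal (2 * l j)" by metis
  define V where "V j = periodized (U j)" for j
  have V: "open (V j)" for j unfolding V_def by (intro open_periodized U)
  have [measurable]: "V j \<in> sets borel" for j using V by auto
  have Vm: "emeasure lborel (V j) \<le> ennreal (200 * l j)" for j
  proof -
    have "emeasure lborel (V j) \<le> 100 * emeasure lborel (U j)" unfolding V_def by (intro emeasure_periodized_le U)
    also have "\<dots> \<le> 100 * ennreal (2 * l j)" by (intro mult_left_mono U) auto
    also have "\<dots> = ennreal 100 * ennreal (2 * l j)" by simp
    also have "\<dots> = ennreal (100 * (2 * l j))" using l[of j] by (subst ennreal_mult) auto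
    also have "\<dots> = ennreal (200 * l j)" by simp
    finally show ?thesis .
  qed
  define b where "b j z = ennreal (\<beta> (Suc j)) * indicator (V j) z" for j z
  define r where "r z = (SUP j. b j z)" for z
  have bm[measurable]: "b j \<in> borel_measurable borel" for j unfolding b_def by measurable
  have rm[measurable]: "r \<in> borel_measurable borel" unfolding r_def by measurable
  show ?thesis
  proof (rule that[OF rm])
    fix \<alpha> :: ennreal
    have "{z. \<alpha> < r z} = (\<Union>j\<in>{j. \<alpha> < ennreal (\<beta> (Suc j))}. V j)"
      by (auto simp: r_def less_SUP_iff b_def indicator_def split: if_splits)
    then show "open {z. \<alpha> < r z}" using V by auto
  next
    fix z k assume z: "z \<in> window"
    let ?v = "\<rho> (z + lattice_vec k)"
    have up: "ennreal (\<beta> (Suc j)) \<le> r z" if "ennreal (\<beta> j) < ?v" for j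
    proof -
      have "z \<in> V j" using that U(2)[of j] z unfolding V_def periodized_def by blast
      then have "b j z = ennreal (\<beta> (Suc j))" by (simp add: b_def)
      then show ?thesis unfolding r_def by (metis SUP_upper UNIV_I)
    qed
    show "?v \<le> ennreal (1/8) + r z"
    proof (rule ccontr)
      assume "\<not> ?thesis"
      then have big: "ennreal (1/8) + r z < ?v" by simp
      then have rfin: "r z < \<top>" and b0: "ennreal (1/8) < ?v" and rv: "r z < ?v"
        by (auto simp: less_top[symmetric] top_unique intro: le_less_trans[rotated])
      \<comment> \<open>Each level below the value of \<rho> forces \<open>r z\<close>, and hence
        that value, above the next level. So no level would stop the induction, and
        \<open>r z\<close> would be infinite.\<close>
      have all: "ennreal (\<beta> j) < ?v" for j
      proof (induction j)
        case 0 then show ?case using b0 by (simp add: \<beta>_def)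
      next
        case (Suc j) then show ?case using up rv le_less_trans by blast
      qed
      obtain x where x: "r z = ennreal x" "0 \<le> x" using rfin by (cases "r z") auto
      obtain n where "x * 8 < 2 ^ n" using real_arch_pow[of 2 "x * 8"] by auto
      then have "x < \<beta> (Suc n)" using x(2) by (simp add: \<beta>_def)
      then have "r z < ennreal (\<beta> (Suc n))" using x by (simp add: ennreal_lessI less_le_trans)
      then show False using up[OF all[of n]] by simp
    qed
  next
    fix t :: real assume t: "0 < t"
    \<comment> \<open>Where a level is at least \<open>t\<close>, it is at most
      \<open>t powr (1 - q)\<close> times its q-th power, because 1 - q < 0. Against the area bound
      this leaves a series in \<open>\<beta> j powr (q - p)\<close>, which is geometric since q <
      p.\<close>
    define a where "a j z = ennreal (t powr (1 - q) * \<beta> (Suc j) powr q) * indicator (V j) z" for j z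
    have am[measurable]: "a j \<in> borel_measurable borel" for j unfolding a_def by measurable
    have big: "b j z \<le> (\<Sum>j. a j z)" if "ennreal t \<le> b j z" for j z
    proof -
      have zV: "z \<in> V j"
      proof (rule ccontr)
        assume "z \<notin> V j"
        then show False using that t by (simp add: b_def)
      qed
      then have tb: "t \<le> \<beta> (Suc j)" using that \<beta>(1)[of "Suc j"] by (simp add: b_def)
      have "\<beta> (Suc j) = \<beta> (Suc j) powr (1 - q) * \<beta> (Suc j) powr q"
        using \<beta>(1)[of "Suc j"] by (simp add: powr_add[symmetric])
      also have "\<dots> \<le> t powr (1 - q) * \<beta> (Suc j) powr q"
        using tb t q by (intro mult_right_mono powr_mono2') auto
      finally have "b j z \<le> a j z" using zV by (simp add: b_def a_def ennreal_leI)
      also have "\<dots> \<le> (\<Sum>j. a j z)" using sum_le_suminf[of "\<lambda>j. a j z" "{j}"] by simp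
      finally show ?thesis .
    qed
    have "r z * indicator {z. r z > ennreal t} z \<le> (\<Sum>j. a j z)" for z
    proof (cases "r z > ennreal t")
      case True
      then obtain i where i: "ennreal t < b i z" by (auto simp: r_def less_SUP_iff)
      have "b j z \<le> (\<Sum>j. a j z)" for j
      proof (cases "ennreal t \<le> b j z")
        case False
        then have "b j z \<le> b i z" using i by (meson le_cases less_imp_le order_trans)
        also have "\<dots> \<le> (\<Sum>j. a j z)" using big i by (simp add: less_imp_le)
        finally show ?thesis .
      qed (rule big)
      then show ?thesis using True by (simp add: r_def SUP_le_iff)
    qed simp
    then have "(\<integral>\<^sup>+z. r z * indicator {z. r z > ennreal t} z \<partial>lborel) \<le> (\<integral>\<^sup>+z. (\<Sum>j. a j z) \<partial>lborel)"
      by (intro nn_integral_mono)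
    also have "\<dots> = (\<Sum>j. \<integral>\<^sup>+z. a j z \<partial>lborel)" by (rule nn_integral_suminf) simp
    also have "\<dots> = (\<Sum>j. ennreal (t powr (1 - q) * \<beta> (Suc j) powr q) * emeasure lborel (V j))"
      unfolding a_def by (intro suminf_cong nn_integral_cmult_indicator) auto
    also have "\<dots> \<le> (\<Sum>j. ennreal (c * 200 * 2 powr q * 8 powr (p - q) * t powr (1 - q) * (2 powr (q - p)) ^ j))"
    proof (rule suminf_le)
      fix j
      have "ennreal (t powr (1 - q) * \<beta> (Suc j) powr q) * emeasure lborel (V j)
          \<le> ennreal (t powr (1 - q) * \<beta> (Suc j) powr q) * ennreal (200 * l j)"
        by (intro mult_left_mono Vm) auto
      also have "\<dots> = ennreal (t powr (1 - q) * \<beta> (Suc j) powr q * (200 * l j))"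
        using l[of j] by (subst ennreal_mult) auto
      \<comment> \<open>Origin of the constants: 200 is 100 translates times 2 from the open
        enclosure, \<open>2 powr q\<close> comes from using the next level, and
        \<open>8 powr (p - q)\<close> from the 8 in \<open>\<beta>\<close>.\<close>
      also have "t powr (1 - q) * \<beta> (Suc j) powr q * (200 * l j)
          = c * 200 * 2 powr q * 8 powr (p - q) * t powr (1 - q) * (2 powr (q - p)) ^ j"
      proof -
        have "\<beta> (Suc j) powr q * \<beta> j powr (- p) = 2 powr q * \<beta> j powr (q - p)"
          using \<beta>(1)[of j] by (simp add: \<beta>(2) powr_mult powr_diff powr_minus divide_inverse)
        also have "\<beta> j powr (q - p) = 8 powr (p - q) * (2 powr (q - p)) ^ j"
        proof -
          have "\<beta> j powr (q - p) = (2 powr real j) powr (q - p) / 8 powr (q - p)"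
            unfolding \<beta>_def by (simp add: powr_divide powr_realpow)
          also have "(2 powr real j) powr (q - p) = (2 powr (q - p)) ^ j"
            by (simp add: powr_powr powr_power mult.commute)
          also have "(2 powr (q - p)) ^ j / 8 powr (q - p) = 8 powr (p - q) * (2 powr (q - p)) ^ j"
            using powr_minus_divide[of 8 "q - p"] by simp
          finally show ?thesis .
        qed
        finally show ?thesis by (simp add: l_def mult_ac)
      qed
      finally show "ennreal (t powr (1 - q) * \<beta> (Suc j) powr q) * emeasure lborel (V j)
        \<le> ennreal (c * 200 * 2 powr q * 8 powr (p - q) * t powr (1 - q) * (2 powr (q - p)) ^ j)" .
    qed auto
    also have "\<dots> = ennreal (c * 200 * 2 powr q * 8 powr (p - q) * t powr (1 - q) * (1 / (1 - 2 powr (q - p))))"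
    proof (rule suminf_ennreal_eq)
      have "2 powr (q - p) < 2 powr (0 :: real)" using q by (intro powr_less_mono) auto
      then show "(\<lambda>j. c * 200 * 2 powr q * 8 powr (p - q) * t powr (1 - q) * (2 powr (q - p)) ^ j)
          sums (c * 200 * 2 powr q * 8 powr (p - q) * t powr (1 - q) * (1 / (1 - 2 powr (q - p))))"
        by (intro sums_mult geometric_sums) simp
    qed (use c in auto)
    finally show "(\<integral>\<^sup>+z. r z * indicator {z. r z > ennreal t} z \<partial>lborel)
      \<le> ennreal (c * (200 * 2 powr q * 8 powr (p - q) / (1 - 2 powr (q - p))) * t powr (1 - q))"
      by (simp add: mult_ac)
  qed
qed

section \<open>Arbitrary isometric copies of the good graph, and the conclusion\<close>

lemma rigid_mod_lattice:
  assumes "P \<in> rigid_params"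
  obtains P' k where "P' \<in> unit_params" "\<And>z. rigid P z = rigid P' z + lattice_vec k"
proof -
  obtain a b c d s where P: "P = (a, b, c, d, s)" by (cases P)
  have "(frac a, frac b, c, d, s) \<in> unit_params"
    using assms by (auto simp: P unit_params_def rigid_params_def less_imp_le[OF frac_lt_1])
  moreover have "rigid P z = rigid (frac a, frac b, c, d, s) z + lattice_vec (\<lfloor>a\<rfloor>, \<lfloor>b\<rfloor>)" for z
    by (cases z) (simp add: P rigid_def lattice_vec_def frac_def)
  ultimately show ?thesis by (rule that)
qed

lemma rigid_unit_in_window:
  assumes "P \<in> unit_params" "x \<in> {0..1}" "y \<in> {0..1}"
  shows "rigid P (x, y) \<in> window"
proof -
  obtain a b c d s where P: "P = (a, b, c, d, s)" by (cases P)
  have ab: "0 \<le> a" "a \<le> 1" "0 \<le> b" "b \<le> 1" and cd: "\<bar>c\<bar> \<le> 1" "\<bar>d\<bar> \<le> 1" and s: "\<bar>s\<bar> = 1"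
    using assms(1) abs_le_1_of_sum_squares[of c d] by (auto simp: P unit_params_def rigid_params_def)
  have prod: "\<bar>u * v\<bar> \<le> 1" if "\<bar>u\<bar> \<le> 1" "v \<in> {0..1}" for u v :: real
    unfolding abs_mult using that mult_mono[of "\<bar>u\<bar>" 1 "\<bar>v\<bar>" 1] by auto
  have sum: "-4 < p + u - v \<and> p + u - v < 4" "-4 < p + u + v \<and> p + u + v < 4"
    if "0 \<le> p" "p \<le> 1" "\<bar>u\<bar> \<le> 1" "\<bar>v\<bar> \<le> 1" for p u v :: real
    using that by linarith+
  have "\<bar>s * d\<bar> \<le> 1" "\<bar>s * c\<bar> \<le> 1" using cd s by (auto simp: abs_mult)
  then show ?thesis
    using sum(1)[OF ab(1,2) prod prod] sum(2)[OF ab(3,4) prod prod] cd assms(2,3)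
    by (simp add: P rigid_def window_def)
qed

text \<open>The parametrisation by the first coordinate is 2-Lipschitz, so the integral is at most 2
  (1/8 + 1/4) = 3/4: the additive constant of the majorant plus the bound along the good
  graph.\<close>

lemma curve_integral_rigid_graph_less_1:
  assumes \<rho>: "\<rho> \<in> borel_measurable borel" and r[measurable]: "r \<in> borel_measurable borel"
    and dom: "\<And>z k. z \<in> window \<Longrightarrow> \<rho> (z + lattice_vec k) \<le> ennreal (1/8) + r z"
    and f: "1-lipschitz_on UNIV f" "\<And>x. f x \<in> {0..1}"
      "\<And>P. P \<in> unit_params \<Longrightarrow> (\<integral>\<^sup>+x. r (rigid P (x, f x)) * indicator {0..<1} x \<partial>lborel) \<le> ennreal (1/4)"
    and \<iota>: "isometry_R2 \<iota>"
  shows "loc_rectifiable (\<iota> ` graph01 f)" "curve_integral_H1 (\<iota> ` graph01 f) \<rho> < 1"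
proof -
  define g where "g x = \<iota> (x, f x)" for x
  have img: "\<iota> ` graph01 f = g ` {0..1}" by (auto simp: graph01_def g_def)
  have g: "2-lipschitz_on UNIV g"
  proof (rule lipschitz_onI)
    fix x y :: real
    have "dist (g x) (g y) = sqrt ((dist x y)\<^sup>2 + (dist (f x) (f y))\<^sup>2)"
      using \<iota> by (simp add: g_def isometry_R2_def dist_Pair_Pair)
    also have "\<dots> \<le> dist x y + dist (f x) (f y)" by (rule sqrt_sum_squares_le_sum) auto
    also have "dist (f x) (f y) \<le> dist x y" using lipschitz_onD[OF f(1), of x y] by simp
    finally show "dist (g x) (g y) \<le> 2 * dist x y" by simp
  qed simp
  show "loc_rectifiable (\<iota> ` graph01 f)"
    unfolding img by (rule loc_rectifiable_lipschitz_image[OF g]) simp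
  have fm[measurable]: "f \<in> borel_measurable borel"
    using f(1) lipschitz_on_continuous_on borel_measurable_continuous_onI by blast
  obtain P where P: "P \<in> rigid_params" "\<iota> = rigid P" using isometry_R2_eq_rigid[OF \<iota>] by blast
  obtain P' k where P': "P' \<in> unit_params" "\<And>z. rigid P z = rigid P' z + lattice_vec k"
    using rigid_mod_lattice[OF P(1)] by blast
  \<comment> \<open>The strips live over the half-open interval; the missing endpoint is a null
    set.\<close>
  have ae: "AE x in lborel. \<rho> (g x) * indicator {0..1} x \<le>
      ennreal (1/8) * indicator {0..<1} x + r (rigid P' (x, f x)) * indicator {0..<1} x"
    using AE_lborel_singleton[of "1 :: real"]
  proof eventually_elim
    case (elim x)
    show ?case
    proof (cases "x \<in> {0..<1}")
      case True
      then have "rigid P' (x, f x) \<in> window" using f(2) by (intro rigid_unit_in_window P') auto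
      from dom[OF this, of k] show ?thesis using True by (simp add: g_def P P' indicator_def)
    next
      case False
      then show ?thesis using elim by (auto simp: indicator_def)
    qed
  qed
  have "curve_integral_H1 (\<iota> ` graph01 f) \<rho> \<le> ennreal 2 * (\<integral>\<^sup>+x. \<rho> (g x) * indicator {0..1} x \<partial>lborel)"
    unfolding img by (rule curve_integral_H1_lipschitz_le[OF g _ \<rho>]) simp
  also have "\<dots> \<le> ennreal 2 * (\<integral>\<^sup>+x. ennreal (1/8) * indicator {0..<1} x + r (rigid P' (x, f x)) * indicator {0..<1} x \<partial>lborel)"
    by (intro mult_left_mono nn_integral_mono_AE ae) auto
  also have "\<dots> = ennreal 2 * (ennreal (1/8) + (\<integral>\<^sup>+x. r (rigid P' (x, f x)) * indicator {0..<1} x \<partial>lborel))"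
    by (subst nn_integral_add) (auto simp: nn_integral_cmult_indicator)
  also have "\<dots> \<le> ennreal 2 * (ennreal (1/8) + ennreal (1/4))"
    by (intro mult_left_mono add_mono f(3) P') auto
  also have "\<dots> = ennreal 2 * ennreal (1/8 + 1/4)" by (subst ennreal_plus) auto
  also have "\<dots> = ennreal (2 * (1/8 + 1/4))" by (rule ennreal_mult[symmetric]) auto
  also have "\<dots> < 1" by (simp add: ennreal_less_one_iff)
  finally show "curve_integral_H1 (\<iota> ` graph01 f) \<rho> < 1" .
qed

theorem theorem1p1:
  fixes p :: real
  assumes "p > 3"
  shows "\<exists>c > 0. \<forall>\<Gamma> :: R2 set set.
     (\<forall>\<gamma>\<in>\<Gamma>. is_curve \<gamma>) \<and>
     (\<forall>f. f ` {0..1} \<subseteq> {0..1} \<and> 1-lipschitz_on {0..1} f \<longrightarrow>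
        (\<exists>\<iota>. isometry_R2 \<iota> \<and> \<iota> ` graph01 f \<in> \<Gamma>))
     \<longrightarrow> modulus p \<Gamma> \<ge> ennreal c"
proof -
  \<comment> \<open>An exponent strictly between 3 and p: q > 3 serves the refinement, q < p the
    geometric series of the majorant.\<close>
  define q where "q = (3 + p) / 2"
  have q: "3 < q" "q < p" using assms by (auto simp: q_def)
  define \<eta> where "\<eta> = (1 - 3 / q) / 8"
  have \<eta>: "0 < \<eta>" "\<eta> < 1" using q by (auto simp: \<eta>_def field_simps)
  obtain w where w: "0 < w" "\<And>v. 0 < v \<Longrightarrow> v \<le> w \<Longrightarrow> small_scale \<eta> v"
  proof -
    obtain b where b: "0 < b" "\<And>v. 0 < v \<Longrightarrow> v < b \<Longrightarrow> small_scale \<eta> v"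
      using eventually_small_scale[OF \<eta>] unfolding eventually_at_right_field by auto
    show ?thesis by (rule that[of "b / 2"]) (use b in auto)
  qed
  define C where "C = 200 * 2 powr q * 8 powr (p - q) / (1 - 2 powr (q - p))"
  have C: "0 < C"
  proof -
    have "2 powr (q - p) < 2 powr (0 :: real)" using q by (intro powr_less_mono) auto
    then show ?thesis by (simp add: C_def)
  qed
  \<comment> \<open>\<open>C\<close> is the constant of \<open>periodic_majorant\<close>, so energy
    at most c = \<kappa> / C gives tails with factor \<kappa>. The bound 1 yields
    \<open>tail_bound\<close>, the other makes the initial strip of width \<open>w\<close> light.
    All these quantities are determined by \<open>p\<close>.\<close>
  define \<kappa> where "\<kappa> = min 1 (w * (1/16) powr q)"
  have \<kappa>: "0 < \<kappa>" "\<kappa> \<le> 1" "\<kappa> \<le> w * (1/16) powr q" using w by (auto simp: \<kappa>_def)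
  define c where "c = \<kappa> / C"
  have c: "0 < c" "c * C = \<kappa>" using \<kappa> C by (auto simp: c_def)
  have "modulus p \<Gamma> \<ge> ennreal c"
    if curves: "\<forall>f. f ` {0..1} \<subseteq> {0..1} \<and> 1-lipschitz_on {0..1} f \<longrightarrow> (\<exists>\<iota>. isometry_R2 \<iota> \<and> \<iota> ` graph01 f \<in> \<Gamma>)" for \<Gamma>
    unfolding modulus_def
  proof (rule INF_greatest, rule ccontr)
    fix \<rho> assume adm: "\<rho> \<in> admissible \<Gamma>" and "\<not> ennreal c \<le> (\<integral>\<^sup>+x. ennpow p (\<rho> x) \<partial>lborel)"
    then have le: "(\<integral>\<^sup>+x. ennpow p (\<rho> x) \<partial>lborel) \<le> ennreal c" by simp
    have \<rho>: "\<rho> \<in> borel_measurable borel" using adm by (simp add: admissible_def)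
    obtain r where r[measurable]: "r \<in> borel_measurable borel" and lsc: "\<And>\<alpha>. open {z. \<alpha> < r z}"
      and dom: "\<And>z k. z \<in> window \<Longrightarrow> \<rho> (z + lattice_vec k) \<le> ennreal (1/8) + r z"
      and tail: "\<And>t. 0 < t \<Longrightarrow> (\<integral>\<^sup>+z. r z * indicator {z. r z > ennreal t} z \<partial>lborel) \<le> ennreal (\<kappa> * t powr (1 - q))"
      using periodic_majorant[OF \<rho> _ q(2) c(1) le, folded C_def, unfolded c(2)] q(1) by auto
    have tb: "tail_bound q r"
      unfolding tail_bound_def
    proof (intro conjI allI impI r)
      fix t :: real assume "0 < t"
      from tail[OF this] show "(\<integral>\<^sup>+z. r z * indicator {z. r z > ennreal t} z \<partial>lborel) \<le> ennreal (t powr (1 - q))"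
        using \<kappa> by (elim order_trans) (intro ennreal_leI mult_left_le_one_le; simp)
    qed
    have mass: "strip_integral {0..<1} (\<lambda>_. 0) w (\<lambda>z. r (rigid P z)) \<le> ennreal (w * (1/8))"
      if P: "P \<in> unit_params" for P
    proof -
      have P': "P \<in> rigid_params" using P by (simp add: unit_params_def)
      have "strip_integral {0..<1} (\<lambda>_. 0) w (\<lambda>z. r (rigid P z))
          = (\<integral>\<^sup>+z. r (rigid P z) * indicator (strip {0..<1} (\<lambda>_. 0) w) z \<partial>lborel)"
        by (rule strip_integral_eq_plane) auto
      \<comment> \<open>Truncation at 1/16: the part below this level and the tail contribute at
        most w/16 each.\<close>
      also have "\<dots> \<le> ennreal (1/16 * w + \<kappa> * (1/16) powr (1 - q))"
      proof (rule nn_integral_indicator_le_tail)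
        show "emeasure lborel (strip {0..<1} (\<lambda>_. 0) w) \<le> ennreal w"
          using w(1) by (subst emeasure_strip) auto
        show "(\<integral>\<^sup>+z. r (rigid P z) * indicator {z. r (rigid P z) > ennreal (1/16)} z \<partial>lborel) \<le> ennreal (\<kappa> * (1/16) powr (1 - q))"
          using tail[of "1/16"] by (subst nn_integral_tail_rigid[OF r P']) simp
      qed (use w \<kappa> in auto)
      also have "\<dots> \<le> ennreal (w * (1/8))"
      proof (rule ennreal_leI)
        have "\<kappa> * (1/16) powr (1 - q) \<le> w * (1/16) powr q * (1/16) powr (1 - q)"
          using \<kappa> by (intro mult_right_mono) auto
        also have "\<dots> = w * (1/16)" by (simp add: mult.assoc powr_add[symmetric])
        finally show "1/16 * w + \<kappa> * (1/16) powr (1 - q) \<le> w * (1/8)" by simp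
      qed
      finally show ?thesis .
    qed
    obtain f where f: "1-lipschitz_on UNIV f" "\<And>x. f x \<in> {0..1}"
      "\<And>P. P \<in> unit_params \<Longrightarrow> (\<integral>\<^sup>+x. r (rigid P (x, f x)) * indicator {0..<1} x \<partial>lborel) \<le> ennreal (1/4)"
      using good_graph_exists[OF q(1) tb lsc w[unfolded \<eta>_def] mass] by blast
    have "f ` {0..1} \<subseteq> {0..1}" "1-lipschitz_on {0..1} f"
      using f(2) lipschitz_on_subset[OF f(1)] by auto
    then obtain \<iota> where \<iota>: "isometry_R2 \<iota>" "\<iota> ` graph01 f \<in> \<Gamma>" using curves by blast
    note small = curve_integral_rigid_graph_less_1[OF \<rho> r dom f \<iota>(1)]
    have "curve_integral_H1 (\<iota> ` graph01 f) \<rho> \<ge> 1"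
      using adm \<iota>(2) small(1) by (simp add: admissible_def)
    with small(2) show False by simp
  qed
  with c(1) show ?thesis by blast
qed

end
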